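(* Let $n\ge 2$, $m\ge 1$ be integers, let $\Omega\subset\mathbb{R}^n$ be a bounded open set, and let $p,q,\tau_1,\tau_2$ satisfy $1<p<n$, $p\le q$, $1<\tau_1,\tau_2\le+\infty$ and $$q<p^*\frac{n}{p(n+1)},\qquad \tau_1>\frac np,\qquad \tau_2\ge\frac{q}{q-1},$$ where $p^*=\frac{np}{n-p}$. Let $A_i^\alpha:\Omega\times\mathbb{R}^{m\times n}\to\mathbb{R}$, $1\le i\le n$, $1\le\alpha\le m$, be Carathéodory functions such that, for some constants $\nu,M>0$ and some non-negative functions $a\in L^{\tau_1}_{\rm loc}(\Omega)$ and $b\in L^{\tau_2}_{\rm loc}(\Omega)$, for every $x\in\Omega$, every $z\in\mathbb{R}^{m\times n}$ and every $\alpha\in\{1,\dots,m\}$, $$\nu|z^\alpha|^p-a(x)\le\sum_{i=1}^nA_i^\alpha(x,z)z_i^\alpha,\qquad \sum_{i=1}^n|A_i^\alpha(x,z)|\le M\left(|z|^{q-1}+b(x)\right).$$ Then any weak solution $u\in W^{1,q}_{\rm loc}(\Omega;\mathbb{R}^m)$ of the system $$\sum_{i=1}^n\frac{\partial}{\partial x_i}\left(A_i^\alpha(x,Du(x))\right)=0,\qquad 1\le\alpha\le m,$$ is locally bounded in $\Omega$.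
   Context: For $z\in\mathbb{R}^{m\times n}$, $z^\alpha=(z^\alpha_1,\dots,z^\alpha_n)$ denotes the $\alpha$-th row of $z$, $z_i^\alpha$ its entries, and $|\cdot|$ the Euclidean norm. For $u=(u^1,\dots,u^m)$, $Du$ is the $m\times n$ matrix with entries $(Du)^\alpha_i=\partial u^\alpha/\partial x_i$. A function $u\in W^{1,q}_{\rm loc}(\Omega;\mathbb{R}^m)$ is a weak solution of the system if $$\int_B\sum_{\beta=1}^m\sum_{i=1}^nA_i^\beta(x,Du(x))\,D_i\psi^\beta(x)\,dx=0$$ for every open set $B\Subset\Omega$ and every $\psi\in W^{1,q}_0(B;\mathbb{R}^m)$. Locally bounded means $u\in L^\infty_{\rm loc}(\Omega;\mathbb{R}^m)$. *)

theory Defs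
  imports "HOL-Analysis.Analysis"
begin

text \<open>
  Points of \<open>R^n\<close> have type \<^typ>\<open>real^'n\<close>, so that \<open>n = CARD('n)\<close>. An \<open>m \<times> n\<close> matrix \<open>z\<close> has
  type \<^typ>\<open>real^'n^'m\<close>: \<open>z $ \<alpha>\<close> is the row \<open>z\<^sup>\<alpha>\<close>, \<open>z $ \<alpha> $ i\<close> the entry \<open>z\<^sup>\<alpha>\<^sub>i\<close>, and
  \<^const>\<open>norm\<close> is the Euclidean (Frobenius) norm.
  Elements of Lebesgue and Sobolev spaces are functions on all of \<open>R^n\<close>, of which only the
  values on the domain matter; they are not identified when equal almost everywhere.
\<close>

subsection \<open>Lebesgue spaces\<close>

definition Lp_on :: "ereal \<Rightarrow> (real^'n) set \<Rightarrow> (real^'n \<Rightarrow> 'b::euclidean_space) set" where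
  "Lp_on r S = {f. f \<in> borel_measurable (lebesgue_on S) \<and>
     (case r of
        ereal s \<Rightarrow> integrable (lebesgue_on S) (\<lambda>x. norm (f x) powr s)
      | PInfty \<Rightarrow> (\<exists>C. AE x in lebesgue_on S. norm (f x) \<le> C)
      | MInfty \<Rightarrow> False)}"

definition Lp_loc :: "ereal \<Rightarrow> (real^'n) set \<Rightarrow> (real^'n \<Rightarrow> 'b::euclidean_space) set" where
  "Lp_loc r \<Omega> = {f. \<forall>K. compact K \<and> K \<subseteq> \<Omega> \<longrightarrow> f \<in> Lp_on r K}"

definition Lp_norm :: "real \<Rightarrow> (real^'n) set \<Rightarrow> (real^'n \<Rightarrow> 'b::euclidean_space) \<Rightarrow> real" where
  "Lp_norm s S f = (LINT x|lebesgue_on S. norm (f x) powr s) powr (1 / s)"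

subsection \<open>Test functions\<close>

definition partial_deriv :: "'n::finite \<Rightarrow> (real^'n \<Rightarrow> real) \<Rightarrow> real^'n \<Rightarrow> real" where
  "partial_deriv i f x = frechet_derivative f (at x) (axis i 1)"

text \<open>
  All iterated partial derivatives are required to be (totally) differentiable everywhere, hence
  they are also continuous: this is \<open>C\<^sup>\<infinity>(R^n)\<close>.
\<close>

definition smooth :: "(real^'n \<Rightarrow> real) \<Rightarrow> bool" where
  "smooth f \<longleftrightarrow> (\<forall>is x. foldr partial_deriv is f differentiable (at x))"

text \<open>The space \<open>C\<^sub>c\<^sup>\<infinity>(\<Omega>)\<close>, its elements being extended by zero to \<open>R^n\<close>.\<close>

definition test_functions :: "(real^'n) set \<Rightarrow> (real^'n \<Rightarrow> real) set" where
  "test_functions \<Omega> = {\<phi>. smooth \<phi> \<and>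
     compact (closure {x. \<phi> x \<noteq> 0}) \<and> closure {x. \<phi> x \<noteq> 0} \<subseteq> \<Omega>}"

subsection \<open>Sobolev spaces\<close>

text \<open>
  The weak gradient is unique only up to null sets, so it is a relation between functions:
  \<open>Du x $ \<alpha> $ i\<close> is a representative of \<open>D\<^sub>i u\<^sup>\<alpha>\<close>.
\<close>

definition has_weak_gradient ::
    "(real^'n) set \<Rightarrow> (real^'n \<Rightarrow> real^'m) \<Rightarrow> (real^'n \<Rightarrow> real^'n^'m) \<Rightarrow> bool" where
  "has_weak_gradient \<Omega> u Du \<longleftrightarrow> u \<in> Lp_loc 1 \<Omega> \<and> Du \<in> Lp_loc 1 \<Omega> \<and>
     (\<forall>\<phi> \<in> test_functions \<Omega>. \<forall>\<alpha> i.
        (LINT x|lebesgue_on \<Omega>. u x $ \<alpha> * partial_deriv i \<phi> x) =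
        - (LINT x|lebesgue_on \<Omega>. Du x $ \<alpha> $ i * \<phi> x))"

text \<open>
  \<open>W1 q \<Omega> u Du\<close> means \<open>u \<in> W\<^sup>1\<^sup>,\<^sup>q(\<Omega>;R^m)\<close> with weak gradient \<open>Du\<close>; similarly for \<open>W1_loc\<close> and
  \<open>W1_0\<close>. The last space is the closure of \<open>C\<^sub>c\<^sup>\<infinity>(\<Omega>;R^m)\<close> in \<open>W\<^sup>1\<^sup>,\<^sup>q(\<Omega>;R^m)\<close>.
\<close>

definition W1 ::
    "real \<Rightarrow> (real^'n) set \<Rightarrow> (real^'n \<Rightarrow> real^'m) \<Rightarrow> (real^'n \<Rightarrow> real^'n^'m) \<Rightarrow> bool" where
  "W1 q \<Omega> u Du \<longleftrightarrow>
     has_weak_gradient \<Omega> u Du \<and> u \<in> Lp_on (ereal q) \<Omega> \<and> Du \<in> Lp_on (ereal q) \<Omega>"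

definition W1_loc ::
    "real \<Rightarrow> (real^'n) set \<Rightarrow> (real^'n \<Rightarrow> real^'m) \<Rightarrow> (real^'n \<Rightarrow> real^'n^'m) \<Rightarrow> bool" where
  "W1_loc q \<Omega> u Du \<longleftrightarrow>
     has_weak_gradient \<Omega> u Du \<and> u \<in> Lp_loc (ereal q) \<Omega> \<and> Du \<in> Lp_loc (ereal q) \<Omega>"

definition W1_0 ::
    "real \<Rightarrow> (real^'n) set \<Rightarrow> (real^'n \<Rightarrow> real^'m) \<Rightarrow> (real^'n \<Rightarrow> real^'n^'m) \<Rightarrow> bool" where
  "W1_0 q \<Omega> u Du \<longleftrightarrow> W1 q \<Omega> u Du \<and>
     (\<exists>\<phi> :: nat \<Rightarrow> real^'n \<Rightarrow> real^'m.
        (\<forall>k \<alpha>. (\<lambda>x. \<phi> k x $ \<alpha>) \<in> test_functions \<Omega>) \<and>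
        (\<lambda>k. Lp_norm q \<Omega> (\<lambda>x. \<phi> k x - u x)) \<longlonglongrightarrow> 0 \<and>
        (\<lambda>k. Lp_norm q \<Omega> (\<lambda>x. jacobian (\<phi> k) (at x) - Du x)) \<longlonglongrightarrow> 0)"

subsection \<open>The elliptic system\<close>

definition caratheodory ::
    "(real^'n) set \<Rightarrow> (real^'n \<Rightarrow> 'b::euclidean_space \<Rightarrow> real) \<Rightarrow> bool" where
  "caratheodory \<Omega> f \<longleftrightarrow>
     (\<forall>z. (\<lambda>x. f x z) \<in> borel_measurable (lebesgue_on \<Omega>)) \<and>
     (AE x in lebesgue_on \<Omega>. continuous_on UNIV (f x))"

definition compactly_contained :: "(real^'n) set \<Rightarrow> (real^'n) set \<Rightarrow> bool" where
  "compactly_contained B \<Omega> \<longleftrightarrow> compact (closure B) \<and> closure B \<subseteq> \<Omega>"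

text \<open>
  The argument order is \<open>A \<alpha> i x z\<close> for \<open>A\<^sub>i\<^sup>\<alpha>(x,z)\<close>. Changing \<open>Du\<close> or \<open>D\<psi>\<close> on a null set does not
  affect the integral, so the choice of representatives is immaterial.
\<close>

definition weak_solution ::
    "real \<Rightarrow> (real^'n) set \<Rightarrow> ('m::finite \<Rightarrow> 'n \<Rightarrow> real^'n \<Rightarrow> real^'n^'m \<Rightarrow> real) \<Rightarrow>
     (real^'n \<Rightarrow> real^'m) \<Rightarrow> bool" where
  "weak_solution q \<Omega> A u \<longleftrightarrow>
     (\<exists>Du. W1_loc q \<Omega> u Du \<and>
        (\<forall>B \<psi> D\<psi>. open B \<and> compactly_contained B \<Omega> \<and> W1_0 q B \<psi> D\<psi> \<longrightarrow>
           (LINT x|lebesgue_on B. (\<Sum>\<beta>\<in>UNIV. \<Sum>i\<in>UNIV. A \<beta> i x (Du x) * D\<psi> x $ \<beta> $ i)) = 0))"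

definition locally_bounded :: "(real^'n) set \<Rightarrow> (real^'n \<Rightarrow> real^'m) \<Rightarrow> bool" where
  "locally_bounded \<Omega> u \<longleftrightarrow> u \<in> Lp_loc \<infinity> \<Omega>"

definition sobolev_exponent :: "real \<Rightarrow> real \<Rightarrow> real" where
  "sobolev_exponent n p = n * p / (n - p)"

end

theory Submission
  imports Defs
begin

text \<open>
  Testing the system with vector fields that have a single nonzero component decouples it: each
  \<open>u\<^sup>\<alpha>\<close> satisfies a scalar equation \<open>div G = 0\<close> with \<open>G\<^sub>i = A\<^sub>i\<^sup>\<alpha>(x,Du)\<close>, where
  \<open>G \<in> L\<^sup>q\<^sup>/\<^sup>(\<^sup>q\<^sup>-\<^sup>1\<^sup>)\<close> locally is treated as given data, so that the growth of \<open>A\<close> in the other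
  components no longer matters. With a cutoff \<open>\<eta>\<close>, the test function \<open>\<eta> (u\<^sup>\<alpha> - k)\<^sub>+\<close> yields the Caccioppoli inequality
  \<open>\<nu> \<integral>\<^bsub>{u\<^sup>\<alpha> > k}\<^esub> \<eta> |Du\<^sup>\<alpha>|\<^sup>p \<le> \<integral>\<^bsub>{u\<^sup>\<alpha> > k}\<^esub> \<eta> a + \<integral> |D\<eta>| |G| (u\<^sup>\<alpha> - k)\<^sub>+\<close>.
  Combined with a Sobolev inequality into \<open>L\<^sup>r\<close>, \<open>r < p\<^sup>*\<close>, it gives for the truncated \<open>L\<^sup>r\<close> integrals \<open>Y\<^sub>h\<close>
  on shrinking balls a recursion \<open>Y\<^sub>h\<^sub>+\<^sub>1 \<le> C B\<^sup>h Y\<^sub>h\<^sup>1\<^sup>+\<^sup>\<delta>\<close>. Here \<open>\<delta> > 0\<close> for \<open>r\<close> close to \<open>p\<^sup>*\<close>, because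
  \<open>\<tau>\<^sub>1 > n/p\<close> and \<open>q < p\<^sup>*/p\<close>. De Giorgi's iteration then bounds \<open>u\<^sup>\<alpha>\<close> from above, and the same
  argument applies to \<open>-u\<^sup>\<alpha>\<close>.
\<close>

subsection \<open>Flat functions\<close>

text \<open>The lower bound for \<open>A\<close> involves only the row \<open>z $ \<alpha>\<close>,
  so the equation with index \<alpha> controls the gradient of one component at a time. The price is
  a flux \<open>G\<close> that cannot be absorbed on the left. The Hoelder inequality leaves the
  \<open>L^q\<close> norm of the truncation, that is, the power \<open>1 / q\<close> of
  \<open>Y\<close>. After the Sobolev inequality has raised everything to \<open>r / p\<close>, the
  energy term, the flux term and the term with \<open>a\<close> carry the powers
  \<open>r / p\<close>, \<open>r / (p q)\<close> and \<open>(1 - 1 / \<tau>) r / p\<close> of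
  \<open>Y\<close>. All of them exceed 1 for some subcritical \<open>r\<close> exactly when
  \<open>p q\<close> is below the critical exponent and \<open>\<tau> > n / p\<close>. Both
  conditions are strict, so an inequality short of the end point is enough, and it follows from
  averaging over dyadic balls. The second constraint is that a truncated Sobolev function must be
  reached by smooth test functions. Truncation is therefore applied to mollifications, and only the
  integrals pass to the limit. Bump, cutoff and truncation are all built from
  \<open>exp (- 1 / t)\<close>, whose derivatives are explicit; equalities such as "equal to 1 on
  the inner ball" are relaxed to bounds with a factor \<open>exp (- 1)\<close>, which only changes
  constants.\<close>

definition flat :: "real poly \<Rightarrow> real \<Rightarrow> real" where
  "flat P t = (if t > 0 then poly P (1 / t) * exp (- 1 / t) else 0)"

lemma poly_times_exp_tendsto_0: "((\<lambda>z. poly P z * exp (- z)) \<longlongrightarrow> 0) at_top" for P :: "real poly"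
proof -
  have "((\<lambda>z. \<Sum>i\<le>degree P. coeff P i * (z ^ i / exp z)) \<longlongrightarrow> (\<Sum>i\<le>degree P. coeff P i * 0)) at_top"
    by (intro tendsto_sum tendsto_mult tendsto_const tendsto_power_div_exp_0)
  then show ?thesis
    by (simp add: poly_altdef sum_distrib_right exp_minus divide_inverse mult.assoc)
qed

lemma flat_tendsto_0: "(flat P \<longlongrightarrow> 0) (at 0)"
proof -
  have "((\<lambda>t. poly P (inverse t) * exp (- inverse t)) \<longlongrightarrow> 0) (at_right 0)"
    using filterlim_compose[OF poly_times_exp_tendsto_0 filterlim_inverse_at_top_right] .
  then have "(flat P \<longlongrightarrow> 0) (at_right 0)"
    by (rule Lim_transform_eventually)
       (auto simp: flat_def eventually_at_filter divide_inverse)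
  moreover have "(flat P \<longlongrightarrow> 0) (at_left 0)"
    by (rule Lim_transform_eventually[OF tendsto_const])
       (auto simp: flat_def eventually_at_filter)
  ultimately show ?thesis
    by (simp add: filterlim_split_at)
qed

text \<open>With \<open>z = 1 / t\<close>, the derivative of \<open>P(z) exp (- z)\<close> in
  \<open>t\<close> is \<open>z^2 (P(z) - P'(z)) exp (- z)\<close>. The polynomial parameter is
  carried along so that the family is closed under differentiation.\<close>

lemma flat_has_derivative:
  "(flat P has_real_derivative flat ([:0, 0, 1:] * (P - pderiv P)) t) (at t)"
proof (cases t "0 :: real" rule: linorder_cases)
  case less
  have "((\<lambda>_. 0) has_real_derivative 0) (at t)"
    by simp
  then have "(flat P has_real_derivative 0) (at t)"
    by (rule has_field_derivative_transform_within_open[where S = "{..<0}"])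
       (use less in \<open>auto simp: flat_def\<close>)
  then show ?thesis
    using less by (simp add: flat_def)
next
  case equal
  \<comment> \<open>Division by \<open>h\<close> multiplies the polynomial by its variable, so the
    difference quotient at 0 is itself a flat function, with polynomial
    \<open>pCons 0 P\<close>.\<close>
  have "((\<lambda>h. (flat P h - flat P 0) / (h - 0)) \<longlongrightarrow> 0) (at 0)"
    by (rule Lim_transform_eventually[OF flat_tendsto_0[of "pCons 0 P"]])
       (auto simp: flat_def eventually_at_filter)
  then show ?thesis
    using equal by (simp add: has_field_derivative_iff flat_def)
next
  case greater
  have "((\<lambda>t. poly P (1 / t) * exp (- 1 / t)) has_real_derivative
      flat ([:0, 0, 1:] * (P - pderiv P)) t) (at t)"
    using greater
    by (auto intro!: derivative_eq_intros poly_DERIV simp: flat_def)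
       (auto simp: field_simps power2_eq_square)
  then show ?thesis
    by (rule has_field_derivative_transform_within_open[where S = "{0<..}"])
       (use greater in \<open>auto simp: flat_def\<close>)
qed

lemma flat_nonneg: "0 \<le> flat 1 t"
  by (simp add: flat_def)

lemma flat_le_1: "flat 1 t \<le> 1"
  by (simp add: flat_def)

lemma flat_pos: "t > 0 \<Longrightarrow> 0 < flat 1 t"
  by (simp add: flat_def)

lemma flat_eq_0: "t \<le> 0 \<Longrightarrow> flat P t = 0"
  by (simp add: flat_def)

lemma flat_ge: "1 \<le> t \<Longrightarrow> exp (- 1) \<le> flat 1 t"
  by (simp add: flat_def)

text \<open>The derivative of \<open>flat 1\<close>: the polynomial \<open>X^2 (P - P')\<close> for
  \<open>P = 1\<close>.\<close>

abbreviation flat' :: "real \<Rightarrow> real" where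
  "flat' \<equiv> flat [:0, 0, 1:]"

lemma flat1_has_derivative: "(flat 1 has_real_derivative flat' t) (at t)"
  using flat_has_derivative[of 1 t] by (simp add: pderiv_1)

lemma flat'_nonneg: "0 \<le> flat' t"
  by (simp add: flat_def)

text \<open>In the variable \<open>z = 1 / t\<close> this is \<open>z^2 \<le> 2 exp z\<close>, read
  off from the exponential series. The 2 here turns into the 4 of
  \<open>gradient_cutoff_bound\<close>.\<close>

lemma flat'_le_2: "flat' t \<le> 2"
proof (cases "t > 0")
  case True
  define z where "z = 1 / t"
  have z: "z > 0" using True by (simp add: z_def)
  have "1 + z + z\<^sup>2 / 2 \<le> exp z"
    using exp_lower_Taylor_quadratic[of z] z by simp
  then have "z * z \<le> 2 * exp z"
    using z by (simp add: power2_eq_square)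
  then have "z * z * exp (- z) \<le> 2"
    by (simp add: exp_minus field_simps)
  then show ?thesis
    using True by (simp add: flat_def z_def)
qed (simp add: flat_def)

lemma continuous_flat: "continuous_on UNIV (flat P)"
  using flat_has_derivative by (meson DERIV_isCont continuous_at_imp_continuous_on)

subsection \<open>Smooth functions\<close>

definition gradient :: "(real^'n \<Rightarrow> real) \<Rightarrow> real^'n \<Rightarrow> real^'n" where
  "gradient f x = (\<chi> i. partial_deriv i f x)"

lemma partial_deriv_eqI: "(f has_derivative f') (at x) \<Longrightarrow> partial_deriv i f x = f' (axis i 1)"
  unfolding partial_deriv_def by (metis frechet_derivative_at)

lemma gradient_eqI: "(f has_derivative (\<lambda>h. g \<bullet> h)) (at x) \<Longrightarrow> gradient f x = g"
  by (simp add: gradient_def partial_deriv_eqI inner_axis vec_eq_iff)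

lemma has_derivative_gradient:
  fixes f :: "real^'n \<Rightarrow> real"
  assumes "f differentiable at x"
  shows "(f has_derivative (\<lambda>h. gradient f x \<bullet> h)) (at x)"
proof -
  have d: "(f has_derivative frechet_derivative f (at x)) (at x)"
    using assms by (simp add: frechet_derivative_works)
  then interpret linear "frechet_derivative f (at x)"
    by (rule has_derivative_linear)
  have "frechet_derivative f (at x) h = gradient f x \<bullet> h" for h
  proof -
    have "frechet_derivative f (at x) h = frechet_derivative f (at x) (\<Sum>i\<in>UNIV. h $ i *\<^sub>R axis i 1)"
      by (metis (no_types, lifting) basis_expansion scalar_mult_eq_scaleR sum.cong)
    also have "\<dots> = gradient f x \<bullet> h"
      by (simp add: sum scale inner_vec_def gradient_def partial_deriv_def mult.commute)
    finally show ?thesis .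
  qed
  then show ?thesis
    using d by (metis (no_types, lifting) has_derivative_eq_rhs ext)
qed

lemma partial_deriv_gradient: "partial_deriv i f x = gradient f x $ i"
  by (simp add: gradient_def)

text \<open>Smoothness is the largest set of differentiable functions that is closed under partial
  derivatives. A proof of smoothness thus reduces to exhibiting an invariant set, without handling
  lists of indices.\<close>

lemma smooth_coinduct:
  assumes "f \<in> S"
    and diff: "\<And>f x. f \<in> S \<Longrightarrow> f differentiable (at x)"
    and step: "\<And>f i. f \<in> S \<Longrightarrow> partial_deriv i f \<in> S"
  shows "smooth f"
proof -
  have "foldr partial_deriv is f \<in> S" for "is"
    by (induction "is") (auto simp: assms)
  then show ?thesis
    by (auto simp: smooth_def diff)
qed

lemma smooth_differentiable: "smooth f \<Longrightarrow> f differentiable (at x)"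
  unfolding smooth_def by (metis foldr.simps(1) id_apply)

lemma smooth_partial_deriv:
  assumes "smooth f"
  shows "smooth (partial_deriv i f)"
proof -
  \<comment> \<open>\<open>foldr\<close> applies the last index of the list first, so an inner
    derivative corresponds to an index appended at the end.\<close>
  have "foldr partial_deriv is (partial_deriv i f) = foldr partial_deriv (is @ [i]) f" for "is"
    by simp
  then show ?thesis
    using assms unfolding smooth_def by metis
qed

lemma smooth_has_derivative:
  "smooth f \<Longrightarrow> (f has_derivative (\<lambda>h. gradient f x \<bullet> h)) (at x)"
  by (simp add: has_derivative_gradient smooth_differentiable)

lemma smooth_continuous_on: "smooth f \<Longrightarrow> continuous_on S f"
  by (meson continuous_at_imp_continuous_on differentiable_imp_continuous_within smooth_differentiable)

lemma smooth_continuous_gradient: "smooth f \<Longrightarrow> continuous_on S (gradient f)"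
  unfolding gradient_def
  by (intro continuous_on_vec_lambda) (simp add: smooth_continuous_on smooth_partial_deriv)

text \<open>The algebra generated by the smooth functions and their compositions with \<^const>\<open>flat\<close> is
  closed under partial derivatives, so it consists of smooth functions.\<close>

inductive_set flat_algebra :: "(real^'n \<Rightarrow> real) set" where
  smooth: "smooth f \<Longrightarrow> f \<in> flat_algebra"
| flat: "smooth w \<Longrightarrow> (\<lambda>x. flat P (w x)) \<in> flat_algebra"
| add: "f \<in> flat_algebra \<Longrightarrow> g \<in> flat_algebra \<Longrightarrow> (\<lambda>x. f x + g x) \<in> flat_algebra"
| mult: "f \<in> flat_algebra \<Longrightarrow> g \<in> flat_algebra \<Longrightarrow> (\<lambda>x. f x * g x) \<in> flat_algebra"

lemma flat_comp_has_derivative: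
  assumes "(w has_derivative w') (at x)"
  shows "((\<lambda>x. flat P (w x)) has_derivative
      (\<lambda>h. flat ([:0, 0, 1:] * (P - pderiv P)) (w x) * w' h)) (at x)"
  using has_derivative_compose[OF assms flat_has_derivative[unfolded has_field_derivative_def]] .

lemma flat_algebra_derivative:
  assumes "f \<in> flat_algebra"
  shows "(\<forall>x. f differentiable (at x)) \<and> (\<forall>i. partial_deriv i f \<in> flat_algebra)"
  using assms
proof induction
  case (smooth f)
  then show ?case
    by (simp add: smooth_differentiable smooth_partial_deriv flat_algebra.smooth)
next
  case (flat w P)
  let ?P' = "[:0, 0, 1:] * (P - pderiv P)"
  have d: "((\<lambda>x. flat P (w x)) has_derivative (\<lambda>h. flat ?P' (w x) * (gradient w x \<bullet> h))) (at x)" for x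
    by (intro flat_comp_has_derivative smooth_has_derivative flat)
  have "partial_deriv i (\<lambda>x. flat P (w x)) = (\<lambda>x. flat ?P' (w x) * partial_deriv i w x)" for i
    by (intro ext) (simp add: partial_deriv_eqI[OF d] partial_deriv_gradient inner_axis)
  then show ?case
    using d flat_algebra.mult[OF flat_algebra.flat[OF flat, of ?P'] flat_algebra.smooth[OF smooth_partial_deriv[OF flat]]]
    unfolding differentiable_def by auto
next
  case (add f g)
  have d: "((\<lambda>x. f x + g x) has_derivative (\<lambda>h. gradient f x \<bullet> h + gradient g x \<bullet> h)) (at x)" for x
    using add by (intro has_derivative_add has_derivative_gradient) auto
  have "partial_deriv i (\<lambda>x. f x + g x) = (\<lambda>x. partial_deriv i f x + partial_deriv i g x)" for i
    by (intro ext) (simp add: partial_deriv_eqI[OF d] partial_deriv_gradient inner_axis)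
  moreover have "(\<lambda>x. partial_deriv i f x + partial_deriv i g x) \<in> flat_algebra" for i
    by (rule flat_algebra.add) (use add in blast)+
  ultimately show ?case
    using d unfolding differentiable_def by auto
next
  case (mult f g)
  have d: "((\<lambda>x. f x * g x) has_derivative (\<lambda>h. f x * (gradient g x \<bullet> h) + gradient f x \<bullet> h * g x)) (at x)" for x
  proof -
    have "f differentiable at x" "g differentiable at x"
      using mult by blast+
    from this[THEN has_derivative_gradient] show ?thesis
      by (rule has_derivative_mult)
  qed
  have "partial_deriv i (\<lambda>x. f x * g x) = (\<lambda>x. f x * partial_deriv i g x + partial_deriv i f x * g x)" for i
    by (intro ext) (simp only: partial_deriv_eqI[OF d] partial_deriv_gradient inner_axis inner_real_def mult_1_right)
  moreover have "(\<lambda>x. f x * partial_deriv i g x + partial_deriv i f x * g x) \<in> flat_algebra" for i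
    by (rule flat_algebra.add; rule flat_algebra.mult) (use mult in auto)
  ultimately show ?case
    using d unfolding differentiable_def by auto
qed

lemma smooth_flat_algebra: "f \<in> flat_algebra \<Longrightarrow> smooth f"
  by (rule smooth_coinduct[of f flat_algebra]) (auto dest: flat_algebra_derivative)

lemma smooth_add: "smooth f \<Longrightarrow> smooth g \<Longrightarrow> smooth (\<lambda>x. f x + g x)"
  by (rule smooth_flat_algebra, rule flat_algebra.add) (auto intro: flat_algebra.smooth)

lemma smooth_mult: "smooth f \<Longrightarrow> smooth g \<Longrightarrow> smooth (\<lambda>x. f x * g x)"
  by (rule smooth_flat_algebra, rule flat_algebra.mult) (auto intro: flat_algebra.smooth)

lemma smooth_flat: "smooth w \<Longrightarrow> smooth (\<lambda>x. flat P (w x))"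
  by (rule smooth_flat_algebra[OF flat_algebra.flat])

lemma smooth_const: "smooth (\<lambda>x. c)"
proof (rule smooth_coinduct[of _ "range (\<lambda>c x. c)"])
  show "partial_deriv i f \<in> range (\<lambda>c x. c)" if "f \<in> range (\<lambda>c x. c)" for i f
    using that by (auto simp: partial_deriv_def fun_eq_iff)
qed auto

lemma smooth_component: "smooth (\<lambda>x. x $ i)"
\<comment> \<open>Derivatives of a coordinate are constants, so adding the coordinate to the set of
  all smooth functions keeps that set invariant.\<close>
proof (rule smooth_coinduct[of _ "insert (\<lambda>x. x $ i) (Collect smooth)"])
  fix f :: "real^'a \<Rightarrow> real" and x :: "real^'a" and j
  assume f: "f \<in> insert (\<lambda>x. x $ i) (Collect smooth)"
  have d: "((\<lambda>x. x $ i) has_derivative (\<lambda>h. h $ i)) (at x)" for x :: "real^'a"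
    by (intro bounded_linear_imp_has_derivative bounded_linear_vec_nth)
  show "f differentiable at x"
    using f d smooth_differentiable unfolding differentiable_def by auto
  have "partial_deriv j (\<lambda>x. x $ i) = (\<lambda>x :: real^'a. axis j 1 $ i)"
    by (intro ext) (simp add: partial_deriv_eqI[OF d])
  then show "partial_deriv j f \<in> insert (\<lambda>x. x $ i) (Collect smooth)"
    using f by (auto simp: smooth_const smooth_partial_deriv)
qed simp

lemma smooth_sum: "finite I \<Longrightarrow> (\<And>i. i \<in> I \<Longrightarrow> smooth (f i)) \<Longrightarrow> smooth (\<lambda>x. \<Sum>i\<in>I. f i x)"
  by (induction rule: finite_induct) (auto simp: smooth_const smooth_add)

lemma smooth_diff_const: "smooth f \<Longrightarrow> smooth (\<lambda>x. f x - c)"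
  using smooth_add[of f "\<lambda>_. - c"] by (simp add: smooth_const)

lemma smooth_norm_square: "smooth (\<lambda>x. (norm (x - x0))\<^sup>2)"
proof -
  have "smooth (\<lambda>x. \<Sum>i\<in>UNIV. (x $ i - x0 $ i) * (x $ i - x0 $ i))"
    by (intro smooth_sum smooth_mult smooth_diff_const smooth_component) auto
  then show ?thesis
    by (simp add: power2_norm_eq_inner inner_vec_def)
qed

text \<open>
  A cutoff function for \<open>cball x0 s \<subseteq> ball x0 t\<close> that is only bounded below, by \<open>1/e\<close>, on the
  inner ball instead of being equal to 1 there.
\<close>

definition cutoff :: "real^'n \<Rightarrow> real \<Rightarrow> real \<Rightarrow> real^'n \<Rightarrow> real" where
  "cutoff x0 s t x = flat 1 ((t\<^sup>2 - (norm (x - x0))\<^sup>2) / (t\<^sup>2 - s\<^sup>2))"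

lemma smooth_cutoff: "smooth (cutoff x0 s t)"
proof -
  have "smooth (\<lambda>x. flat 1 ((norm (x - x0))\<^sup>2 * (- 1 / (t\<^sup>2 - s\<^sup>2)) + t\<^sup>2 / (t\<^sup>2 - s\<^sup>2)))"
    by (intro smooth_flat smooth_add smooth_mult smooth_const smooth_norm_square)
  moreover have "(norm (x - x0))\<^sup>2 * (- 1 / (t\<^sup>2 - s\<^sup>2)) + t\<^sup>2 / (t\<^sup>2 - s\<^sup>2)
      = (t\<^sup>2 - (norm (x - x0))\<^sup>2) / (t\<^sup>2 - s\<^sup>2)" for x
    by (simp add: diff_divide_distrib)
  ultimately show ?thesis
    unfolding cutoff_def[abs_def] by (simp only:)
qed

lemma cutoff_nonneg: "0 \<le> cutoff x0 s t x" and cutoff_le_1: "cutoff x0 s t x \<le> 1"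
  by (simp_all add: cutoff_def flat_nonneg flat_le_1)

lemma cutoff_eq_0:
  assumes "0 \<le> s" "s < t" "x \<notin> ball x0 t"
  shows "cutoff x0 s t x = 0"
proof -
  have "s\<^sup>2 < t\<^sup>2" using assms by (simp add: power_strict_mono)
  moreover have "t\<^sup>2 \<le> (norm (x - x0))\<^sup>2"
    using assms by (intro power_mono) (auto simp: dist_norm norm_minus_commute)
  ultimately show ?thesis
    by (simp add: cutoff_def flat_eq_0 divide_nonpos_pos)
qed

lemma cutoff_pos:
  assumes "0 \<le> s" "s < t" "x \<in> ball x0 t"
  shows "0 < cutoff x0 s t x"
proof -
  have "s\<^sup>2 < t\<^sup>2" using assms by (simp add: power_strict_mono)
  moreover have "(norm (x - x0))\<^sup>2 < t\<^sup>2"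
    using assms by (intro power_strict_mono) (auto simp: dist_norm norm_minus_commute)
  ultimately show ?thesis
    by (simp add: cutoff_def flat_pos)
qed

lemma cutoff_ge:
  assumes "0 \<le> s" "s < t" "x \<in> cball x0 s"
  shows "exp (- 1) \<le> cutoff x0 s t x"
proof -
  have "s\<^sup>2 < t\<^sup>2" using assms by (simp add: power_strict_mono)
  moreover have "(norm (x - x0))\<^sup>2 \<le> s\<^sup>2"
    using assms by (intro power_mono) (auto simp: dist_norm norm_minus_commute)
  ultimately show ?thesis
    by (simp add: cutoff_def flat_ge)
qed

text \<open>The chain rule gives length \<open>flat'(..) * 2 |x - x0| / (t^2 - s^2)\<close>. On the
  ball \<open>|x - x0| \<le> t\<close> and \<open>flat' \<le> 2\<close>, and
  \<open>t / (t + s) \<le> 1\<close> leaves \<open>4 / (t - s)\<close>. Off the ball the argument of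
  \<open>flat'\<close> is nonpositive.\<close>

lemma gradient_cutoff_bound:
  fixes x0 :: "real^'n"
  assumes "0 \<le> s" "s < t"
  shows "norm (gradient (cutoff x0 s t) x) \<le> 4 / (t - s)"
proof -
  have st: "s\<^sup>2 < t\<^sup>2" using assms by (simp add: power_strict_mono)
  define k where "k = 1 / (t\<^sup>2 - s\<^sup>2)"
  have k: "k > 0" using st by (simp add: k_def)
  let ?w = "k * (t\<^sup>2 - (norm (x - x0))\<^sup>2)"
  have "((\<lambda>x. k * (t\<^sup>2 - (norm (x - x0))\<^sup>2)) has_derivative (\<lambda>h. (- 2 * k) *\<^sub>R (x - x0) \<bullet> h)) (at x)"
    unfolding power2_norm_eq_inner
    by (rule derivative_eq_intros refl | simp add: inner_commute algebra_simps)+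
  from has_derivative_compose[OF this flat1_has_derivative[unfolded has_field_derivative_def]]
  have "(cutoff x0 s t has_derivative (\<lambda>h. (flat' ?w *\<^sub>R (- 2 * k) *\<^sub>R (x - x0)) \<bullet> h)) (at x)"
    unfolding cutoff_def[abs_def] by (simp add: k_def mult.assoc)
  then have eq: "gradient (cutoff x0 s t) x = flat' ?w *\<^sub>R (- 2 * k) *\<^sub>R (x - x0)"
    by (rule gradient_eqI)
  show ?thesis
  proof (cases "x \<in> ball x0 t")
    case True
    then have "norm (x - x0) \<le> t"
      by (simp add: dist_norm norm_minus_commute)
    then have "norm (gradient (cutoff x0 s t) x) \<le> 2 * (2 * k * t)"
      unfolding eq norm_scaleR
      by (intro mult_mono) (use k flat'_le_2[of ?w] flat'_nonneg[of ?w] assms in \<open>auto simp: abs_mult\<close>)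
    also have "\<dots> = 4 * t / ((t - s) * (t + s))"
      by (simp add: k_def power2_eq_square algebra_simps)
    also have "\<dots> = 4 / (t - s) * (t / (t + s))"
      by (simp only: times_divide_times_eq)
    also have "\<dots> \<le> 4 / (t - s) * 1"
      using assms by (intro mult_left_mono) auto
    finally show ?thesis by simp
  next
    case False
    then have "t\<^sup>2 \<le> (norm (x - x0))\<^sup>2"
      using assms by (intro power_mono) (auto simp: dist_norm norm_minus_commute)
    then have "flat' ?w = 0"
      using k by (simp add: flat_eq_0 mult_nonneg_nonpos)
    then show ?thesis
      unfolding eq using assms by simp
  qed
qed

subsection \<open>Powers\<close>

text \<open>The sum is at most twice the maximum. The crude constant \<open>2 powr q\<close> needs
  no convexity and serves for all exponents \<open>q \<ge> 0\<close>.\<close>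

lemma powr_add_le:
  fixes a b q :: real
  assumes "0 \<le> a" "0 \<le> b" "0 \<le> q"
  shows "(a + b) powr q \<le> 2 powr q * (a powr q + b powr q)"
proof -
  have "(a + b) powr q \<le> (2 * max a b) powr q"
    using assms by (intro powr_mono2) auto
  also have "\<dots> = 2 powr q * max a b powr q"
    using assms by (simp add: powr_mult)
  also have "\<dots> \<le> 2 powr q * (a powr q + b powr q)"
    by (intro mult_left_mono) (auto simp: max_def)
  finally show ?thesis .
qed

lemma powr_le_one_plus_powr:
  fixes a p q :: real
  assumes "0 \<le> a" "0 \<le> p" "p \<le> q"
  shows "a powr p \<le> 1 + a powr q"
proof (cases "a \<le> 1")
  case True
  then have "a powr p \<le> 1 powr p"
    using assms by (intro powr_mono2) auto
  then show ?thesis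
    by (simp add: add_increasing2)
next
  case False
  then have "a powr p \<le> a powr q"
    using assms by (intro powr_mono) auto
  then show ?thesis by simp
qed

subsection \<open>Hoelder and Jensen inequalities\<close>

text \<open>Young's inequality, integrated after scaling both factors to norm one. A factor of norm
  zero cannot be scaled; in that case the product vanishes almost everywhere.\<close>

lemma Holder_integral:
  fixes f g :: "'a \<Rightarrow> real"
  assumes [measurable]: "f \<in> borel_measurable M" "g \<in> borel_measurable M"
    and pq: "p > 1" "q > 1" "1 / p + 1 / q = 1"
    and f: "integrable M (\<lambda>x. \<bar>f x\<bar> powr p)" and g: "integrable M (\<lambda>x. \<bar>g x\<bar> powr q)"
  shows "integrable M (\<lambda>x. f x * g x)"
    and "(\<integral>x. \<bar>f x * g x\<bar> \<partial>M) \<le>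
      (\<integral>x. \<bar>f x\<bar> powr p \<partial>M) powr (1 / p) * (\<integral>x. \<bar>g x\<bar> powr q \<partial>M) powr (1 / q)"
proof -
  have Y: "\<bar>f x * g x\<bar> \<le> \<bar>f x\<bar> powr p / p + \<bar>g x\<bar> powr q / q" for x
    using Youngs_inequality[of p q "\<bar>f x\<bar>" "\<bar>g x\<bar>"] pq by (simp add: abs_mult)
  show int: "integrable M (\<lambda>x. f x * g x)"
    by (rule Bochner_Integration.integrable_bound[of _ "\<lambda>x. \<bar>f x\<bar> powr p / p + \<bar>g x\<bar> powr q / q"])
       (use f g Y in \<open>auto intro: order_trans[OF Y abs_ge_self]\<close>)
  define A B where "A = (\<integral>x. \<bar>f x\<bar> powr p \<partial>M)" and "B = (\<integral>x. \<bar>g x\<bar> powr q \<partial>M)"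
  have AB: "A \<ge> 0" "B \<ge> 0" by (auto simp: A_def B_def)
  show "(\<integral>x. \<bar>f x * g x\<bar> \<partial>M) \<le> (\<integral>x. \<bar>f x\<bar> powr p \<partial>M) powr (1 / p) * (\<integral>x. \<bar>g x\<bar> powr q \<partial>M) powr (1 / q)"
  proof (cases "A = 0 \<or> B = 0")
    case True
    then have "AE x in M. \<bar>f x\<bar> powr p = 0 \<or> \<bar>g x\<bar> powr q = 0"
      using integral_nonneg_eq_0_iff_AE[OF f] integral_nonneg_eq_0_iff_AE[OF g]
      unfolding A_def B_def by auto
    then have "(\<integral>x. \<bar>f x * g x\<bar> \<partial>M) = (\<integral>x. 0 \<partial>M)"
      by (intro integral_cong_AE) auto
    then show ?thesis by simp
  next
    case False
    then have AB: "A > 0" "B > 0" using AB by auto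
    let ?C = "A powr (1 / p) * B powr (1 / q)"
    have "\<bar>f x * g x\<bar> \<le> ?C * (\<bar>f x\<bar> powr p / (A * p) + \<bar>g x\<bar> powr q / (B * q))" for x
    proof -
      have "\<bar>f x\<bar> / A powr (1 / p) * (\<bar>g x\<bar> / B powr (1 / q))
          \<le> (\<bar>f x\<bar> / A powr (1 / p)) powr p / p + (\<bar>g x\<bar> / B powr (1 / q)) powr q / q"
        using pq by (intro Youngs_inequality) auto
      also have "\<dots> = \<bar>f x\<bar> powr p / (A * p) + \<bar>g x\<bar> powr q / (B * q)"
        using pq AB by (simp add: powr_divide powr_powr)
      finally show ?thesis
        using AB by (simp add: abs_mult field_simps)
    qed
    then have "(\<integral>x. \<bar>f x * g x\<bar> \<partial>M) \<le> (\<integral>x. ?C * (\<bar>f x\<bar> powr p / (A * p) + \<bar>g x\<bar> powr q / (B * q)) \<partial>M)"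
      using int f g by (intro integral_mono) auto
    also have "\<dots> = ?C * (A / (A * p) + B / (B * q))"
      using f g by (simp add: A_def B_def)
    also have "\<dots> = ?C"
      using AB pq by simp
    finally show ?thesis
      by (simp add: A_def B_def)
  qed
qed

text \<open>The Hoelder inequality for the splitting \<open>w = w^(1 / r) w^(1 / q)\<close> with
  \<open>r\<close> conjugate to \<open>q\<close>. It is used with three weights: a mollifier, the
  indicator of \<open>{0..1}\<close>, and the indicator of a small ball.\<close>

lemma Jensen_weighted:
  fixes w g :: "'a \<Rightarrow> real"
  assumes [measurable]: "w \<in> borel_measurable M" "g \<in> borel_measurable M"
    and nonneg: "\<And>x. 0 \<le> w x" "\<And>x. 0 \<le> g x" and q: "q \<ge> 1"
    and w: "integrable M w" and wg: "integrable M (\<lambda>x. w x * g x powr q)"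
  shows "integrable M (\<lambda>x. w x * g x)"
    and "(\<integral>x. w x * g x \<partial>M) powr q \<le> (\<integral>x. w x \<partial>M) powr (q - 1) * (\<integral>x. w x * g x powr q \<partial>M)"
proof -
  have "integrable M (\<lambda>x. w x * g x) \<and>
    (\<integral>x. w x * g x \<partial>M) powr q \<le> (\<integral>x. w x \<partial>M) powr (q - 1) * (\<integral>x. w x * g x powr q \<partial>M)"
  proof (cases "q = 1")
    case True
    have "(\<integral>x. w x * g x \<partial>M) \<le> (\<integral>x. w x \<partial>M) powr 0 * (\<integral>x. w x * g x \<partial>M)"
    \<comment> \<open>Since \<open>0 powr 0 = 0\<close>, the right-hand side vanishes for a weight
      of mass zero, so that case needs an argument.\<close>
    proof (cases "(\<integral>x. w x \<partial>M) = 0")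
      case True
      then have "AE x in M. w x = 0"
        using integral_nonneg_eq_0_iff_AE[OF w] nonneg by auto
      then have "(\<integral>x. w x * g x \<partial>M) = (\<integral>x. 0 \<partial>M)"
        by (intro integral_cong_AE) auto
      then show ?thesis by simp
    qed simp
    then show ?thesis
      using True wg nonneg by simp
  next
    case False
    then have q1: "q > 1" using q by simp
    define r where "r = q / (q - 1)"
    have r: "r > 1" "1 / r + 1 / q = 1" and r': "q / r = q - 1"
      using q1 by (auto simp: r_def divide_simps)
    have 1: "\<bar>w x powr (1 / r)\<bar> powr r = w x" for x
      using nonneg r by (simp add: powr_powr)
    have 2: "\<bar>w x powr (1 / q) * g x\<bar> powr q = w x * g x powr q" for x
      using nonneg q1 by (simp add: powr_powr powr_mult)
    have 3: "w x powr (1 / r) * (w x powr (1 / q) * g x) = w x * g x" for x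
      using nonneg by (simp add: mult.assoc[symmetric] powr_add[symmetric] r)
    have H: "integrable M (\<lambda>x. w x powr (1 / r) * (w x powr (1 / q) * g x))"
      "(\<integral>x. \<bar>w x powr (1 / r) * (w x powr (1 / q) * g x)\<bar> \<partial>M) \<le>
        (\<integral>x. \<bar>w x powr (1 / r)\<bar> powr r \<partial>M) powr (1 / r) *
        (\<integral>x. \<bar>w x powr (1 / q) * g x\<bar> powr q \<partial>M) powr (1 / q)"
      using Holder_integral[of "\<lambda>x. w x powr (1 / r)" M "\<lambda>x. w x powr (1 / q) * g x" r q] r q1 w wg
      unfolding 1 2 by auto
    have "(\<integral>x. w x * g x \<partial>M) \<le> (\<integral>x. w x \<partial>M) powr (1 / r) * (\<integral>x. w x * g x powr q \<partial>M) powr (1 / q)"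
      using H(2) nonneg unfolding 1 2 3 by simp
    then have "(\<integral>x. w x * g x \<partial>M) powr q \<le>
        ((\<integral>x. w x \<partial>M) powr (1 / r) * (\<integral>x. w x * g x powr q \<partial>M) powr (1 / q)) powr q"
      using q1 nonneg by (intro powr_mono2) auto
    also have "\<dots> = (\<integral>x. w x \<partial>M) powr (q - 1) * (\<integral>x. w x * g x powr q \<partial>M)"
      using q1 nonneg by (simp add: powr_mult powr_powr r')
    finally show ?thesis
      using H(1) unfolding 3 by simp
  qed
  then show "integrable M (\<lambda>x. w x * g x)"
    "(\<integral>x. w x * g x \<partial>M) powr q \<le> (\<integral>x. w x \<partial>M) powr (q - 1) * (\<integral>x. w x * g x powr q \<partial>M)"
    by auto
qed

subsection \<open>Test functions\<close>

lemma test_functionsI: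
  assumes "smooth f" "compact K" "K \<subseteq> S" "\<And>x. x \<notin> K \<Longrightarrow> f x = 0"
  shows "f \<in> test_functions S"
proof -
  have "closure {x. f x \<noteq> 0} \<subseteq> K"
    using assms by (intro closure_minimal compact_imp_closed) auto
  moreover from this have "compact (closure {x. f x \<noteq> 0})"
    using assms(2) by (metis closed_closure compact_Int_closed inf.absorb_iff2)
  ultimately show ?thesis
    using assms unfolding test_functions_def by auto
qed

lemma test_functions_mono: "S \<subseteq> T \<Longrightarrow> test_functions S \<subseteq> test_functions T"
  by (auto simp: test_functions_def)

lemma test_functions_smooth: "f \<in> test_functions S \<Longrightarrow> smooth f"
  by (auto simp: test_functions_def)

lemma gradient_eq_0_outside:
  assumes "closed K" "x \<notin> K" "\<And>x. x \<notin> K \<Longrightarrow> f x = 0"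
  shows "gradient f x = 0"
proof (rule gradient_eqI)
  have "((\<lambda>_. 0) has_derivative (\<lambda>h. 0 \<bullet> h)) (at x)"
    by simp
  then show "(f has_derivative (\<lambda>h. 0 \<bullet> h)) (at x)"
    by (rule has_derivative_transform_within_open[where s = "- K"]) (use assms in auto)
qed

lemma test_functions_partial_deriv:
  assumes "f \<in> test_functions S"
  shows "partial_deriv i f \<in> test_functions S"
proof (rule test_functionsI)
  let ?K = "closure {x. f x \<noteq> 0}"
  show "smooth (partial_deriv i f)" "compact ?K" "?K \<subseteq> S"
    using assms smooth_partial_deriv[of f i] unfolding test_functions_def by blast+
  show "partial_deriv i f x = 0" if "x \<notin> ?K" for x
  proof -
    have "gradient f x = 0"
      by (rule gradient_eq_0_outside[OF closed_closure that])
         (use closure_subset[of "{x. f x \<noteq> 0}"] in auto)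
    then show ?thesis
      by (simp add: partial_deriv_gradient)
  qed
qed

lemma continuous_compact_support_bounded:
  fixes f :: "'a::euclidean_space \<Rightarrow> 'b::euclidean_space"
  assumes "continuous_on UNIV f" "compact K" "\<And>x. x \<notin> K \<Longrightarrow> f x = 0"
  obtains B where "B > 0" "\<And>x. norm (f x) \<le> B"
proof -
  have "bounded (f ` K)"
    using assms by (intro compact_imp_bounded compact_continuous_image) (auto intro: continuous_on_subset)
  then obtain B where "B > 0" "\<And>x. x \<in> K \<Longrightarrow> norm (f x) \<le> B"
    by (auto simp: bounded_pos)
  then show ?thesis
    using assms(3) that[of B] by (metis less_le norm_zero)
qed

lemma continuous_compact_support_integrable:
  fixes f :: "'a::euclidean_space \<Rightarrow> 'b::{banach, second_countable_topology}"
  assumes "continuous_on UNIV f" "compact K" "\<And>x. x \<notin> K \<Longrightarrow> f x = 0"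
  shows "integrable lborel f"
proof -
  have "integrable lborel (\<lambda>x. indicator K x *\<^sub>R f x)"
    using assms by (intro borel_integrable_compact) (auto intro: continuous_on_subset)
  moreover have "(\<lambda>x. indicator K x *\<^sub>R f x) = f"
    using assms by (auto simp: fun_eq_iff indicator_def)
  ultimately show ?thesis by simp
qed

lemma test_function_compact_support:
  assumes "f \<in> test_functions S"
  obtains K where "compact K" "K \<subseteq> S" "\<And>x. x \<notin> K \<Longrightarrow> f x = 0" "\<And>x. x \<notin> K \<Longrightarrow> gradient f x = 0"
proof (rule that)
  let ?K = "closure {x. f x \<noteq> 0}"
  show "compact ?K" "?K \<subseteq> S"
    using assms by (auto simp: test_functions_def)
  show f: "f x = 0" if "x \<notin> ?K" for x
    using that closure_subset[of "{x. f x \<noteq> 0}"] by auto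
  show "gradient f x = 0" if "x \<notin> ?K" for x
    by (rule gradient_eq_0_outside[OF closed_closure that f])
qed

lemma test_function_bounds:
  assumes "f \<in> test_functions S"
  obtains B where "B > 0" "\<And>x. \<bar>f x\<bar> \<le> B" "\<And>x. norm (gradient f x) \<le> B"
    "\<And>x y. \<bar>f x - f y\<bar> \<le> B * norm (x - y)"
proof -
  obtain K where K: "compact K" "\<And>x. x \<notin> K \<Longrightarrow> f x = 0" "\<And>x. x \<notin> K \<Longrightarrow> gradient f x = 0"
    using test_function_compact_support[OF assms] by metis
  have sm: "smooth f" using assms by (rule test_functions_smooth)
  obtain B1 where B1: "B1 > 0" "\<And>x. norm (f x) \<le> B1"
    using continuous_compact_support_bounded[OF smooth_continuous_on[OF sm] K(1,2)] by metis
  obtain B2 where B2: "B2 > 0" "\<And>x. norm (gradient f x) \<le> B2"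
    using continuous_compact_support_bounded[OF smooth_continuous_gradient[OF sm] K(1,3)] by metis
  show ?thesis
  proof (rule that)
    show "max B1 B2 > 0" "\<bar>f x\<bar> \<le> max B1 B2" "norm (gradient f x) \<le> max B1 B2" for x
      using B1 B2 by (auto simp: le_max_iff_disj)
    have "norm (f x - f y) \<le> B2 * norm (x - y)" for x y
    proof (rule differentiable_bound[of UNIV])
      show "(f has_derivative (\<lambda>h. gradient f x \<bullet> h)) (at x within UNIV)" for x
        using smooth_has_derivative[OF sm] by simp
      show "onorm (\<lambda>h. gradient f x \<bullet> h) \<le> B2" for x
        by (rule order_trans[OF onorm_le[of _ "norm (gradient f x)"] B2(2)])
           (simp add: Cauchy_Schwarz_ineq2)
    qed auto
    also have "B2 * norm (x - y) \<le> max B1 B2 * norm (x - y)" for x y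
      by (intro mult_right_mono) auto
    finally show "\<bar>f x - f y\<bar> \<le> max B1 B2 * norm (x - y)" for x y
      by simp
  qed
qed

lemma test_function_integrable:
  assumes "f \<in> test_functions S"
  shows "integrable lborel f"
  using test_function_compact_support[OF assms] continuous_compact_support_integrable
    smooth_continuous_on[OF test_functions_smooth[OF assms]] by metis

section \<open>Translation invariance and integration by parts\<close>

lemma nn_integral_lborel_translation:
  fixes f :: "'a::euclidean_space \<Rightarrow> ennreal"
  assumes [measurable]: "f \<in> borel_measurable borel"
  shows "(\<integral>\<^sup>+x. f (x + a) \<partial>lborel) = (\<integral>\<^sup>+x. f x \<partial>lborel)"
proof -
  have "(\<integral>\<^sup>+x. f x \<partial>lborel) = (\<integral>\<^sup>+x. f x \<partial>distr lborel borel ((+) a))"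
    by (simp add: lborel_distr_plus)
  also have "\<dots> = (\<integral>\<^sup>+x. f (x + a) \<partial>lborel)"
    by (subst nn_integral_distr) (auto simp: add.commute)
  finally show ?thesis by simp
qed

lemma integrable_lborel_translation:
  fixes f :: "'a::euclidean_space \<Rightarrow> 'b::{banach, second_countable_topology}"
  assumes "integrable lborel f"
  shows "integrable lborel (\<lambda>x. f (x + a))"
proof -
  have "integrable (distr lborel borel ((+) a)) f"
    using assms by (simp add: lborel_distr_plus)
  then show ?thesis
    by (subst (asm) integrable_distr_eq) (use assms in \<open>auto simp: add.commute\<close>)
qed

lemma integral_lborel_translation:
  fixes f :: "'a::euclidean_space \<Rightarrow> 'b::{banach, second_countable_topology}"
  assumes [measurable]: "f \<in> borel_measurable borel"
  shows "(\<integral>x. f (x + a) \<partial>lborel) = (\<integral>x. f x \<partial>lborel)"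
proof -
  have "(\<integral>x. f x \<partial>lborel) = (\<integral>x. f x \<partial>distr lborel borel ((+) a))"
    by (simp add: lborel_distr_plus)
  also have "\<dots> = (\<integral>x. f (x + a) \<partial>lborel)"
    by (subst integral_distr) (auto simp: add.commute)
  finally show ?thesis by simp
qed

lemma smooth_difference_quotient:
  assumes f: "smooth f" and X: "X \<longlonglongrightarrow> x" "\<And>n. X n \<noteq> x"
  shows "(\<lambda>n. (f (X n) - f x - gradient f x \<bullet> (X n - x)) / norm (X n - x)) \<longlonglongrightarrow> 0"
proof -
  have "((\<lambda>y. (f y - f x - gradient f x \<bullet> (y - x)) /\<^sub>R norm (y - x)) \<longlongrightarrow> 0) (at x)"
    using smooth_has_derivative[OF f, of x] unfolding has_derivative_at_within by auto
  then show ?thesis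
    using X unfolding tendsto_at_iff_sequentially by (auto simp: o_def divide_inverse mult.commute)
qed

text \<open>By translation invariance every difference quotient of \<open>f\<close> has integral
  zero, and dominated convergence carries this over to the derivative.\<close>

lemma integral_partial_deriv_test_function:
  fixes f :: "real^'n \<Rightarrow> real"
  assumes f: "f \<in> test_functions S"
  shows "(\<integral>x. partial_deriv i f x \<partial>lborel) = 0"
proof -
  obtain K where K: "compact K" "\<And>x. x \<notin> K \<Longrightarrow> f x = 0" "\<And>x. x \<notin> K \<Longrightarrow> gradient f x = 0"
    using test_function_compact_support[OF f] by metis
  obtain B where B: "B > 0" "\<And>x. norm (gradient f x) \<le> B" "\<And>x y. \<bar>f x - f y\<bar> \<le> B * norm (x - y)"
    using test_function_bounds[OF f] by metis
  obtain r where r: "K \<subseteq> ball 0 r"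
    using compact_imp_bounded[OF K(1)] bounded_subset_ballD[of K 0] by auto
  have sm: "smooth f" using f by (rule test_functions_smooth)
  have [measurable]: "f \<in> borel_measurable borel" "partial_deriv i f \<in> borel_measurable borel"
    using sm by (auto intro!: borel_measurable_continuous_onI smooth_continuous_on smooth_partial_deriv)
  \<comment> \<open>Steps of length at most 1 keep all shifted supports inside the ball of radius
    \<open>r + 1\<close>; there the Lipschitz constant \<open>B\<close> of \<open>f\<close> is a
    common majorant of the quotients.\<close>
  define h where "h m = (1 / real (Suc m)) *\<^sub>R axis i (1::real)" for m
  have h: "norm (h m) = 1 / real (Suc m)" "h m \<noteq> 0" "norm (h m) \<le> 1" for m
    by (auto simp: h_def norm_axis_1 axis_eq_0_iff)
  have h0: "h \<longlonglongrightarrow> 0"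
    by (rule tendsto_norm_zero_cancel) (unfold h, rule LIMSEQ_Suc[OF lim_1_over_n])
  define s where "s m x = (f (x + h m) - f x) / norm (h m)" for m x
  have "(\<lambda>m. \<integral>x. s m x \<partial>lborel) \<longlonglongrightarrow> (\<integral>x. partial_deriv i f x \<partial>lborel)"
  proof (rule integral_dominated_convergence)
    show "integrable lborel (\<lambda>x. B * indicator (cball (0::real^'n) (r + 1)) x)"
      by (auto intro!: integrable_real_indicator emeasure_lborel_cball_finite)
    show "AE x in lborel. (\<lambda>m. s m x) \<longlonglongrightarrow> partial_deriv i f x"
    proof (rule AE_I2)
      fix x
      have "(\<lambda>m. (f (x + h m) - f x - gradient f x \<bullet> (x + h m - x)) / norm (x + h m - x) + partial_deriv i f x) \<longlonglongrightarrow> 0 + partial_deriv i f x"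
        using h h0 by (intro tendsto_add smooth_difference_quotient[OF sm] tendsto_const)
           (auto intro: tendsto_eq_intros)
      moreover have "gradient f x \<bullet> h m / norm (h m) = partial_deriv i f x" for m
        unfolding h by (simp add: h_def inner_axis partial_deriv_gradient)
      ultimately show "(\<lambda>m. s m x) \<longlonglongrightarrow> partial_deriv i f x"
        by (simp add: s_def diff_divide_distrib)
    qed
    show "AE x in lborel. norm (s m x) \<le> B * indicator (cball 0 (r + 1)) x" for m
    proof (rule AE_I2)
      fix x
      show "norm (s m x) \<le> B * indicator (cball 0 (r + 1)) x"
      proof (cases "x \<in> cball 0 (r + 1)")
        case True
        have "\<bar>f (x + h m) - f x\<bar> \<le> B * norm (h m)"
          using B(3)[of "x + h m" x] by simp
        then show ?thesis
          using True h(2)[of m] by (simp add: s_def divide_simps)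
      next
        case False
        then have "norm x > r + 1" by simp
        moreover have "norm x \<le> norm (x + h m) + norm (h m)"
          using norm_triangle_ineq4[of "x + h m" "h m"] by simp
        ultimately have "x \<notin> K" "x + h m \<notin> K"
          using r h(3)[of m] by (force simp: subset_eq)+
        then show ?thesis
          using False K by (simp add: s_def)
      qed
    qed
  qed (auto simp: s_def)
  moreover have "(\<integral>x. s m x \<partial>lborel) = 0" for m
    using test_function_integrable[OF f] integrable_lborel_translation[OF test_function_integrable[OF f], of "h m"]
    by (simp add: s_def integral_lborel_translation)
  ultimately show ?thesis
    by (simp add: LIMSEQ_const_iff)
qed

lemma test_functions_mult:
  assumes "f \<in> test_functions S" "smooth g"
  shows "(\<lambda>x. f x * g x) \<in> test_functions S"
  using test_function_compact_support[OF assms(1)]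
    test_functionsI[OF smooth_mult[OF test_functions_smooth[OF assms(1)] assms(2)]]
  by (metis mult_zero_left)

lemma gradient_mult:
  assumes "f differentiable at x" "g differentiable at x"
  shows "gradient (\<lambda>x. f x * g x) x = g x *\<^sub>R gradient f x + f x *\<^sub>R gradient g x"
proof (rule gradient_eqI)
  from assms[THEN has_derivative_gradient]
  have "((\<lambda>x. f x * g x) has_derivative (\<lambda>h. f x * (gradient g x \<bullet> h) + gradient f x \<bullet> h * g x)) (at x)"
    by (rule has_derivative_mult)
  then show "((\<lambda>x. f x * g x) has_derivative (\<lambda>h. (g x *\<^sub>R gradient f x + f x *\<^sub>R gradient g x) \<bullet> h)) (at x)"
    by (rule has_derivative_eq_rhs) (auto simp: algebra_simps)
qed

lemma integration_by_parts_test_function: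
  fixes f :: "real^'n \<Rightarrow> real"
  assumes f: "f \<in> test_functions S" and g: "smooth g"
  shows "(\<integral>x. g x * partial_deriv i f x \<partial>lborel) = - (\<integral>x. partial_deriv i g x * f x \<partial>lborel)"
proof -
  have sm: "smooth f" using f by (rule test_functions_smooth)
  have "partial_deriv i (\<lambda>x. f x * g x) x = partial_deriv i f x * g x + f x * partial_deriv i g x" for x
    using gradient_mult[of f x g] smooth_differentiable[OF sm] smooth_differentiable[OF g]
    by (simp add: partial_deriv_gradient)
  moreover have "integrable lborel (\<lambda>x. partial_deriv i f x * g x)" "integrable lborel (\<lambda>x. f x * partial_deriv i g x)"
    using f g by (auto intro!: test_function_integrable[of _ S] test_functions_mult test_functions_partial_deriv smooth_partial_deriv)
  ultimately show ?thesis
    using integral_partial_deriv_test_function[OF test_functions_mult[OF f g], of i]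
    by (simp add: mult.commute)
qed

subsection \<open>Mollification\<close>

definition convol :: "(real^'n \<Rightarrow> real) \<Rightarrow> (real^'n \<Rightarrow> real) \<Rightarrow> real^'n \<Rightarrow> real" where
  "convol k f x = (\<integral>y. k (x - y) * f y \<partial>lborel)"

lemma test_function_measurable:
  assumes "k \<in> test_functions S"
  shows "k \<in> borel_measurable borel" "gradient k \<in> borel_measurable borel"
  using assms by (auto intro!: borel_measurable_continuous_onI smooth_continuous_on smooth_continuous_gradient
      dest: test_functions_smooth)

lemma integrable_bounded_mult:
  fixes f g :: "'a \<Rightarrow> real"
  assumes "integrable M f" and [measurable]: "g \<in> borel_measurable M" and B: "\<And>x. \<bar>g x\<bar> \<le> B"
  shows "integrable M (\<lambda>x. g x * f x)"
proof (rule Bochner_Integration.integrable_bound[of _ "\<lambda>x. B * f x"])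
  have "B \<ge> 0" using B[of undefined] by (smt (verit) abs_ge_zero)
  then show "AE x in M. norm (g x * f x) \<le> norm (B * f x)"
    using B by (auto simp: abs_mult intro!: mult_right_mono)
qed (use assms in auto)

lemma convol_integrable:
  fixes k :: "real^'n \<Rightarrow> real"
  assumes "k \<in> test_functions S" "integrable lborel f"
  shows "integrable lborel (\<lambda>y. k (x - y) * f y)"
proof -
  note [measurable] = test_function_measurable[OF assms(1)]
  obtain B where "\<And>x. \<bar>k x\<bar> \<le> B"
    using test_function_bounds[OF assms(1)] by metis
  then show ?thesis
    using assms(2) by (intro integrable_bounded_mult[where B = B]) auto
qed

lemma convol_gradient_inner:
  fixes k :: "real^'n \<Rightarrow> real"
  assumes k: "k \<in> test_functions S" and f: "integrable lborel f"
  shows "integrable lborel (\<lambda>y. f y * (gradient k (x - y) \<bullet> v))"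
    and "(\<integral>y. f y * (gradient k (x - y) \<bullet> v) \<partial>lborel) = (\<integral>y. f y *\<^sub>R gradient k (x - y) \<partial>lborel) \<bullet> v"
proof -
  note [measurable] = test_function_measurable[OF k]
  have [measurable]: "f \<in> borel_measurable borel" using f by auto
  obtain B where B: "B > 0" "\<And>x. norm (gradient k x) \<le> B"
    using test_function_bounds[OF k] by metis
  have gi: "integrable lborel (\<lambda>y. f y *\<^sub>R gradient k (x - y))"
  proof (rule Bochner_Integration.integrable_bound[of _ "\<lambda>x. B * f x"])
    show "AE y in lborel. norm (f y *\<^sub>R gradient k (x - y)) \<le> norm (B * f y)"
    proof (rule AE_I2)
      show "norm (f y *\<^sub>R gradient k (x - y)) \<le> norm (B * f y)" for y
        using mult_left_mono[OF B(2)[of "x - y"], of "\<bar>f y\<bar>"] B(1) by (simp add: abs_mult mult.commute)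
    qed
  qed (use f in auto)
  show "integrable lborel (\<lambda>y. f y * (gradient k (x - y) \<bullet> v))"
    using integrable_inner_left[OF gi, of v] by simp
  show "(\<integral>y. f y * (gradient k (x - y) \<bullet> v) \<partial>lborel) = (\<integral>y. f y *\<^sub>R gradient k (x - y) \<partial>lborel) \<bullet> v"
    using integral_inner_left[OF gi, of v] by simp
qed

text \<open>Differentiation under the integral sign: the remainder quotients of the kernel are
  bounded by \<open>2 * B\<close> uniformly, where \<open>B\<close> bounds its gradient and
  Lipschitz constant. Hence \<open>2 * B * \<bar>f y\<bar>\<close> is a majorant, and integrability
  of \<open>f\<close> suffices.\<close>

lemma convol_has_derivative:
  fixes k :: "real^'n \<Rightarrow> real"
  assumes k: "k \<in> test_functions S" and f: "integrable lborel f"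
  shows "(convol k f has_derivative (\<lambda>h. (\<integral>y. f y *\<^sub>R gradient k (x - y) \<partial>lborel) \<bullet> h)) (at x)"
proof -
  note [measurable] = test_function_measurable[OF k]
  have [measurable]: "f \<in> borel_measurable borel" using f by auto
  obtain B where B: "B > 0" "\<And>x. norm (gradient k x) \<le> B" "\<And>x y. \<bar>k x - k y\<bar> \<le> B * norm (x - y)"
    using test_function_bounds[OF k] by metis
  have sm: "smooth k" using k by (rule test_functions_smooth)
  have lim: "(\<lambda>n. (convol k f (X n) - convol k f x - (\<integral>y. f y *\<^sub>R gradient k (x - y) \<partial>lborel) \<bullet> (X n - x)) / norm (X n - x)) \<longlonglongrightarrow> 0"
    if X: "X \<longlonglongrightarrow> x" "\<And>n. X n \<noteq> x" for X
  proof -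
    define s where "s n y = (k (X n - y) - k (x - y) - gradient k (x - y) \<bullet> (X n - x)) / norm (X n - x) * f y" for n y
    have "(\<lambda>n. \<integral>y. s n y \<partial>lborel) \<longlonglongrightarrow> (\<integral>y. 0 \<partial>(lborel::(real^'n) measure))"
    proof (rule integral_dominated_convergence)
      show "integrable lborel (\<lambda>y. 2 * B * \<bar>f y\<bar>)"
        using f by auto
      show "AE y in lborel. (\<lambda>n. s n y) \<longlonglongrightarrow> 0"
      proof (rule AE_I2)
        fix y
        have "(\<lambda>n. (k (X n - y) - k (x - y) - gradient k (x - y) \<bullet> (X n - y - (x - y))) / norm (X n - y - (x - y)) * f y) \<longlonglongrightarrow> 0 * f y"
          using X by (intro tendsto_mult smooth_difference_quotient[OF sm] tendsto_const tendsto_diff) auto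
        then show "(\<lambda>n. s n y) \<longlonglongrightarrow> 0"
          by (simp add: s_def)
      qed
      show "AE y in lborel. norm (s n y) \<le> 2 * B * \<bar>f y\<bar>" for n
      proof (rule AE_I2)
        fix y
        let ?d = "norm (X n - x)"
        have "\<bar>k (X n - y) - k (x - y)\<bar> \<le> B * ?d"
          using B(3)[of "X n - y" "x - y"] by simp
        moreover have "\<bar>gradient k (x - y) \<bullet> (X n - x)\<bar> \<le> B * ?d"
          by (rule order_trans[OF Cauchy_Schwarz_ineq2]) (intro mult_right_mono B, simp)
        ultimately have "\<bar>k (X n - y) - k (x - y) - gradient k (x - y) \<bullet> (X n - x)\<bar> / ?d \<le> 2 * B"
          using X(2)[of n] by (auto simp: divide_simps)
        then show "norm (s n y) \<le> 2 * B * \<bar>f y\<bar>"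
          by (simp only: s_def real_norm_def abs_mult abs_divide abs_norm_cancel mult_right_mono abs_ge_zero)
      qed
    qed (auto simp: s_def[abs_def])
    moreover have "(\<integral>y. s n y \<partial>lborel) = (convol k f (X n) - convol k f x - (\<integral>y. f y *\<^sub>R gradient k (x - y) \<partial>lborel) \<bullet> (X n - x)) / norm (X n - x)" for n
    proof -
      have "(\<integral>y. s n y \<partial>lborel) = (\<integral>y. (k (X n - y) * f y - k (x - y) * f y - f y * (gradient k (x - y) \<bullet> (X n - x))) / norm (X n - x) \<partial>lborel)"
        by (intro Bochner_Integration.integral_cong) (auto simp: s_def algebra_simps diff_divide_distrib)
      also have "\<dots> = (convol k f (X n) - convol k f x - (\<integral>y. f y * (gradient k (x - y) \<bullet> (X n - x)) \<partial>lborel)) / norm (X n - x)"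
        using convol_integrable[OF k f] convol_gradient_inner(1)[OF k f] by (simp add: convol_def)
      finally show ?thesis
        by (simp only: convol_gradient_inner(2)[OF k f])
    qed
    ultimately show ?thesis by simp
  qed
  show ?thesis
    unfolding has_derivative_at_within
  proof
    show "bounded_linear (\<lambda>h. (\<integral>y. f y *\<^sub>R gradient k (x - y) \<partial>lborel) \<bullet> h)"
      by (rule bounded_linear_inner_right)
    show "((\<lambda>y. (convol k f y - convol k f x - (\<integral>y. f y *\<^sub>R gradient k (x - y) \<partial>lborel) \<bullet> (y - x)) /\<^sub>R norm (y - x)) \<longlongrightarrow> 0) (at x)"
      unfolding tendsto_at_iff_sequentially using lim by (auto simp: o_def divide_inverse mult.commute)
  qed
qed

lemma partial_deriv_convol:
  assumes k: "k \<in> test_functions S" and f: "integrable lborel f"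
  shows "partial_deriv i (convol k f) = convol (partial_deriv i k) f"
proof
  fix x
  have "partial_deriv i (convol k f) x = (\<integral>y. f y *\<^sub>R gradient k (x - y) \<partial>lborel) \<bullet> axis i 1"
    by (rule partial_deriv_eqI[OF convol_has_derivative[OF k f]])
  also have "\<dots> = (\<integral>y. f y * (gradient k (x - y) \<bullet> axis i 1) \<partial>lborel)"
    by (simp only: convol_gradient_inner(2)[OF k f])
  finally show "partial_deriv i (convol k f) x = convol (partial_deriv i k) f x"
    by (simp add: convol_def inner_axis partial_deriv_gradient mult.commute)
qed

text \<open>All derivatives fall on the kernel, so the convolutions of \<open>f\<close> with
  arbitrary test functions form an invariant set for \<open>smooth_coinduct\<close>.\<close>

lemma smooth_convol:
  assumes k: "k \<in> test_functions S" and f: "integrable lborel f"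
  shows "smooth (convol k f)"
proof (rule smooth_coinduct)
  show "convol k f \<in> {convol k f | k. k \<in> test_functions S}"
    using k by blast
  show "g differentiable at x" if "g \<in> {convol k f | k. k \<in> test_functions S}" for g x
    using that convol_has_derivative[OF _ f] unfolding differentiable_def by blast
  show "partial_deriv i g \<in> {convol k f | k. k \<in> test_functions S}"
    if "g \<in> {convol k f | k. k \<in> test_functions S}" for g i
    using that partial_deriv_convol[OF _ f] test_functions_partial_deriv by blast
qed

text \<open>With inner radius 0 the cutoff is the standard bump
  \<open>exp (- \<epsilon>^2 / (\<epsilon>^2 - |x|^2))\<close>, here normalised to mass one.\<close>

definition mollifier :: "real \<Rightarrow> real^'n \<Rightarrow> real" where
  "mollifier \<epsilon> x = cutoff 0 0 \<epsilon> x / (\<integral>x. cutoff 0 0 \<epsilon> (x::real^'n) \<partial>lborel)"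

lemma cutoff_test_function:
  assumes "0 \<le> s" "s < t" "cball x0 t \<subseteq> S"
  shows "cutoff x0 s t \<in> test_functions S"
  by (rule test_functionsI[OF smooth_cutoff compact_cball assms(3)])
     (rule cutoff_eq_0[OF assms(1,2)], use ball_subset_cball[of x0 t] in blast)

lemma integral_cutoff_pos:
  assumes "\<epsilon> > 0"
  shows "(\<integral>x. cutoff 0 0 \<epsilon> (x::real^'n) \<partial>lborel) > 0"
proof -
  have t: "cutoff 0 0 \<epsilon> \<in> test_functions (UNIV :: (real^'n) set)"
    using assms by (intro cutoff_test_function) auto
  have "(\<integral>x. cutoff 0 0 \<epsilon> (x::real^'n) \<partial>lborel) \<noteq> 0"
  proof
    assume "(\<integral>x. cutoff 0 0 \<epsilon> (x::real^'n) \<partial>lborel) = 0"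
    then have "AE x in lborel. cutoff 0 0 \<epsilon> (x::real^'n) = 0"
      using integral_nonneg_eq_0_iff_AE[OF test_function_integrable[OF t] AE_I2[OF cutoff_nonneg]] by blast
    then have "AE x in lborel. (x::real^'n) \<notin> ball 0 \<epsilon>"
      by eventually_elim (metis assms cutoff_pos less_irrefl order_refl)
    then have "emeasure lborel (ball (0::real^'n) \<epsilon>) = 0"
      by (subst (asm) AE_iff_measurable[where N = "ball 0 \<epsilon>"]) auto
    then have "unit_ball_vol (real CARD('n)) * \<epsilon> ^ CARD('n) \<le> 0"
      using assms by (simp add: emeasure_ball ennreal_eq_0_iff)
    moreover have "unit_ball_vol (real CARD('n)) * \<epsilon> ^ CARD('n) > 0"
      using assms by (intro mult_pos_pos unit_ball_vol_pos zero_less_power) auto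
    ultimately show False by linarith
  qed
  moreover have "(\<integral>x. cutoff 0 0 \<epsilon> (x::real^'n) \<partial>lborel) \<ge> 0"
    by (intro integral_nonneg_AE) (auto simp: cutoff_nonneg)
  ultimately show ?thesis by simp
qed

lemma mollifier_nonneg: "0 \<le> mollifier \<epsilon> x"
  unfolding mollifier_def by (intro divide_nonneg_nonneg integral_nonneg_AE) (auto simp: cutoff_nonneg)

lemma mollifier_eq_0: "\<epsilon> > 0 \<Longrightarrow> \<epsilon> \<le> norm x \<Longrightarrow> mollifier \<epsilon> x = 0"
  unfolding mollifier_def by (subst cutoff_eq_0) auto

lemma mollifier_test_function:
  assumes "\<epsilon> > 0" "cball 0 \<epsilon> \<subseteq> S"
  shows "mollifier \<epsilon> \<in> test_functions S"
proof -
  have "(\<lambda>x. cutoff 0 0 \<epsilon> x * (1 / (\<integral>x. cutoff 0 0 \<epsilon> (x::real^'n) \<partial>lborel))) \<in> test_functions S"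
    using assms by (intro test_functions_mult cutoff_test_function smooth_const) auto
  then show ?thesis
    unfolding mollifier_def[abs_def] by simp
qed

lemma integral_mollifier:
  assumes "\<epsilon> > 0"
  shows "(\<integral>x. mollifier \<epsilon> (x::real^'n) \<partial>lborel) = 1"
  using integral_cutoff_pos[OF assms, where 'n = 'n] unfolding mollifier_def by simp

lemma mollifier_minus: "mollifier \<epsilon> (x - y) = mollifier \<epsilon> (y - x)"
  by (simp add: mollifier_def cutoff_def norm_minus_commute)

lemma mollifier_integrals:
  fixes x :: "real^'n"
  assumes "\<epsilon> > 0"
  shows "integrable lborel (\<lambda>y. mollifier \<epsilon> (x - y))" "(\<integral>y. mollifier \<epsilon> (x - y) \<partial>lborel) = 1"
    "(\<integral>\<^sup>+y. ennreal (mollifier \<epsilon> (y - x)) \<partial>lborel) = 1"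
proof -
  have t: "mollifier \<epsilon> \<in> test_functions (UNIV :: (real^'n) set)"
    using assms by (intro mollifier_test_function) auto
  note [measurable] = test_function_measurable(1)[OF t]
  have i: "integrable lborel (\<lambda>y. mollifier \<epsilon> (y + (- x)))"
    by (intro integrable_lborel_translation test_function_integrable[OF t])
  have e: "(\<integral>y. mollifier \<epsilon> (y + (- x)) \<partial>lborel) = 1"
    by (subst integral_lborel_translation) (simp_all add: integral_mollifier assms)
  show "integrable lborel (\<lambda>y. mollifier \<epsilon> (x - y))" "(\<integral>y. mollifier \<epsilon> (x - y) \<partial>lborel) = 1"
    using i e by (simp_all add: mollifier_minus[of \<epsilon> x])
  show "(\<integral>\<^sup>+y. ennreal (mollifier \<epsilon> (y - x)) \<partial>lborel) = 1"
    using i e by (subst nn_integral_eq_integral) (auto simp: mollifier_nonneg)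
qed

lemma borel_measurable_convol:
  assumes "k \<in> test_functions S" "integrable lborel f"
  shows "convol k f \<in> borel_measurable borel"
  by (intro borel_measurable_continuous_onI smooth_continuous_on smooth_convol[OF assms])

lemma integrable_of_powr_bounded_support:
  fixes f :: "'a::euclidean_space \<Rightarrow> real"
  assumes [measurable]: "f \<in> borel_measurable borel" and "integrable lborel (\<lambda>x. \<bar>f x\<bar> powr q)"
    and "\<And>x. x \<notin> cball x0 R \<Longrightarrow> f x = 0" and "0 < p" "p \<le> q"
  shows "integrable lborel (\<lambda>x. \<bar>f x\<bar> powr p)"
proof (rule Bochner_Integration.integrable_bound)
  show "integrable lborel (\<lambda>x. indicator (cball x0 R) x + \<bar>f x\<bar> powr q)"
    using assms by (auto intro!: integrable_real_indicator emeasure_lborel_cball_finite)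
  show "AE x in lborel. norm (\<bar>f x\<bar> powr p) \<le> norm (indicator (cball x0 R) x + \<bar>f x\<bar> powr q)"
  proof (rule AE_I2)
    fix x
    show "norm (\<bar>f x\<bar> powr p) \<le> norm (indicator (cball x0 R) x + \<bar>f x\<bar> powr q)"
      using powr_le_one_plus_powr[of "\<bar>f x\<bar>" p q] assms by (cases "x \<in> cball x0 R") auto
  qed
qed auto

lemma integrable_of_powr_bounded_support1:
  fixes f :: "'a::euclidean_space \<Rightarrow> real"
  assumes [measurable]: "f \<in> borel_measurable borel" and "integrable lborel (\<lambda>x. \<bar>f x\<bar> powr q)"
    and "\<And>x. x \<notin> cball x0 R \<Longrightarrow> f x = 0" and "1 \<le> q"
  shows "integrable lborel f"
proof (rule Bochner_Integration.integrable_bound)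
  show "integrable lborel (\<lambda>x. \<bar>f x\<bar> powr 1)"
    by (rule integrable_of_powr_bounded_support[OF assms(1-3)]) (use assms in auto)
qed auto

text \<open>For fixed \<open>x\<close> the mollifier is a probability density in \<open>y\<close>,
  so Jensen's inequality moves the power inside the convolution. Exchanging the integrals then
  integrates the mollifier in \<open>x\<close>, again to one. With nonnegative integrals,
  integrability of the left-hand side need not be settled first.\<close>

lemma convol_mollifier_contraction:
  fixes f :: "real^'n \<Rightarrow> real"
  assumes \<epsilon>: "\<epsilon> > 0" and q: "q \<ge> 1" and f: "integrable lborel f" "integrable lborel (\<lambda>x. \<bar>f x\<bar> powr q)"
  shows "(\<integral>\<^sup>+x. ennreal (\<bar>convol (mollifier \<epsilon>) f x\<bar> powr q) \<partial>lborel) \<le> (\<integral>\<^sup>+x. ennreal (\<bar>f x\<bar> powr q) \<partial>lborel)"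
proof -
  let ?m = "mollifier \<epsilon> :: real^'n \<Rightarrow> real"
  have t: "?m \<in> test_functions UNIV"
    using \<epsilon> by (intro mollifier_test_function) auto
  note [measurable] = test_function_measurable(1)[OF t]
  have [measurable]: "f \<in> borel_measurable borel" using f by auto
  have "ennreal (\<bar>convol ?m f x\<bar> powr q) \<le> (\<integral>\<^sup>+y. ennreal (?m (x - y) * \<bar>f y\<bar> powr q) \<partial>lborel)" for x
  proof -
    have i: "integrable lborel (\<lambda>y. ?m (x - y) * \<bar>f y\<bar> powr q)"
      by (rule convol_integrable[OF t f(2)])
    have J: "(\<integral>y. ?m (x - y) * \<bar>f y\<bar> \<partial>lborel) powr q
        \<le> (\<integral>y. ?m (x - y) \<partial>lborel) powr (q - 1) * (\<integral>y. ?m (x - y) * \<bar>f y\<bar> powr q \<partial>lborel)"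
      by (rule Jensen_weighted) (use i q \<epsilon> mollifier_nonneg mollifier_integrals in auto)
    have "\<bar>convol ?m f x\<bar> \<le> (\<integral>y. \<bar>?m (x - y) * f y\<bar> \<partial>lborel)"
      unfolding convol_def by (rule integral_abs_bound)
    then have "\<bar>convol ?m f x\<bar> powr q \<le> (\<integral>y. ?m (x - y) * \<bar>f y\<bar> \<partial>lborel) powr q"
      using q by (intro powr_mono2) (auto simp: abs_mult mollifier_nonneg)
    also have "\<dots> \<le> (\<integral>y. ?m (x - y) * \<bar>f y\<bar> powr q \<partial>lborel)"
      using J \<epsilon> by (simp add: mollifier_integrals)
    finally show ?thesis
      using i by (subst nn_integral_eq_integral) (auto simp: mollifier_nonneg ennreal_leI)
  qed
  then have "(\<integral>\<^sup>+x. ennreal (\<bar>convol ?m f x\<bar> powr q) \<partial>lborel)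
      \<le> (\<integral>\<^sup>+x. (\<integral>\<^sup>+y. ennreal (?m (x - y) * \<bar>f y\<bar> powr q) \<partial>lborel) \<partial>lborel)"
    by (intro nn_integral_mono)
  also have "\<dots> = (\<integral>\<^sup>+y. (\<integral>\<^sup>+x. ennreal (?m (x - y) * \<bar>f y\<bar> powr q) \<partial>lborel) \<partial>lborel)"
    by (rule lborel_pair.Fubini') measurable
  also have "\<dots> = (\<integral>\<^sup>+y. (\<integral>\<^sup>+x. ennreal (?m (x - y)) \<partial>lborel) * ennreal (\<bar>f y\<bar> powr q) \<partial>lborel)"
    by (intro nn_integral_cong) (simp add: ennreal_mult' mollifier_nonneg nn_integral_multc)
  also have "\<dots> = (\<integral>\<^sup>+y. ennreal (\<bar>f y\<bar> powr q) \<partial>lborel)"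
    using \<epsilon> by (simp add: mollifier_integrals)
  finally show ?thesis .
qed

section \<open>Approximation in \<open>L^q\<close> by continuous functions and by
  mollification\<close>

definition clip :: "real \<Rightarrow> real \<Rightarrow> real" where
  "clip N t = max (- N) (min N t)"

lemma clip_bounds: "N \<ge> 0 \<Longrightarrow> \<bar>clip N t\<bar> \<le> N" "N \<ge> 0 \<Longrightarrow> \<bar>t - clip N t\<bar> \<le> \<bar>t\<bar>"
    "\<bar>t\<bar> \<le> N \<Longrightarrow> clip N t = t" "N \<ge> 0 \<Longrightarrow> clip N 0 = 0"
  by (auto simp: clip_def)

lemma continuous_on_clip: "continuous_on UNIV (clip N)"
  unfolding clip_def[abs_def] by (intro continuous_intros)

lemma Lq_approx_bounded:
  fixes f :: "'a \<Rightarrow> real"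
  assumes [measurable]: "f \<in> borel_measurable M" and f: "integrable M (\<lambda>x. \<bar>f x\<bar> powr q)"
    and q: "q > 0" and e: "e > 0"
  obtains N where "N > 0" "(\<integral>x. \<bar>f x - clip N (f x)\<bar> powr q \<partial>M) < e"
proof -
  have [measurable]: "clip N \<in> borel_measurable borel" for N
    by (intro borel_measurable_continuous_onI continuous_on_clip)
  have "(\<lambda>n. \<integral>x. \<bar>f x - clip (real n) (f x)\<bar> powr q \<partial>M) \<longlonglongrightarrow> (\<integral>x. 0 \<partial>M)"
  proof (rule integral_dominated_convergence[OF _ _ f])
    show "AE x in M. (\<lambda>n. \<bar>f x - clip (real n) (f x)\<bar> powr q) \<longlonglongrightarrow> 0"
    proof (rule AE_I2)
      fix x
      have "\<forall>\<^sub>F n in sequentially. \<bar>f x\<bar> \<le> real n"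
        using eventually_ge_at_top[of "nat \<lceil>\<bar>f x\<bar>\<rceil>"] by eventually_elim linarith
      then have "\<forall>\<^sub>F n in sequentially. \<bar>f x - clip (real n) (f x)\<bar> powr q = 0"
        by eventually_elim (simp add: clip_bounds)
      then show "(\<lambda>n. \<bar>f x - clip (real n) (f x)\<bar> powr q) \<longlonglongrightarrow> 0"
        by (rule tendsto_eventually)
    qed
    show "AE x in M. norm (\<bar>f x - clip (real n) (f x)\<bar> powr q) \<le> \<bar>f x\<bar> powr q" for n
      using q by (intro AE_I2) (auto intro!: powr_mono2 simp: clip_bounds)
  qed auto
  then have "\<forall>\<^sub>F n in sequentially. (\<integral>x. \<bar>f x - clip (real n) (f x)\<bar> powr q \<partial>M) < e"
    using order_tendstoD(2)[of _ 0 sequentially e] e by simp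
  with eventually_gt_at_top[of 0] have "\<forall>\<^sub>F n in sequentially. n > 0 \<and> (\<integral>x. \<bar>f x - clip (real n) (f x)\<bar> powr q \<partial>M) < e"
    by eventually_elim auto
  then obtain n where "n > 0" "(\<integral>x. \<bar>f x - clip (real n) (f x)\<bar> powr q \<partial>M) < e"
    using eventually_happens' sequentially_bot by blast
  then show ?thesis using that[of "real n"] by auto
qed

text \<open>A measurable function is an almost everywhere limit of continuous ones. Clipping these
  at height \<open>N\<close> and multiplying by a tent function, equal to 1 on the given ball and 0
  off the ball of radius \<open>R + 1\<close>, creates a common majorant, so the convergence also
  holds in \<open>L^q\<close>.\<close>

lemma Lq_approx_continuous:
  fixes f :: "'a::euclidean_space \<Rightarrow> real"
  assumes [measurable]: "f \<in> borel_measurable borel" and f: "integrable lborel (\<lambda>x. \<bar>f x\<bar> powr q)"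
    and f0: "\<And>x. x \<notin> cball x0 R \<Longrightarrow> f x = 0"
    and q: "q > 0" and e: "e > 0"
  obtains g where "continuous_on UNIV g" "\<And>x. x \<notin> cball x0 (R + 1) \<Longrightarrow> g x = 0"
    "(\<integral>\<^sup>+x. ennreal (\<bar>f x - g x\<bar> powr q) \<partial>lborel) \<le> ennreal e"
proof -
  \<comment> \<open>The error splits into the clipping error and the error of approximating the
    clipped function. Two parts at most \<open>e'\<close>, times the constant
    \<open>2 powr q\<close> of \<open>powr_add_le\<close>, give \<open>e\<close>.\<close>
  define e' where "e' = e / (2 * 2 powr q)"
  have e': "e' > 0" using e by (simp add: e'_def)
  have [measurable]: "clip N \<in> borel_measurable borel" for N
    by (intro borel_measurable_continuous_onI continuous_on_clip)
  obtain N where N: "N > 0" "(\<integral>x. \<bar>f x - clip N (f x)\<bar> powr q \<partial>lborel) < e'"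
    using Lq_approx_bounded[OF _ f q e'] by auto
  have "f measurable_on UNIV"
    by (subst measurable_on_iff_borel_measurable) (auto simp: lebesgue_on_UNIV_eq intro: measurable_completion)
  then obtain Z g where Z: "negligible Z" and g: "\<And>n. continuous_on UNIV (g n)"
    and lim: "\<And>x. x \<notin> Z \<Longrightarrow> (\<lambda>n. g n x) \<longlonglongrightarrow> f x"
    unfolding measurable_on_def by auto
  have [measurable]: "g n \<in> borel_measurable borel" for n
    by (intro borel_measurable_continuous_onI g)
  have "AE x in lebesgue. x \<notin> Z"
    using Z by (intro AE_not_in) (simp add: negligible_iff_null_sets)
  then have Z': "AE x in lborel. x \<notin> Z"
    using AE_completion_iff by blast
  define c where "c x = max 0 (min 1 (R + 1 - dist x0 x))" for x
  have c: "0 \<le> c x" "c x \<le> 1" "x \<in> cball x0 R \<Longrightarrow> c x = 1" "x \<notin> cball x0 (R + 1) \<Longrightarrow> c x = 0" for x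
    by (auto simp: c_def)
  have cc: "continuous_on UNIV c"
    unfolding c_def[abs_def] by (intro continuous_intros)
  then have [measurable]: "c \<in> borel_measurable borel"
    by (rule borel_measurable_continuous_onI)
  define h where "h n x = c x * clip N (g n x)" for n x
  have hc: "continuous_on UNIV (h n)" for n
    unfolding h_def[abs_def]
    by (intro continuous_intros cc continuous_on_compose2[OF continuous_on_clip g]) auto
  have bnd_int: "integrable lborel (\<lambda>x. (2 * N) powr q * indicator (cball x0 (R + 1)) (x::'a))"
    by (auto intro!: integrable_real_indicator emeasure_lborel_cball_finite)
  have bnd: "norm (\<bar>clip N (f x) - h n x\<bar> powr q) \<le> (2 * N) powr q * indicator (cball x0 (R + 1)) x" for n x
      proof (cases "x \<in> cball x0 (R + 1)")
        case True
        have "\<bar>h n x\<bar> \<le> 1 * N"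
          unfolding h_def abs_mult using c N(1) by (intro mult_mono) (auto simp: clip_bounds)
        then have "\<bar>clip N (f x) - h n x\<bar> \<le> 2 * N"
          using clip_bounds(1)[of N "f x"] N(1) by linarith
        then show ?thesis
          using True q by (auto intro!: powr_mono2)
      next
        case False
        then show ?thesis
          using f0 c(4) N(1) q by (auto simp: h_def clip_bounds)
      qed
  have "(\<lambda>n. \<integral>x. \<bar>clip N (f x) - h n x\<bar> powr q \<partial>lborel) \<longlonglongrightarrow> (\<integral>x. 0 \<partial>(lborel::'a measure))"
  proof (rule integral_dominated_convergence)
    show "integrable lborel (\<lambda>x. (2 * N) powr q * indicator (cball x0 (R + 1)) (x::'a))"
      by (rule bnd_int)
    show "AE x in lborel. (\<lambda>n. \<bar>clip N (f x) - h n x\<bar> powr q) \<longlonglongrightarrow> 0"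
      using Z'
    proof eventually_elim
      case (elim x)
      have "(\<lambda>n. clip N (g n x)) \<longlonglongrightarrow> clip N (f x)"
        using continuous_on_tendsto_compose[OF continuous_on_clip lim[OF elim]] by simp
      then have "(\<lambda>n. h n x) \<longlonglongrightarrow> c x * clip N (f x)"
        unfolding h_def by (intro tendsto_intros)
      also have "c x * clip N (f x) = clip N (f x)"
        using c(3) f0 N(1) by (cases "x \<in> cball x0 R") (auto simp: clip_bounds)
      finally have "(\<lambda>n. \<bar>clip N (f x) - h n x\<bar>) \<longlonglongrightarrow> \<bar>clip N (f x) - clip N (f x)\<bar>"
        by (intro tendsto_intros)
      then have "(\<lambda>n. \<bar>clip N (f x) - h n x\<bar> powr q) \<longlonglongrightarrow> 0 powr q"
        using q by (intro tendsto_powr') auto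
      then show ?case by simp
    qed
    show "AE x in lborel. norm (\<bar>clip N (f x) - h n x\<bar> powr q) \<le> (2 * N) powr q * indicator (cball x0 (R + 1)) x" for n
      by (intro AE_I2 bnd)
  qed (auto simp: h_def[abs_def])
  then have "\<forall>\<^sub>F n in sequentially. (\<integral>x. \<bar>clip N (f x) - h n x\<bar> powr q \<partial>lborel) < e'"
    using order_tendstoD(2)[of _ 0 sequentially e'] e' by simp
  then obtain n where n: "(\<integral>x. \<bar>clip N (f x) - h n x\<bar> powr q \<partial>lborel) < e'"
    using eventually_happens' sequentially_bot by blast
  show ?thesis
  proof (rule that[OF hc])
    show "h n x = 0" if "x \<notin> cball x0 (R + 1)" for x
      using c(4)[OF that] by (simp add: h_def)
    have i1: "integrable lborel (\<lambda>x. \<bar>f x - clip N (f x)\<bar> powr q)"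
      by (rule Bochner_Integration.integrable_bound[OF f])
         (use q N in \<open>auto intro!: powr_mono2 AE_I2 simp: clip_bounds\<close>)
    have i2: "integrable lborel (\<lambda>x. \<bar>clip N (f x) - h n x\<bar> powr q)"
      by (rule Bochner_Integration.integrable_bound[OF bnd_int]) (use bnd in \<open>auto simp: h_def[abs_def]\<close>)
    have "ennreal (\<bar>f x - h n x\<bar> powr q) \<le> ennreal (2 powr q * (\<bar>f x - clip N (f x)\<bar> powr q + \<bar>clip N (f x) - h n x\<bar> powr q))" for x
    proof (rule ennreal_leI)
      have "\<bar>f x - h n x\<bar> powr q \<le> (\<bar>f x - clip N (f x)\<bar> + \<bar>clip N (f x) - h n x\<bar>) powr q"
        using q by (intro powr_mono2) auto
      also have "\<dots> \<le> 2 powr q * (\<bar>f x - clip N (f x)\<bar> powr q + \<bar>clip N (f x) - h n x\<bar> powr q)"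
        using q by (intro powr_add_le) auto
      finally show "\<bar>f x - h n x\<bar> powr q \<le> 2 powr q * (\<bar>f x - clip N (f x)\<bar> powr q + \<bar>clip N (f x) - h n x\<bar> powr q)" .
    qed
    then have "(\<integral>\<^sup>+x. ennreal (\<bar>f x - h n x\<bar> powr q) \<partial>lborel)
        \<le> (\<integral>\<^sup>+x. ennreal (2 powr q * (\<bar>f x - clip N (f x)\<bar> powr q + \<bar>clip N (f x) - h n x\<bar> powr q)) \<partial>lborel)"
      by (intro nn_integral_mono)
    also have "\<dots> = ennreal (2 powr q * ((\<integral>x. \<bar>f x - clip N (f x)\<bar> powr q \<partial>lborel) + (\<integral>x. \<bar>clip N (f x) - h n x\<bar> powr q \<partial>lborel)))"
      using i1 i2 by (subst nn_integral_eq_integral) auto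
    also have "\<dots> \<le> ennreal (2 powr q * (e' + e'))"
      using N(2) n by (intro ennreal_leI mult_left_mono add_mono) auto
    also have "\<dots> = ennreal e"
      by (simp add: e'_def)
    finally show "(\<integral>\<^sup>+x. ennreal (\<bar>f x - h n x\<bar> powr q) \<partial>lborel) \<le> ennreal e" .
  qed
qed

lemma integrable_powr_diff:
  fixes f g :: "'a \<Rightarrow> real"
  assumes [measurable]: "f \<in> borel_measurable M" "g \<in> borel_measurable M" and q: "q > 0"
    and "integrable M (\<lambda>x. \<bar>f x\<bar> powr q)" "integrable M (\<lambda>x. \<bar>g x\<bar> powr q)"
  shows "integrable M (\<lambda>x. \<bar>f x - g x\<bar> powr q)"
proof (rule Bochner_Integration.integrable_bound)
  show "integrable M (\<lambda>x. 2 powr q * (\<bar>f x\<bar> powr q + \<bar>g x\<bar> powr q))"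
    using assms by auto
  have "\<bar>f x - g x\<bar> powr q \<le> (\<bar>f x\<bar> + \<bar>g x\<bar>) powr q" for x
    using q by (intro powr_mono2) auto
  also have "(\<bar>f x\<bar> + \<bar>g x\<bar>) powr q \<le> 2 powr q * (\<bar>f x\<bar> powr q + \<bar>g x\<bar> powr q)" for x
    using q by (intro powr_add_le) auto
  finally show "AE x in M. norm (\<bar>f x - g x\<bar> powr q) \<le> norm (2 powr q * (\<bar>f x\<bar> powr q + \<bar>g x\<bar> powr q))"
    by auto
qed auto

text \<open>Uniform continuity on the ball of radius \<open>R + 2\<close>, which contains every
  point within distance 1 of the ball of radius \<open>R + 1\<close>. The indicator is part of the
  bound so that it can be integrated.\<close>

lemma mollifier_uniform:
  fixes g :: "real^'n \<Rightarrow> real"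
  assumes g: "continuous_on UNIV g" "\<And>x. x \<notin> cball x0 R \<Longrightarrow> g x = 0" and e: "e > 0"
  shows "\<forall>\<^sub>F \<epsilon> in at_right 0. \<forall>x. \<bar>convol (mollifier \<epsilon>) g x - g x\<bar> \<le> e * indicator (cball x0 (R + 1)) x"
proof -
  have "uniformly_continuous_on (cball x0 (R + 2)) g"
    by (rule compact_uniformly_continuous[OF continuous_on_subset[OF g(1)]]) auto
  then obtain d where d: "d > 0" "\<And>x y. x \<in> cball x0 (R + 2) \<Longrightarrow> y \<in> cball x0 (R + 2) \<Longrightarrow> dist y x < d \<Longrightarrow> dist (g y) (g x) < e"
    unfolding uniformly_continuous_on_def using e by metis
  have gi: "integrable lborel g"
    by (rule continuous_compact_support_integrable[OF g(1) compact_cball g(2)])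
  show ?thesis
    unfolding eventually_at_right_field
  proof (intro exI[of _ "min d 1"] conjI allI impI)
    fix \<epsilon> :: real and x :: "real^'n"
    assume \<epsilon>: "0 < \<epsilon>" "\<epsilon> < min d 1"
    have t: "mollifier \<epsilon> \<in> test_functions (UNIV :: (real^'n) set)"
      using \<epsilon> by (intro mollifier_test_function) auto
    note m = mollifier_integrals[OF \<epsilon>(1), of x]
    have ci: "integrable lborel (\<lambda>y. mollifier \<epsilon> (x - y) * g y)"
      by (rule convol_integrable[OF t gi])
    have eq: "convol (mollifier \<epsilon>) g x - g x = (\<integral>y. mollifier \<epsilon> (x - y) * g y - mollifier \<epsilon> (x - y) * g x \<partial>lborel)"
      using ci m by (simp add: convol_def)
    show "\<bar>convol (mollifier \<epsilon>) g x - g x\<bar> \<le> e * indicator (cball x0 (R + 1)) x"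
    proof (cases "x \<in> cball x0 (R + 1)")
      case True
      have "\<bar>mollifier \<epsilon> (x - y) * g y - mollifier \<epsilon> (x - y) * g x\<bar> \<le> mollifier \<epsilon> (x - y) * e" for y
      proof (cases "dist x y < \<epsilon>")
        case d': True
        have "y \<in> cball x0 (R + 2)" "x \<in> cball x0 (R + 2)" "dist y x < d"
          using True d' \<epsilon> dist_triangle[of x0 y x] by (auto simp: dist_commute)
        then have "\<bar>g y - g x\<bar> \<le> e"
          using d(2)[of x y] by (auto simp: dist_norm)
        then have "mollifier \<epsilon> (x - y) * \<bar>g y - g x\<bar> \<le> mollifier \<epsilon> (x - y) * e"
          by (intro mult_left_mono mollifier_nonneg)
        then show ?thesis
          by (simp add: right_diff_distrib[symmetric] abs_mult mollifier_nonneg)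
      next
        case False
        then have "mollifier \<epsilon> (x - y) = 0"
          using \<epsilon> by (intro mollifier_eq_0) (auto simp: dist_norm)
        then show ?thesis by simp
      qed
      then have "\<bar>convol (mollifier \<epsilon>) g x - g x\<bar> \<le> (\<integral>y. mollifier \<epsilon> (x - y) * e \<partial>lborel)"
        unfolding eq using ci m
        by (intro order_trans[OF integral_abs_bound] integral_mono) auto
      then show ?thesis
        using True m by simp
    next
      case False
      have z: "mollifier \<epsilon> (x - y) * g y = 0" for y
      proof (cases "dist x y < \<epsilon>")
        case True
        then have "y \<notin> cball x0 R"
          using False \<epsilon> dist_triangle[of x0 x y] by (auto simp: dist_commute)
        then show ?thesis by (simp add: g(2))
      next
        case False
        then have "mollifier \<epsilon> (x - y) = 0"
          using \<epsilon> by (intro mollifier_eq_0) (auto simp: dist_norm)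
        then show ?thesis by simp
      qed
      have "convol (mollifier \<epsilon>) g x = (\<integral>y. 0 \<partial>(lborel::(real^'n) measure))"
        unfolding convol_def by (intro Bochner_Integration.integral_cong refl z)
      moreover have "g x = 0" using False by (intro g(2)) auto
      ultimately show ?thesis using e by simp
    qed
  qed (use d in auto)
qed

text \<open>With a continuous \<open>g\<close> close to \<open>f\<close>, the error is the sum of
  the mollified \<open>f - g\<close>, of the mollification error of \<open>g\<close>, and of
  \<open>g - f\<close>. The first is controlled by contraction, the second by uniform convergence on
  a bounded set, the third by the choice of \<open>g\<close>.\<close>

lemma mollifier_converges_Lq:
  fixes f :: "real^'n \<Rightarrow> real"
  assumes f0[measurable]: "f \<in> borel_measurable borel" and f: "integrable lborel (\<lambda>x. \<bar>f x\<bar> powr q)"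
    and f0: "\<And>x. x \<notin> cball x0 R \<Longrightarrow> f x = 0"
    and q: "q \<ge> 1" and e: "e > 0"
  shows "\<forall>\<^sub>F \<epsilon> in at_right 0. (\<integral>\<^sup>+x. ennreal (\<bar>convol (mollifier \<epsilon>) f x - f x\<bar> powr q) \<partial>lborel) \<le> ennreal e"
proof -
  \<comment> \<open>The constant produced by splitting the power of a sum of three terms with
    \<open>powr_add_le\<close> twice.\<close>
  define K where "K = 2 powr q * (1 + 2 powr q * 2)"
  have K: "K > 0" unfolding K_def by (intro mult_pos_pos add_pos_nonneg) auto
  define e1 where "e1 = e / K"
  have e1: "e1 > 0" using e K by (simp add: e1_def)
  obtain g where g: "continuous_on UNIV g" "\<And>x. x \<notin> cball x0 (R + 1) \<Longrightarrow> g x = 0"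
    and fg: "(\<integral>\<^sup>+x. ennreal (\<bar>f x - g x\<bar> powr q) \<partial>lborel) \<le> ennreal e1"
    using Lq_approx_continuous[OF _ f f0 _ e1] q by auto
  have [measurable]: "g \<in> borel_measurable borel"
    by (rule borel_measurable_continuous_onI[OF g(1)])
  have fi: "integrable lborel f"
    by (rule integrable_of_powr_bounded_support1[OF _ f f0 q]) auto
  have gi: "integrable lborel g"
    by (rule continuous_compact_support_integrable[OF g(1) compact_cball g(2)])
  have gq: "integrable lborel (\<lambda>x. \<bar>g x\<bar> powr q)"
    using q by (intro continuous_compact_support_integrable[of _ "cball x0 (R + 1)"] continuous_on_powr' g(1) continuous_intros)
      (auto simp: g(2))
  have fgq: "integrable lborel (\<lambda>x. \<bar>f x - g x\<bar> powr q)"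
    using q f gq by (intro integrable_powr_diff) auto
  \<comment> \<open>The volume of the set where the mollification error of \<open>g\<close> can be
    nonzero, increased by 1 to be positive as a denominator.\<close>
  define V where "V = 1 + measure lborel (cball x0 (R + 2))"
  have V: "V > 0" "measure lborel (cball x0 (R + 2)) \<le> V" unfolding V_def by (auto intro: add_pos_nonneg)
  define e2 where "e2 = (e1 / V) powr (1 / q)"
  have e2: "e2 > 0" "e2 powr q = e1 / V"
    using e1 V q by (auto simp: e2_def powr_powr)
  have "\<forall>\<^sub>F \<epsilon> in at_right 0. \<forall>x. \<bar>convol (mollifier \<epsilon>) g x - g x\<bar> \<le> e2 * indicator (cball x0 (R + 1 + 1)) x"
    by (rule mollifier_uniform[OF g(1) _ e2(1)]) (rule g(2))
  with eventually_at_right_less[of 0]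
  show ?thesis
  proof eventually_elim
    case (elim \<epsilon>)
    let ?m = "mollifier \<epsilon> :: real^'n \<Rightarrow> real"
    have t: "?m \<in> test_functions UNIV"
      using elim by (intro mollifier_test_function) auto
    note [measurable] = borel_measurable_convol[OF t fi] borel_measurable_convol[OF t gi]
      borel_measurable_convol[OF t Bochner_Integration.integrable_diff[OF fi gi]]
    let ?a = "\<lambda>x. \<bar>convol ?m (\<lambda>x. f x - g x) x\<bar>" and ?b = "\<lambda>x. \<bar>convol ?m g x - g x\<bar>" and ?c = "\<lambda>x. \<bar>f x - g x\<bar>"
    have pw: "ennreal (\<bar>convol ?m f x - f x\<bar> powr q) \<le>
        ennreal (2 powr q) * (ennreal (?a x powr q) + ennreal (2 powr q) * (ennreal (?b x powr q) + ennreal (?c x powr q)))" for x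
    proof -
      have "convol ?m f x = convol ?m (\<lambda>x. f x - g x) x + convol ?m g x"
        using convol_integrable[OF t fi, of x] convol_integrable[OF t gi, of x]
        by (simp add: convol_def right_diff_distrib)
      then have "\<bar>convol ?m f x - f x\<bar> \<le> ?a x + (?b x + ?c x)"
        by linarith
      then have "\<bar>convol ?m f x - f x\<bar> powr q \<le> (?a x + (?b x + ?c x)) powr q"
        using q by (intro powr_mono2) auto
      also have "\<dots> \<le> 2 powr q * (?a x powr q + (?b x + ?c x) powr q)"
        using q by (intro powr_add_le) auto
      also have "\<dots> \<le> 2 powr q * (?a x powr q + 2 powr q * (?b x powr q + ?c x powr q))"
        using q by (intro mult_left_mono add_left_mono powr_add_le) auto
      finally show ?thesis
        by (simp add: ennreal_leI flip: ennreal_mult' ennreal_plus)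
    qed
    have A: "(\<integral>\<^sup>+x. ennreal (?a x powr q) \<partial>lborel) \<le> ennreal e1"
      using convol_mollifier_contraction[OF elim(1) q Bochner_Integration.integrable_diff[OF fi gi] fgq] fg by (rule order_trans)
    have B: "(\<integral>\<^sup>+x. ennreal (?b x powr q) \<partial>lborel) \<le> ennreal e1"
    proof -
      have "?b x powr q \<le> e2 powr q * indicator (cball x0 (R + 2)) x" for x
      proof -
        have "?b x powr q \<le> (e2 * indicator (cball x0 (R + 1 + 1)) x) powr q"
          using elim(2)[rule_format, of x] q by (intro powr_mono2) auto
        then show ?thesis
          using q by (auto simp: indicator_def split: if_splits)
      qed
      then have "(\<integral>\<^sup>+x. ennreal (?b x powr q) \<partial>lborel) \<le> (\<integral>\<^sup>+x. ennreal (e2 powr q) * indicator (cball x0 (R + 2)) x \<partial>lborel)"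
        by (intro nn_integral_mono) (metis (no_types, lifting) ennreal_leI ennreal_mult' ennreal_indicator powr_ge_zero)
      also have "\<dots> = ennreal (e2 powr q * measure lborel (cball x0 (R + 2)))"
        using emeasure_lborel_cball_finite[of x0 "R + 2"]
        by (subst nn_integral_cmult_indicator) (auto simp: ennreal_mult' emeasure_eq_ennreal_measure)
      also have "\<dots> \<le> ennreal (e2 powr q * V)"
        by (intro ennreal_leI mult_left_mono V) auto
      also have "\<dots> = ennreal e1"
        using V by (simp add: e2)
      finally show ?thesis .
    qed
    have "(\<integral>\<^sup>+x. ennreal (\<bar>convol ?m f x - f x\<bar> powr q) \<partial>lborel) \<le>
        (\<integral>\<^sup>+x. ennreal (2 powr q) * (ennreal (?a x powr q) + ennreal (2 powr q) * (ennreal (?b x powr q) + ennreal (?c x powr q))) \<partial>lborel)"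
      by (intro nn_integral_mono pw)
    also have "\<dots> = ennreal (2 powr q) * ((\<integral>\<^sup>+x. ennreal (?a x powr q) \<partial>lborel) + ennreal (2 powr q) * ((\<integral>\<^sup>+x. ennreal (?b x powr q) \<partial>lborel) + (\<integral>\<^sup>+x. ennreal (?c x powr q) \<partial>lborel)))"
      by (simp add: nn_integral_cmult nn_integral_add)
    also have "\<dots> \<le> ennreal (2 powr q) * (ennreal e1 + ennreal (2 powr q) * (ennreal e1 + ennreal e1))"
      by (intro mult_left_mono add_mono A B fg) auto
    also have "\<dots> = ennreal (2 powr q * (e1 + 2 powr q * (e1 + e1)))"
      using e1 by (simp flip: ennreal_mult' ennreal_plus)
    also have "2 powr q * (e1 + 2 powr q * (e1 + e1)) = e1 * K"
      by (simp add: K_def algebra_simps)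
    also have "\<dots> = e"
      using K by (simp add: e1_def)
    finally show ?case .
  qed
qed

text \<open>The kernel centred at \<open>x\<close> is itself an admissible test function as long as
  its support stays in the ball; this is the hypothesis on \<open>\<epsilon>\<close>. Its gradient
  in \<open>y\<close> has the opposite sign, which cancels the minus sign in the definition of the
  weak derivative.\<close>

lemma partial_deriv_convol_mollifier:
  fixes v :: "real^'n \<Rightarrow> real"
  assumes v: "integrable lborel v" and D: "integrable lborel D"
    and weak: "\<And>\<phi>. \<phi> \<in> test_functions (ball x0 R) \<Longrightarrow>
        (\<integral>x. v x * partial_deriv i \<phi> x \<partial>lborel) = - (\<integral>x. D x * \<phi> x \<partial>lborel)"
    and \<epsilon>: "0 < \<epsilon>" and x: "dist x0 x + \<epsilon> < R"
  shows "partial_deriv i (convol (mollifier \<epsilon>) v) x = convol (mollifier \<epsilon>) D x"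
proof -
  let ?m = "mollifier \<epsilon> :: real^'n \<Rightarrow> real"
  have t: "?m \<in> test_functions UNIV"
    using \<epsilon> by (intro mollifier_test_function) auto
  define \<phi> where "\<phi> y = ?m (x - y)" for y
  have \<phi>: "\<phi> = (\<lambda>y. cutoff x 0 \<epsilon> y * (1 / (\<integral>x. cutoff 0 0 \<epsilon> (x::real^'n) \<partial>lborel)))"
    by (simp add: fun_eq_iff \<phi>_def mollifier_def cutoff_def norm_minus_commute)
  have "cball x \<epsilon> \<subseteq> ball x0 R"
  proof
    show "y \<in> ball x0 R" if "y \<in> cball x \<epsilon>" for y
      using that x dist_triangle[of x0 y x] by simp
  qed
  then have t\<phi>: "\<phi> \<in> test_functions (ball x0 R)"
    unfolding \<phi> using \<epsilon> by (intro test_functions_mult cutoff_test_function smooth_const) auto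
  have d\<phi>: "partial_deriv i \<phi> y = - partial_deriv i ?m (x - y)" for y
  proof -
    have "(?m has_derivative (\<lambda>h. gradient ?m (x - y) \<bullet> h)) (at (x - y))"
      by (intro smooth_has_derivative test_functions_smooth[OF t])
    then have "(\<phi> has_derivative (\<lambda>h. gradient ?m (x - y) \<bullet> (- h))) (at y)"
      unfolding \<phi>_def
      by (rule has_derivative_compose[rotated]) (auto intro!: derivative_eq_intros)
    from partial_deriv_eqI[OF this, of i] show ?thesis
      by (simp add: partial_deriv_gradient inner_axis)
  qed
  have "partial_deriv i (convol ?m v) x = (\<integral>y. partial_deriv i ?m (x - y) * v y \<partial>lborel)"
    by (simp add: partial_deriv_convol[OF t v] convol_def)
  also have "\<dots> = - (\<integral>y. v y * partial_deriv i \<phi> y \<partial>lborel)"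
    by (simp add: d\<phi> mult.commute)
  also have "\<dots> = (\<integral>y. D y * \<phi> y \<partial>lborel)"
    by (simp add: weak[OF t\<phi>])
  finally show ?thesis
    by (simp add: convol_def \<phi>_def mult.commute)
qed

text \<open>The parameters of the mollification are chosen so that the \<open>L^q\<close> errors
  decay geometrically. Their \<open>q\<close>-th powers are then summable almost everywhere, which
  yields both pointwise convergence and a single majorant \<open>H\<close> in \<open>L^q\<close>.
  Nonlinear expressions in \<open>w j\<close> can thus be treated by dominated convergence. The
  smaller radius \<open>R'\<close> leaves room for the support of the mollifier.\<close>

lemma smooth_approximation:
  fixes v :: "real^'n \<Rightarrow> real" and D :: "real^'n \<Rightarrow> real^'n"
  assumes [measurable]: "v \<in> borel_measurable borel" "D \<in> borel_measurable borel"
    and v: "integrable lborel (\<lambda>x. \<bar>v x\<bar> powr q)" and D: "integrable lborel (\<lambda>x. norm (D x) powr q)"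
    and v0: "\<And>x. x \<notin> cball x0 R \<Longrightarrow> v x = 0" and D0: "\<And>x. x \<notin> cball x0 R \<Longrightarrow> D x = 0"
    and weak: "\<And>\<phi> i. \<phi> \<in> test_functions (ball x0 R) \<Longrightarrow>
        (\<integral>x. v x * partial_deriv i \<phi> x \<partial>lborel) = - (\<integral>x. D x $ i * \<phi> x \<partial>lborel)"
    and q: "1 \<le> q" and R: "R' < R"
  obtains w H where "\<And>j. smooth (w j)" "H \<in> borel_measurable borel" "integrable lborel (\<lambda>x. H x powr q)"
    "\<And>x. 0 \<le> H x"
    "AE x in lborel. x \<in> ball x0 R' \<longrightarrow> (\<lambda>j. w j x) \<longlonglongrightarrow> v x"
    "AE x in lborel. x \<in> ball x0 R' \<longrightarrow> (\<lambda>j. gradient (w j) x) \<longlonglongrightarrow> D x"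
    "AE x in lborel. x \<in> ball x0 R' \<longrightarrow> (\<forall>j. \<bar>w j x\<bar> \<le> H x)"
    "AE x in lborel. x \<in> ball x0 R' \<longrightarrow> (\<forall>j. norm (gradient (w j) x) \<le> H x)"
proof -
  \<comment> \<open>The function and the components of its gradient are treated as one finite
    family, so that the same \<open>\<epsilon> j\<close> works for all of them.\<close>
  define F where "F k = (case k of None \<Rightarrow> v | Some i \<Rightarrow> (\<lambda>x. D x $ i))" for k
  have Fm[measurable]: "F k \<in> borel_measurable borel" for k
  proof -
    have [measurable]: "(\<lambda>z. z $ i) \<in> borel_measurable borel" for i :: 'n
      by (intro borel_measurable_continuous_onI continuous_intros)
    show ?thesis
      by (cases k) (simp_all add: F_def)
  qed
  have Fq: "integrable lborel (\<lambda>x. \<bar>F k x\<bar> powr q)" for k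
  proof (cases k)
    case (Some i)
    have "integrable lborel (\<lambda>x. \<bar>D x $ i\<bar> powr q)"
      by (rule Bochner_Integration.integrable_bound[OF D])
        (use q in \<open>auto intro!: powr_mono2 AE_I2 component_le_norm_cart\<close>)
    then show ?thesis using Some by (simp add: F_def)
  qed (use v in \<open>simp add: F_def\<close>)
  have F0: "F k x = 0" if "x \<notin> cball x0 R" for k x
    using that v0 D0 by (auto simp: F_def split: option.split)
  have Fi: "integrable lborel (F k)" for k
    by (rule integrable_of_powr_bounded_support1[OF Fm Fq F0 q])
  have "\<exists>\<epsilon>. 0 < \<epsilon> \<and> \<epsilon> < R - R' \<and> (\<forall>k. (\<integral>\<^sup>+x. ennreal (\<bar>convol (mollifier \<epsilon>) (F k) x - F k x\<bar> powr q) \<partial>lborel) \<le> ennreal ((1/2) ^ j))" for j :: nat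
  proof -
    have "\<forall>\<^sub>F \<epsilon> in at_right 0. (\<forall>k. (\<integral>\<^sup>+x. ennreal (\<bar>convol (mollifier \<epsilon>) (F k) x - F k x\<bar> powr q) \<partial>lborel) \<le> ennreal ((1/2) ^ j))"
      by (intro eventually_all_finite mollifier_converges_Lq[OF Fm Fq F0 q]) auto
    moreover have "\<forall>\<^sub>F \<epsilon> in at_right (0::real). 0 < \<epsilon>" "\<forall>\<^sub>F \<epsilon> in at_right 0. \<epsilon> < R - R'"
      using R by (auto intro: eventually_at_right_less order_tendstoD(2)[OF tendsto_ident_at])
    ultimately have "\<forall>\<^sub>F \<epsilon> in at_right 0. 0 < \<epsilon> \<and> \<epsilon> < R - R' \<and> (\<forall>k. (\<integral>\<^sup>+x. ennreal (\<bar>convol (mollifier \<epsilon>) (F k) x - F k x\<bar> powr q) \<partial>lborel) \<le> ennreal ((1/2) ^ j))"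
      by (intro eventually_conj)
    then show ?thesis
      by (intro eventually_happens'[of "at_right 0"]) auto
  qed
  then have "\<forall>j. \<exists>\<epsilon>. 0 < \<epsilon> \<and> \<epsilon> < R - R' \<and> (\<forall>k. (\<integral>\<^sup>+x. ennreal (\<bar>convol (mollifier \<epsilon>) (F k) x - F k x\<bar> powr q) \<partial>lborel) \<le> ennreal ((1/2) ^ j))"
    by (rule allI)
  from choice[OF this] obtain \<epsilon> where all: "\<forall>j. 0 < \<epsilon> j \<and> \<epsilon> j < R - R' \<and> (\<forall>k. (\<integral>\<^sup>+x. ennreal (\<bar>convol (mollifier (\<epsilon> j)) (F k) x - F k x\<bar> powr q) \<partial>lborel) \<le> ennreal ((1/2) ^ j))"
    by (rule exE)
  have \<epsilon>: "\<And>j. 0 < \<epsilon> j" "\<And>j. \<epsilon> j < R - R'"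
    and lim: "\<And>j k. (\<integral>\<^sup>+x. ennreal (\<bar>convol (mollifier (\<epsilon> j)) (F k) x - F k x\<bar> powr q) \<partial>lborel) \<le> ennreal ((1/2) ^ j)"
    by (simp_all add: all)
  define c where "c j k = convol (mollifier (\<epsilon> j)) (F k)" for j k
  have t: "mollifier (\<epsilon> j) \<in> test_functions (UNIV :: (real^'n) set)" for j
    by (intro mollifier_test_function \<epsilon>) auto
  have [measurable]: "c j k \<in> borel_measurable borel" for j k
    unfolding c_def by (rule borel_measurable_convol[OF t Fi])
  \<comment> \<open>Finiteness of this sum at \<open>x\<close> gives convergence of each error to 0,
    and its value dominates the \<open>q\<close>-th power of each error.\<close>
  define S where "S x = (\<Sum>k\<in>UNIV. \<Sum>j. ennreal (\<bar>c j k x - F k x\<bar> powr q))" for x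
  have [measurable]: "S \<in> borel_measurable borel"
    unfolding S_def[abs_def] by measurable
  have "(\<integral>\<^sup>+x. S x \<partial>lborel) = (\<Sum>k\<in>UNIV. \<integral>\<^sup>+x. (\<Sum>j. ennreal (\<bar>c j k x - F k x\<bar> powr q)) \<partial>lborel)"
    unfolding S_def by (rule nn_integral_sum) measurable
  also have "\<dots> = (\<Sum>k\<in>UNIV. \<Sum>j. \<integral>\<^sup>+x. ennreal (\<bar>c j k x - F k x\<bar> powr q) \<partial>lborel)"
    by (intro sum.cong refl nn_integral_suminf) measurable
  also have "\<dots> \<le> (\<Sum>k\<in>(UNIV :: 'n option set). \<Sum>j. ennreal ((1/2) ^ j))"
    unfolding c_def by (intro sum_mono suminf_le lim) auto
  also have "\<dots> < \<infinity>"
  proof -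
    have "(\<Sum>j. ennreal ((1/2::real) ^ j)) = ennreal (\<Sum>j. (1/2) ^ j)"
      by (intro suminf_ennreal2) (auto intro: summable_geometric)
    then show ?thesis
      by (simp add: ennreal_mult_less_top of_nat_less_top)
  qed
  finally have S_fin: "(\<integral>\<^sup>+x. S x \<partial>lborel) < \<infinity>" .
  then have AE_fin: "AE x in lborel. S x < \<infinity>"
    by (intro nn_integral_PInf_AE[THEN AE_mp, OF _ _ AE_I2]) (auto simp: less_top)
  define s where "s x = enn2real (S x)" for x
  have [measurable]: "s \<in> borel_measurable borel"
    unfolding s_def[abs_def] by measurable
  have si: "integrable lborel s"
  proof (rule integrableI_nonneg)
    have "(\<integral>\<^sup>+x. ennreal (s x) \<partial>lborel) \<le> (\<integral>\<^sup>+x. S x \<partial>lborel)"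
      by (intro nn_integral_mono) (simp add: s_def ennreal_enn2real_if)
    then show "(\<integral>\<^sup>+x. ennreal (s x) \<partial>lborel) < \<infinity>"
      using S_fin by (rule le_less_trans)
  qed (simp_all add: s_def)
  have sb: "\<bar>c j k x - F k x\<bar> powr q \<le> s x" and clim: "(\<lambda>j. c j k x) \<longlonglongrightarrow> F k x" if "S x < \<infinity>" for x j k
  proof -
    have le: "(\<Sum>j. ennreal (\<bar>c j k x - F k x\<bar> powr q)) \<le> S x"
    proof -
      define T where "T k = (\<Sum>j. ennreal (\<bar>c j k x - F k x\<bar> powr q))" for k
      have "T k \<le> sum T UNIV"
        by (rule member_le_sum) simp_all
      then show ?thesis
        unfolding S_def T_def[abs_def] .
    qed
    have "ennreal (\<bar>c j k x - F k x\<bar> powr q) \<le> (\<Sum>j. ennreal (\<bar>c j k x - F k x\<bar> powr q))"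
    proof -
      define T where "T j = ennreal (\<bar>c j k x - F k x\<bar> powr q)" for j
      have "T j \<le> suminf T"
        using sum_le_suminf[OF summableI, of "{j}" T] by simp
      then show ?thesis
        unfolding T_def[abs_def] .
    qed
    also note le
    also have "S x = ennreal (s x)"
      using that by (simp add: s_def)
    finally show "\<bar>c j k x - F k x\<bar> powr q \<le> s x"
      by (subst (asm) ennreal_le_iff) (auto simp: s_def)
    have "(\<Sum>j. ennreal (\<bar>c j k x - F k x\<bar> powr q)) \<noteq> top"
      using le that by (auto simp: top_unique)
    then have "summable (\<lambda>j. \<bar>c j k x - F k x\<bar> powr q)"
      by (intro summable_suminf_not_top) auto
    then have "(\<lambda>j. \<bar>c j k x - F k x\<bar> powr q) \<longlonglongrightarrow> 0"
      by (rule summable_LIMSEQ_zero)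
    then have "(\<lambda>j. (\<bar>c j k x - F k x\<bar> powr q) powr (1 / q)) \<longlonglongrightarrow> 0 powr (1 / q)"
      using q by (intro tendsto_powr') auto
    then have "(\<lambda>j. \<bar>c j k x - F k x\<bar>) \<longlonglongrightarrow> 0"
      using q by (simp add: powr_powr)
    then show "(\<lambda>j. c j k x) \<longlonglongrightarrow> F k x"
      using LIM_zero_cancel tendsto_rabs_zero_iff by blast
  qed
  define n where "n = real CARD('n)"
  have n: "n \<ge> 1" unfolding n_def using zero_less_card_finite[where 'a = 'n] by linarith
  \<comment> \<open>The norm of a gradient is bounded by the sum of its \<open>n\<close> components;
    the factor \<open>n\<close> accounts for that.\<close>
  define H where "H x = n * (\<bar>v x\<bar> + norm (D x) + s x powr (1 / q))" for x
  have [measurable]: "H \<in> borel_measurable borel"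
    unfolding H_def[abs_def] by measurable
  have s0: "0 \<le> s x" for x by (simp add: s_def)
  have H0: "0 \<le> H x" for x
    using n by (simp add: H_def)
  define w where "w j = c j None" for j
  have gw: "gradient (w j) x $ i = c j (Some i) x" if "x \<in> ball x0 R'" for x j i
    unfolding w_def c_def F_def partial_deriv_gradient[symmetric] option.case
    by (rule partial_deriv_convol_mollifier[OF _ _ weak])
       (use \<epsilon>[of j] that Fi[of None] Fi[of "Some i"] in \<open>auto simp: F_def\<close>)
  have cb: "\<bar>c j k x\<bar> \<le> \<bar>F k x\<bar> + s x powr (1 / q)" if "S x < \<infinity>" for x j k
  proof -
    have "(\<bar>c j k x - F k x\<bar> powr q) powr (1 / q) \<le> s x powr (1 / q)"
      using q by (intro powr_mono2 sb that) auto
    then show ?thesis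
      using q by (simp add: powr_powr)
  qed
  show ?thesis
  proof (rule that[of w H])
    show "smooth (w j)" for j
      unfolding w_def c_def by (rule smooth_convol[OF t Fi])
    have "H x powr q \<le> n powr q * (2 powr q * (2 powr q * (\<bar>v x\<bar> powr q + norm (D x) powr q) + s x))" for x
    proof -
      have "(\<bar>v x\<bar> + norm (D x) + s x powr (1 / q)) powr q
        \<le> 2 powr q * ((\<bar>v x\<bar> + norm (D x)) powr q + (s x powr (1 / q)) powr q)"
        using q by (intro powr_add_le) auto
      also have "(s x powr (1 / q)) powr q = s x"
        using q s0 by (simp add: powr_powr)
      also have "2 powr q * ((\<bar>v x\<bar> + norm (D x)) powr q + s x)
          \<le> 2 powr q * (2 powr q * (\<bar>v x\<bar> powr q + norm (D x) powr q) + s x)"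
        using q by (intro mult_left_mono add_right_mono powr_add_le) auto
      finally show ?thesis
        using n by (simp add: H_def powr_mult mult_left_mono)
    qed
    then show "integrable lborel (\<lambda>x. H x powr q)"
      by (intro Bochner_Integration.integrable_bound[where g = "\<lambda>x. H x powr q" and
            f = "\<lambda>x. n powr q * (2 powr q * (2 powr q * (\<bar>v x\<bar> powr q + norm (D x) powr q) + s x))"])
         (use v D si s0 in \<open>auto\<close>)
    show "AE x in lborel. x \<in> ball x0 R' \<longrightarrow> (\<lambda>j. w j x) \<longlonglongrightarrow> v x"
      using AE_fin by eventually_elim (use clim[of _ None] in \<open>auto simp: w_def F_def\<close>)
    show "AE x in lborel. x \<in> ball x0 R' \<longrightarrow> (\<lambda>j. gradient (w j) x) \<longlonglongrightarrow> D x"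
      using AE_fin
    proof eventually_elim
      case (elim x)
      show ?case
      proof
        assume x: "x \<in> ball x0 R'"
        show "(\<lambda>j. gradient (w j) x) \<longlonglongrightarrow> D x"
          using clim[OF elim, of "Some _"] by (intro vec_tendstoI) (auto simp: gw[OF x] F_def)
      qed
    qed
    show "AE x in lborel. x \<in> ball x0 R' \<longrightarrow> (\<forall>j. \<bar>w j x\<bar> \<le> H x)"
      using AE_fin
    proof eventually_elim
      case (elim x)
      have "\<bar>w j x\<bar> \<le> H x" for j
      proof -
        have "\<bar>w j x\<bar> \<le> 1 * (\<bar>v x\<bar> + norm (D x) + s x powr (1 / q))"
          using cb[OF elim, of j None] by (simp add: w_def F_def) (smt (verit) norm_ge_zero)
        also have "\<dots> \<le> H x"
          unfolding H_def using n by (intro mult_right_mono) auto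
        finally show ?thesis .
      qed
      then show ?case by simp
    qed
    show "AE x in lborel. x \<in> ball x0 R' \<longrightarrow> (\<forall>j. norm (gradient (w j) x) \<le> H x)"
      using AE_fin
    proof eventually_elim
      case (elim x)
      have "norm (gradient (w j) x) \<le> H x" if x: "x \<in> ball x0 R'" for j
      proof -
        have "norm (gradient (w j) x) \<le> (\<Sum>i\<in>UNIV. \<bar>gradient (w j) x $ i\<bar>)"
          by (rule norm_le_l1_cart)
        also have "\<dots> \<le> (\<Sum>i\<in>(UNIV :: 'n set). \<bar>v x\<bar> + norm (D x) + s x powr (1 / q))"
        proof (rule sum_mono)
          fix i
          have "\<bar>gradient (w j) x $ i\<bar> \<le> \<bar>D x $ i\<bar> + s x powr (1 / q)"
            using cb[OF elim, of j "Some i"] by (simp add: gw[OF x] F_def)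
          then show "\<bar>gradient (w j) x $ i\<bar> \<le> \<bar>v x\<bar> + norm (D x) + s x powr (1 / q)"
            using component_le_norm_cart[of "D x" i] by linarith
        qed
        also have "\<dots> = H x"
          by (simp add: H_def n_def)
        finally show ?thesis .
      qed
      then show ?case by simp
    qed
  qed (use H0 in auto)
qed

subsection \<open>A subcritical Sobolev inequality\<close>

text \<open>The two terms on the right of \<open>Wj\<close> balance when \<open>b ^ j\<close> is
  comparable to \<open>\<rho> = \<Gamma> / P\<close>: both are then of size
  \<open>\<rho>^(p / r) P\<close>, because \<open>\<sigma> = 1 - p / r\<close>. Raised to the power
  \<open>r / p\<close> this is \<open>P^(r / p - 1) \<Gamma>\<close>. For
  \<open>\<Gamma> \<le> P\<close> no such nonnegative \<open>j\<close> need exist, and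
  \<open>W1\<close> takes over.\<close>

lemma dyadic_interpolation:
  fixes P \<Gamma> W p r b K \<sigma> :: real
  assumes P: "P > 0" and \<Gamma>: "\<Gamma> \<ge> 0" and W: "W \<ge> 0" and pr: "0 < p" "p < r" and \<sigma>: "\<sigma> = 1 - p / r"
    and b: "b > 1" and K: "K \<ge> 0" and W1: "W \<le> 2 * \<Gamma>"
    and Wj: "\<And>j::nat. W \<le> K * ((b ^ j) powr (- \<sigma>) * \<Gamma> + (b ^ j) powr (p / r) * P)"
  shows "W powr (r / p) \<le> (2 powr (r / p) + (K * (b powr \<sigma> + 1)) powr (r / p)) * P powr (r / p - 1) * \<Gamma>"
proof (cases "\<Gamma> \<le> P")
  case True
  have "W powr (r / p) \<le> (2 * \<Gamma>) powr (r / p)"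
    using W W1 pr by (intro powr_mono2) auto
  also have "\<dots> = 2 powr (r / p) * \<Gamma> powr (r / p)"
    using \<Gamma> by (simp add: powr_mult)
  also have "\<Gamma> powr (r / p) = \<Gamma> powr (r / p - 1) * \<Gamma>"
    using \<Gamma> powr_add[of \<Gamma> "r / p - 1" 1] by (cases "\<Gamma> = 0") auto
  also have "2 powr (r / p) * (\<Gamma> powr (r / p - 1) * \<Gamma>) \<le> 2 powr (r / p) * (P powr (r / p - 1) * \<Gamma>)"
    using True \<Gamma> pr by (intro mult_left_mono mult_right_mono powr_mono2) (auto simp: field_simps)
  also have "\<dots> \<le> (2 powr (r / p) + (K * (b powr \<sigma> + 1)) powr (r / p)) * (P powr (r / p - 1) * \<Gamma>)"
    using \<Gamma> by (intro mult_right_mono) auto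
  finally show ?thesis by (simp add: mult.assoc)
next
  case False
  define \<rho> where "\<rho> = \<Gamma> / P"
  have \<rho>: "\<rho> > 1" "\<Gamma> = \<rho> * P" using False P by (auto simp: \<rho>_def)
  \<comment> \<open>The predecessor \<open>j\<close> of the least such \<open>k\<close> satisfies
    \<open>b ^ j \<le> \<rho> < b ^ (j + 1)\<close>, so the balance is met up to a factor
    \<open>b\<close>.\<close>
  define k where "k = (LEAST k. \<rho> < b ^ k)"
  have k: "\<rho> < b ^ k"
    unfolding k_def using real_arch_pow[OF b, of \<rho>] by (rule LeastI_ex)
  then have "k \<noteq> 0" using \<rho> by (intro notI) simp
  then obtain j where j: "k = Suc j" by (cases k) auto
  have jle: "b ^ j \<le> \<rho>"
    using not_less_Least[of j "\<lambda>k. \<rho> < b ^ k"] j by (simp add: k_def[symmetric])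
  have jge: "\<rho> / b \<le> b ^ j"
    using k j b by (simp add: field_simps)
  have s0: "\<sigma> > 0" using pr by (simp add: \<sigma>)
  have "(b ^ j) powr (- \<sigma>) \<le> (\<rho> / b) powr (- \<sigma>)"
    using s0 \<rho> b jge by (intro powr_mono2') auto
  also have "\<dots> = b powr \<sigma> * \<rho> powr (- \<sigma>)"
    using \<rho> b by (simp add: powr_divide powr_minus divide_simps)
  finally have "(b ^ j) powr (- \<sigma>) * \<Gamma> \<le> b powr \<sigma> * \<rho> powr (- \<sigma>) * \<Gamma>"
    using \<Gamma> by (intro mult_right_mono)
  also have "\<dots> = b powr \<sigma> * (\<rho> powr (- \<sigma>) * \<rho> powr 1) * P"
    using \<rho> by simp
  also have "\<rho> powr (- \<sigma>) * \<rho> powr 1 = \<rho> powr (p / r)"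
    by (subst powr_add[symmetric]) (simp add: \<sigma>)
  finally have 1: "(b ^ j) powr (- \<sigma>) * \<Gamma> \<le> b powr \<sigma> * \<rho> powr (p / r) * P" .
  have 2: "(b ^ j) powr (p / r) * P \<le> \<rho> powr (p / r) * P"
    using jle P b pr by (intro mult_right_mono powr_mono2) auto
  have "W \<le> K * (b powr \<sigma> * \<rho> powr (p / r) * P + \<rho> powr (p / r) * P)"
    by (rule order_trans[OF Wj[of j]]) (intro mult_left_mono add_mono 1 2 K)
  also have "\<dots> = (K * (b powr \<sigma> + 1)) * \<rho> powr (p / r) * P"
    by (simp add: algebra_simps)
  finally have "W powr (r / p) \<le> ((K * (b powr \<sigma> + 1)) * \<rho> powr (p / r) * P) powr (r / p)"
    using W pr by (intro powr_mono2) auto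
  also have "\<dots> = (K * (b powr \<sigma> + 1)) powr (r / p) * \<rho> * P powr (r / p)"
    using K P \<rho> pr by (simp add: powr_mult powr_powr)
  also have "P powr (r / p) = P powr (r / p - 1) * P"
    using P powr_add[of P "r / p - 1" 1] by simp
  also have "(K * (b powr \<sigma> + 1)) powr (r / p) * \<rho> * (P powr (r / p - 1) * P)
      = (K * (b powr \<sigma> + 1)) powr (r / p) * (P powr (r / p - 1) * \<Gamma>)"
    by (simp add: \<rho>(2))
  also have "\<dots> \<le> (2 powr (r / p) + (K * (b powr \<sigma> + 1)) powr (r / p)) * (P powr (r / p - 1) * \<Gamma>)"
    using \<Gamma> by (intro mult_right_mono) auto
  finally show ?thesis by (simp add: mult.assoc)
qed

text \<open>The fundamental theorem of calculus along the segment from \<open>x\<close> to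
  \<open>x + y\<close>, followed by Jensen's inequality on \<open>{0..1}\<close>.\<close>

lemma smooth_increment_bound:
  fixes w :: "real^'n \<Rightarrow> real"
  assumes w: "smooth w" and p: "p \<ge> 1"
  shows "ennreal (\<bar>w (x + y) - w x\<bar> powr p) \<le>
    (\<integral>\<^sup>+t. ennreal (norm y powr p * (indicator {0..1} t * norm (gradient w (x + t *\<^sub>R y)) powr p)) \<partial>lborel)"
proof -
  let ?g = "\<lambda>t::real. gradient w (x + t *\<^sub>R y)"
  have cg: "continuous_on UNIV ?g"
    by (intro continuous_on_compose2[OF smooth_continuous_gradient[OF w]] continuous_intros) auto
  have [measurable]: "?g \<in> borel_measurable borel"
    by (rule borel_measurable_continuous_onI[OF cg])
  have "((\<lambda>t. w (x + t *\<^sub>R y)) has_vector_derivative (?g t \<bullet> y)) (at t within {0..1})" for t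
  proof -
    have "((\<lambda>t. x + t *\<^sub>R y) has_derivative (\<lambda>h. h *\<^sub>R y)) (at t within {0..1})"
      by (auto intro!: derivative_eq_intros)
    from has_derivative_compose[OF this smooth_has_derivative[OF w]]
    show ?thesis
      by (simp add: has_vector_derivative_def mult.commute)
  qed
  then have "(\<integral>t. indicator {0..1} t *\<^sub>R (?g t \<bullet> y) \<partial>lborel) = w (x + 1 *\<^sub>R y) - w (x + 0 *\<^sub>R y)"
    by (intro integral_FTC_Icc) (auto intro!: continuous_intros continuous_on_subset[OF cg])
  then have eq: "w (x + y) - w x = (\<integral>t. indicator {0..1} t * (?g t \<bullet> y) \<partial>lborel)"
    by simp
  have int: "integrable lborel (\<lambda>t. indicator {0..1} t *\<^sub>R f t)" if "continuous_on UNIV f" for f :: "real \<Rightarrow> real"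
    using that by (intro borel_integrable_compact) (auto intro: continuous_on_subset)
  have i1: "integrable lborel (\<lambda>t. indicator {0..1} t * (?g t \<bullet> y))"
    using int[OF continuous_on_inner[OF cg continuous_on_const]] by simp
  have i2: "integrable lborel (\<lambda>t. indicator {0..1} t * norm (?g t) powr p)"
  proof -
    have "continuous_on UNIV (\<lambda>t. norm (?g t) powr p)"
      using p by (intro continuous_on_powr' continuous_on_norm cg continuous_on_const) auto
    from int[OF this] show ?thesis by simp
  qed
  have i0: "integrable lborel (indicator {0..1::real} :: real \<Rightarrow> real)"
    by (rule integrable_real_indicator) auto
  have J: "integrable lborel (\<lambda>t. indicator {0..1} t * norm (?g t))"
    "(\<integral>t. indicator {0..1} t * norm (?g t) \<partial>lborel) powr p \<le>
      (\<integral>t. indicator {0..1::real} t \<partial>lborel) powr (p - 1) * (\<integral>t. indicator {0..1} t * norm (?g t) powr p \<partial>lborel)"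
    by (rule Jensen_weighted; use i2 i0 p in simp)+
  have "\<bar>w (x + y) - w x\<bar> \<le> (\<integral>t. \<bar>indicator {0..1} t * (?g t \<bullet> y)\<bar> \<partial>lborel)"
    unfolding eq by (rule integral_abs_bound)
  also have "\<dots> \<le> (\<integral>t. norm y * (indicator {0..1} t * norm (?g t)) \<partial>lborel)"
  proof (rule integral_mono)
    show "\<bar>indicator {0..1} t * (?g t \<bullet> y)\<bar> \<le> norm y * (indicator {0..1} t * norm (?g t))" for t :: real
      using Cauchy_Schwarz_ineq2[of "?g t" y] by (simp add: indicator_def mult.commute)
  qed (use i1 J in auto)
  finally have "\<bar>w (x + y) - w x\<bar> powr p \<le> (norm y * (\<integral>t. indicator {0..1} t * norm (?g t) \<partial>lborel)) powr p"
    using p by (intro powr_mono2) auto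
  also have "\<dots> \<le> norm y powr p * (\<integral>t. indicator {0..1} t * norm (?g t) powr p \<partial>lborel)"
    using J(2) by (subst powr_mult) (auto intro!: mult_left_mono)
  finally have "ennreal (\<bar>w (x + y) - w x\<bar> powr p) \<le> ennreal (\<integral>t. norm y powr p * (indicator {0..1} t * norm (?g t) powr p) \<partial>lborel)"
    by (simp add: ennreal_leI)
  also have "\<dots> = (\<integral>\<^sup>+t. ennreal (norm y powr p * (indicator {0..1} t * norm (?g t) powr p)) \<partial>lborel)"
    using i2 by (intro nn_integral_eq_integral[symmetric]) auto
  finally show ?thesis .
qed

text \<open>After exchanging the integrals, translation invariance makes the inner integral
  independent of the position \<open>t\<close> on the segment.\<close>

lemma nn_integral_increment_bound:
  fixes w :: "real^'n \<Rightarrow> real"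
  assumes w: "smooth w" and p: "p \<ge> 1"
  shows "(\<integral>\<^sup>+x. ennreal (\<bar>w (x + y) - w x\<bar> powr p) \<partial>lborel) \<le>
    ennreal (norm y powr p) * (\<integral>\<^sup>+x. ennreal (norm (gradient w x) powr p) \<partial>lborel)"
proof -
  have [measurable]: "gradient w \<in> borel_measurable borel"
    by (rule borel_measurable_continuous_onI[OF smooth_continuous_gradient[OF w]])
  have "(\<integral>\<^sup>+x. ennreal (\<bar>w (x + y) - w x\<bar> powr p) \<partial>lborel) \<le>
      (\<integral>\<^sup>+x. (\<integral>\<^sup>+t. ennreal (norm y powr p * (indicator {0..1} t * norm (gradient w (x + t *\<^sub>R y)) powr p)) \<partial>lborel) \<partial>lborel)"
    by (intro nn_integral_mono smooth_increment_bound[OF w p])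
  also have "\<dots> = (\<integral>\<^sup>+t. (\<integral>\<^sup>+x. ennreal (norm y powr p * (indicator {0..1} t * norm (gradient w (x + t *\<^sub>R y)) powr p)) \<partial>lborel) \<partial>lborel)"
    by (rule lborel_pair.Fubini') measurable
  also have "\<dots> = (\<integral>\<^sup>+t. ennreal (norm y powr p * indicator {0..1} t) * (\<integral>\<^sup>+x. ennreal (norm (gradient w (x + t *\<^sub>R y)) powr p) \<partial>lborel) \<partial>lborel)"
    by (intro nn_integral_cong) (simp add: mult.assoc[symmetric] ennreal_mult' nn_integral_cmult)
  also have "\<dots> = (\<integral>\<^sup>+t. ennreal (norm y powr p * indicator {0..1} (t::real)) * (\<integral>\<^sup>+x. ennreal (norm (gradient w x) powr p) \<partial>lborel) \<partial>lborel)"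
    by (intro nn_integral_cong arg_cong2[where f = "(*)"] refl nn_integral_lborel_translation[where f = "\<lambda>x. ennreal (norm (gradient w x) powr p)"]) measurable
  also have "\<dots> = (\<integral>\<^sup>+t. ennreal (norm y powr p) * indicator {0..1} (t::real) \<partial>lborel) * (\<integral>\<^sup>+x. ennreal (norm (gradient w x) powr p) \<partial>lborel)"
    by (subst nn_integral_multc) (auto simp: ennreal_mult' ennreal_indicator)
  also have "(\<integral>\<^sup>+t. ennreal (norm y powr p) * indicator {0..1} (t::real) \<partial>lborel) = ennreal (norm y powr p)"
    by (subst nn_integral_cmult_indicator) auto
  finally show ?thesis .
qed

text \<open>
  The function \<open>G\<close> in the proof is a dyadic version of the density of the fractional Sobolev energy of order
  \<open>n\<sigma>/p < 1\<close>. For every \<open>j\<close>, comparing \<open>w x\<close> with the mean of \<open>w\<close> over a ball of radius \<open>2\<^sup>-\<^sup>j\<close> bounds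
  \<open>|w x|\<^sup>p\<close> by \<open>G x\<close> and the \<open>L\<^sup>r\<close> norm; choosing \<open>j\<close> depending on \<open>x\<close> gives
  \<open>|w x|\<^sup>r \<le> C \<parallel>w\<parallel>\<^sub>r\<^sup>r\<^sup>-\<^sup>p G x\<close>, and it remains to integrate.
\<close>

lemma subcritical_sobolev:
  fixes p r :: real
  assumes p: "1 \<le> p" and pr: "p < r" and sub: "real CARD('n) * (1 - p / r) < p"
  obtains C where "C > 0" "\<And>(w :: real^'n \<Rightarrow> real) x0. smooth w \<Longrightarrow> (\<And>x. x \<notin> cball x0 (1/2) \<Longrightarrow> w x = 0) \<Longrightarrow>
    (\<integral>x. \<bar>w x\<bar> powr r \<partial>lborel) \<le> C * (\<integral>x. norm (gradient w x) powr p \<partial>lborel) powr (r / p)"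
proof -
  define n where "n = CARD('n)"
  \<comment> \<open>The ratio of the volumes of consecutive dyadic balls \<open>B j\<close> and
    \<open>B (Suc j)\<close>.\<close>
  define b where "b = (2::real) ^ n"
  have n: "n > 0" by (simp add: n_def)
  have b: "b \<ge> 2" unfolding b_def using power_increasing[of 1 n "2::real"] n by simp
  define V where "V = unit_ball_vol (real n)"
  have V: "V > 0" unfolding V_def by (rule unit_ball_vol_pos) simp
  define \<sigma> where "\<sigma> = 1 - p / r"
  have \<sigma>: "\<sigma> > 0" "\<sigma> < 1" using p pr by (auto simp: \<sigma>_def)
  have rp: "r / p > 1" using p pr by auto
  \<comment> \<open>The ratio of the geometric series that bounds the integral of \<open>G\<close>.
    It is below 1 exactly because \<open>n \<sigma> < p\<close>; this is where subcriticality
    enters.\<close>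
  define \<theta> where "\<theta> = 2 powr (real n * \<sigma> - p)"
  have \<theta>: "0 < \<theta>" "\<theta> < 1"
    using sub unfolding \<theta>_def \<sigma>_def n_def by (auto simp: powr_less_one)
  define B where "B j = ball (0::real^'n) (1 / 2 ^ j)" for j :: nat
  have volB: "measure lborel (B j) = V / b ^ j" for j
    unfolding B_def b_def V_def n_def
    by (subst content_ball) (auto simp: power_divide power_mult[symmetric] mult.commute)
  have finB: "emeasure lborel (B j) < \<infinity>" for j
    unfolding B_def by (rule emeasure_lborel_ball_finite)
  have [measurable]: "B j \<in> sets borel" for j by (simp add: B_def)
  define K where "K = 2 powr p * (1 + V powr (- (p / r)))"
  have K: "K > 0" unfolding K_def by (intro mult_pos_pos add_pos_nonneg) auto
  define C0 where "C0 = 2 powr (r / p) + (K * (b powr \<sigma> + 1)) powr (r / p)"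
  have C0: "C0 > 0" unfolding C0_def by (intro add_pos_nonneg) auto
  define C where "C = (C0 / (1 - \<theta>)) powr (r / p)"
  have C: "C > 0" using C0 \<theta> by (simp add: C_def)
  show ?thesis
  proof (rule that[OF C])
    fix w :: "real^'n \<Rightarrow> real" and x0
    assume w: "smooth w" and w0: "\<And>x. x \<notin> cball x0 (1/2) \<Longrightarrow> w x = 0"
    have cw: "continuous_on UNIV w" by (rule smooth_continuous_on[OF w])
    have [measurable]: "w \<in> borel_measurable borel"
      by (rule borel_measurable_continuous_onI[OF cw])
    have cg: "continuous_on UNIV (gradient w)" by (rule smooth_continuous_gradient[OF w])
    have g0: "gradient w x = 0" if "x \<notin> cball x0 (1/2)" for x
      by (rule gradient_eq_0_outside[OF closed_cball that w0])
    have wi: "integrable lborel (\<lambda>x. \<bar>w x\<bar> powr s)" if "s > 0" for s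
      using that by (intro continuous_compact_support_integrable[OF _ compact_cball[of x0 "1/2"]] continuous_on_powr' continuous_on_rabs cw continuous_on_const)
        (auto simp: w0)
    have gi: "integrable lborel (\<lambda>x. norm (gradient w x) powr p)"
      using p by (intro continuous_compact_support_integrable[OF _ compact_cball[of x0 "1/2"]] continuous_on_powr' continuous_on_norm cg continuous_on_const)
        (auto simp: g0)
    define Q where "Q = (\<integral>x. \<bar>w x\<bar> powr r \<partial>lborel)"
    define I where "I = (\<integral>x. norm (gradient w x) powr p \<partial>lborel)"
    have Q0: "Q \<ge> 0" and I0: "I \<ge> 0" by (auto simp: Q_def I_def)
    show "(\<integral>x. \<bar>w x\<bar> powr r \<partial>lborel) \<le> C * (\<integral>x. norm (gradient w x) powr p \<partial>lborel) powr (r / p)"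
      unfolding Q_def[symmetric] I_def[symmetric]
    proof (cases "Q = 0")
      case True
      then show "Q \<le> C * I powr (r / p)" using C by simp
    next
      case False
      \<comment> \<open>This is \<open>\<parallel>w\<parallel>^p\<close> for the norm of
        \<open>L^r\<close>, which has the same homogeneity as \<open>\<bar>w x\<bar> powr p\<close>
        and as \<open>G\<close>.\<close>
      define P where "P = Q powr (p / r)"
      have P: "P > 0" using False Q0 by (simp add: P_def)
      have PQ: "Q = P powr (r / p - 1) * P"
      proof -
        have "P powr (r / p - 1) * P = P powr (r / p)"
          using P powr_add[of P "r / p - 1" 1] by simp
        also have "\<dots> = Q" using Q0 p pr by (simp add: P_def powr_powr)
        finally show ?thesis by simp
      qed
      define a where "a j x = (\<integral>\<^sup>+y. indicator (B j) y * ennreal (\<bar>w (x + y) - w x\<bar> powr p) \<partial>lborel)" for j x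
      have [measurable]: "a j \<in> borel_measurable borel" for j
        unfolding a_def[abs_def] by measurable
      have a_int: "(\<integral>\<^sup>+x. a j x \<partial>lborel) \<le> ennreal ((1 / 2 ^ j) powr p * I * (V / b ^ j))" for j
      proof -
        have "(\<integral>\<^sup>+x. a j x \<partial>lborel) = (\<integral>\<^sup>+y. (\<integral>\<^sup>+x. indicator (B j) y * ennreal (\<bar>w (x + y) - w x\<bar> powr p) \<partial>lborel) \<partial>lborel)"
          unfolding a_def by (rule lborel_pair.Fubini') measurable
        also have "\<dots> \<le> (\<integral>\<^sup>+y. ennreal ((1 / 2 ^ j) powr p * I) * indicator (B j) y \<partial>lborel)"
        proof (rule nn_integral_mono)
          fix y
          show "(\<integral>\<^sup>+x. indicator (B j) y * ennreal (\<bar>w (x + y) - w x\<bar> powr p) \<partial>lborel) \<le> ennreal ((1 / 2 ^ j) powr p * I) * indicator (B j) y"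
          proof (cases "y \<in> B j")
            case True
            have "(\<integral>\<^sup>+x. ennreal (\<bar>w (x + y) - w x\<bar> powr p) \<partial>lborel) \<le> ennreal (norm y powr p) * (\<integral>\<^sup>+x. ennreal (norm (gradient w x) powr p) \<partial>lborel)"
              by (rule nn_integral_increment_bound[OF w p])
            also have "\<dots> = ennreal (norm y powr p * I)"
              using gi by (simp add: nn_integral_eq_integral I_def ennreal_mult')
            also have "\<dots> \<le> ennreal ((1 / 2 ^ j) powr p * I)"
              using True p I0 by (intro ennreal_leI mult_right_mono powr_mono2) (auto simp: B_def)
            finally show ?thesis using True by simp
          qed simp
        qed
        also have "\<dots> = ennreal ((1 / 2 ^ j) powr p * I * measure lborel (B j))"
          using finB[of j] I0
          by (subst nn_integral_cmult_indicator)
             (simp_all add: emeasure_eq_ennreal_measure ennreal_mult[symmetric] less_top[symmetric])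
        finally show ?thesis by (simp only: volB)
      qed
      \<comment> \<open>The factor \<open>b ^ j / V\<close> turns \<open>a j x\<close> into a mean
        over \<open>B j\<close>; the weight \<open>(b ^ j) powr \<sigma>\<close> is the largest
        growth needed by \<open>dyadic_interpolation\<close>, and it is beaten by the factor
        \<open>2 powr (- p * j)\<close> from \<open>a_int\<close>.\<close>
      define G where "G x = (\<Sum>j. ennreal ((b ^ j) powr \<sigma> * (b ^ j / V)) * a j x)" for x
      have [measurable]: "G \<in> borel_measurable borel"
        unfolding G_def[abs_def] by measurable
      have G_int: "(\<integral>\<^sup>+x. G x \<partial>lborel) \<le> ennreal (I / (1 - \<theta>))"
      proof -
        have "(\<integral>\<^sup>+x. G x \<partial>lborel) = (\<Sum>j. \<integral>\<^sup>+x. ennreal ((b ^ j) powr \<sigma> * (b ^ j / V)) * a j x \<partial>lborel)"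
          unfolding G_def by (rule nn_integral_suminf) measurable
        also have "\<dots> \<le> (\<Sum>j. ennreal (\<theta> ^ j * I))"
        proof (intro suminf_le summableI)
          fix j
          have "(\<integral>\<^sup>+x. ennreal ((b ^ j) powr \<sigma> * (b ^ j / V)) * a j x \<partial>lborel) = ennreal ((b ^ j) powr \<sigma> * (b ^ j / V)) * (\<integral>\<^sup>+x. a j x \<partial>lborel)"
            by (rule nn_integral_cmult) measurable
          also have "\<dots> \<le> ennreal ((b ^ j) powr \<sigma> * (b ^ j / V)) * ennreal ((1 / 2 ^ j) powr p * I * (V / b ^ j))"
            by (intro mult_left_mono a_int) auto
          also have "\<dots> = ennreal (((b ^ j) powr \<sigma> * (b ^ j / V)) * ((1 / 2 ^ j) powr p * I * (V / b ^ j)))"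
            by (rule ennreal_mult[symmetric]) (use b V I0 in auto)
          also have "((b ^ j) powr \<sigma> * (b ^ j / V)) * ((1 / 2 ^ j) powr p * I * (V / b ^ j)) = (b ^ j) powr \<sigma> * (1 / 2 ^ j) powr p * I"
            using b V by simp
          also have "(b ^ j) powr \<sigma> * (1 / 2 ^ j) powr p = \<theta> ^ j"
          proof -
            have "(b ^ j) powr \<sigma> = 2 powr (real n * real j * \<sigma>)"
              by (simp add: b_def power_mult[symmetric] powr_realpow[symmetric] powr_powr)
            moreover have "(1 / 2 ^ j :: real) powr p = 2 powr (- real j * p)"
              by (simp add: powr_divide powr_realpow[symmetric] powr_powr powr_minus_divide)
            moreover have "\<theta> ^ j = 2 powr ((real n * \<sigma> - p) * real j)"
              using \<theta>(1) by (simp add: \<theta>_def powr_realpow[symmetric] powr_powr)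
            ultimately show ?thesis
              by (simp add: powr_add[symmetric] algebra_simps)
          qed
          finally show "(\<integral>\<^sup>+x. ennreal ((b ^ j) powr \<sigma> * (b ^ j / V)) * a j x \<partial>lborel) \<le> ennreal (\<theta> ^ j * I)" .
        qed
        also have "\<dots> = ennreal (\<Sum>j. \<theta> ^ j * I)"
          using \<theta> I0 by (intro suminf_ennreal2) (auto intro!: summable_mult2 summable_geometric)
        also have "(\<Sum>j. \<theta> ^ j * I) = I / (1 - \<theta>)"
          using \<theta> by (simp add: suminf_mult2[symmetric] summable_geometric suminf_geometric)
        finally show ?thesis .
      qed
      have pw: "ennreal (\<bar>w x\<bar> powr r) \<le> ennreal (C0 * P powr (r / p - 1)) * G x" for x
      proof (cases "G x = \<infinity>")
        case True
        \<comment> \<open>In \<open>ennreal\<close> the product of 0 and infinity is 0, so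
          positivity of the factor has to be checked.\<close>
        have "C0 * P powr (r / p - 1) > 0" using C0 P by simp
        then have "ennreal (C0 * P powr (r / p - 1)) \<noteq> 0"
          by (simp only: ennreal_eq_0_iff not_le)
        then have "ennreal (C0 * P powr (r / p - 1)) * G x = top"
          using True unfolding ennreal_mult_eq_top_iff infinity_ennreal_def by blast
        then show ?thesis by (simp only: top_greatest)
      next
        case False
        define \<Gamma> where "\<Gamma> = enn2real (G x)"
        have G\<Gamma>: "G x = ennreal \<Gamma>" using False by (simp add: \<Gamma>_def less_top)
        have \<Gamma>0: "\<Gamma> \<ge> 0" by (simp add: \<Gamma>_def)
        define W where "W = \<bar>w x\<bar> powr p"
        define d where "d y = \<bar>w (x + y) - w x\<bar> powr p" for y
        have cd: "continuous_on UNIV d"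
          unfolding d_def[abs_def] using p
          by (intro continuous_on_powr' continuous_on_rabs continuous_on_diff continuous_on_compose2[OF cw] continuous_intros) auto
        have intB: "integrable lborel (\<lambda>y. indicator (B j) y * f y)" if "continuous_on UNIV f" for f :: "real^'n \<Rightarrow> real" and j
        proof -
          have [measurable]: "f \<in> borel_measurable borel" by (rule borel_measurable_continuous_onI[OF that])
          have "integrable lborel (\<lambda>y. indicator (cball 0 (1 / 2 ^ j)) y *\<^sub>R f y)"
            using that by (intro borel_integrable_compact) (auto intro: continuous_on_subset)
          then show ?thesis
            by (rule Bochner_Integration.integrable_bound) (auto simp: B_def indicator_def)
        qed
        define A where "A j = (\<integral>y. indicator (B j) y * d y \<partial>lborel)" for j
        have aA: "a j x = ennreal (A j)" for j
        proof -
          have "a j x = (\<integral>\<^sup>+y. ennreal (indicator (B j) y * d y) \<partial>lborel)"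
            unfolding a_def d_def by (intro nn_integral_cong) (simp add: ennreal_mult' ennreal_indicator)
          also have "\<dots> = ennreal (A j)"
            unfolding A_def by (rule nn_integral_eq_integral[OF intB[OF cd]]) (auto simp: d_def)
          finally show ?thesis .
        qed
        have A0: "A j \<ge> 0" for j unfolding A_def by (auto simp: d_def)
        have A\<Gamma>: "A j * (b ^ j / V) \<le> (b ^ j) powr (- \<sigma>) * \<Gamma>" for j
        proof -
          define T where "T j = ennreal ((b ^ j) powr \<sigma> * (b ^ j / V)) * a j x" for j
          have "T j \<le> suminf T"
            using sum_le_suminf[OF summableI, of "{j}" T] by simp
          also have "suminf T = ennreal \<Gamma>"
            unfolding T_def[abs_def] G_def[symmetric] by (rule G\<Gamma>)
          also have "T j = ennreal ((b ^ j) powr \<sigma> * (b ^ j / V) * A j)"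
            unfolding T_def aA by (rule ennreal_mult[symmetric]) (use A0 b V in auto)
          finally have "ennreal ((b ^ j) powr \<sigma> * (b ^ j / V) * A j) \<le> ennreal \<Gamma>" .
          then have "(b ^ j) powr \<sigma> * (b ^ j / V) * A j \<le> \<Gamma>"
            using \<Gamma>0 by (simp add: ennreal_le_iff)
          then have "(b ^ j) powr (- \<sigma>) * ((b ^ j) powr \<sigma> * (b ^ j / V) * A j) \<le> (b ^ j) powr (- \<sigma>) * \<Gamma>"
            by (intro mult_left_mono) auto
          moreover have "(b ^ j) powr (- \<sigma>) * (b ^ j) powr \<sigma> = 1"
            using b by (subst powr_add[symmetric]) simp
          ultimately show ?thesis
            by (simp add: mult.assoc[symmetric]) (simp add: mult.commute)
        qed
        have WB: "(\<integral>y. indicator (B j) y * W \<partial>lborel) = W * (V / b ^ j)" for j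
          using finB[of j] by (simp add: volB)
        \<comment> \<open>The support has radius 1/2, so it covers at most half the volume of the
          unit ball around \<open>x\<close>. On the rest \<open>w (x + y) = 0\<close>, and the
          increment equals \<open>w x\<close> in absolute value. This is the reason for the radius
          1/2 in the statement.\<close>
        have W1: "W \<le> 2 * \<Gamma>"
        proof -
          let ?C = "cball (x0 - x) (1/2)"
          have vC: "measure lborel ?C = V / b"
            unfolding b_def V_def n_def by (subst content_cball) (auto simp: power_divide)
          have iC: "integrable lborel (\<lambda>y. indicator ?C y * W)"
            by (intro integrable_mult_left integrable_real_indicator emeasure_lborel_cball_finite) auto
          have "indicator (B 0) y * W \<le> indicator (B 0) y * d y + indicator ?C y * W" for y
          proof (cases "y \<in> ?C")
            case True
            then show ?thesis by (auto simp: indicator_def d_def W_def)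
          next
            case False
            then have "x + y \<notin> cball x0 (1/2)"
              by (auto simp: dist_norm algebra_simps)
            then show ?thesis using False by (simp add: d_def W_def w0)
          qed
          then have "(\<integral>y. indicator (B 0) y * W \<partial>lborel) \<le> (\<integral>y. indicator (B 0) y * d y + indicator ?C y * W \<partial>lborel)"
            by (intro integral_mono Bochner_Integration.integrable_add intB cd continuous_on_const iC)
          also have "\<dots> = A 0 + W * (V / b)"
            using intB[OF cd, of 0] iC emeasure_lborel_cball_finite[of "x0 - x" "1/2"] by (simp add: A_def vC)
          finally have "W * V \<le> A 0 + W * (V / b)"
            by (simp only: WB power_0 div_by_1)
          also have "W * (V / b) \<le> W * (V / 2)"
            using b V by (intro mult_left_mono divide_left_mono) (auto simp: W_def)
          finally have "W * V \<le> 2 * A 0" by simp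
          then have "W \<le> 2 * (A 0 * (1 / V))"
            using V by (simp add: field_simps)
          also have "A 0 * (1 / V) \<le> \<Gamma>"
            using A\<Gamma>[of 0] by simp
          finally show ?thesis by simp
        qed
        \<comment> \<open>Averaging
          \<open>|w x|^p \<le> 2^p (|w (x + y) - w x|^p + |w (x + y)|^p)\<close> over
          \<open>B j\<close>. Jensen's inequality bounds the mean of the last term by
          \<open>v^(- p / r) P\<close>, where \<open>v\<close> is the volume of
          \<open>B j\<close>.\<close>
        have Wj: "W \<le> K * ((b ^ j) powr (- \<sigma>) * \<Gamma> + (b ^ j) powr (p / r) * P)" for j
        proof -
          define v where "v = V / b ^ j"
          have v: "v > 0" using V b by (simp add: v_def)
          define h where "h y = \<bar>w (x + y)\<bar> powr p" for y
          have ch: "continuous_on UNIV h"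
            unfolding h_def[abs_def] using p
            by (intro continuous_on_powr' continuous_on_rabs continuous_on_compose2[OF cw] continuous_intros) auto
          have hr: "h y powr (r / p) = \<bar>w (y + x)\<bar> powr r" for y
            using p by (simp add: h_def powr_powr add.commute)
          have ch2: "continuous_on UNIV (\<lambda>y. h y powr (r / p))"
            using p pr by (intro continuous_on_powr' ch continuous_on_const) (auto simp: h_def)
          have hm: "h \<in> borel_measurable lborel"
            using borel_measurable_continuous_onI[OF ch] by simp
          have "(\<integral>y. indicator (B j) y * h y \<partial>lborel) powr (r / p) \<le>
              (\<integral>y. indicator (B j) y \<partial>lborel) powr (r / p - 1) * (\<integral>y. indicator (B j) y * h y powr (r / p) \<partial>lborel)"
            using finB[of j] rp
            by (intro Jensen_weighted(2) intB ch2 hm integrable_real_indicator) (auto simp: h_def)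
          also have "(\<integral>y. indicator (B j) y \<partial>lborel) = v"
            by (simp add: volB v_def)
          also have "(\<integral>y. indicator (B j) y * h y powr (r / p) \<partial>lborel) \<le> (\<integral>y. h y powr (r / p) \<partial>lborel)"
            using integrable_lborel_translation[OF wi[of r], of x] p pr
            by (intro integral_mono intB ch2) (auto simp: hr indicator_def)
          also have "(\<integral>y. h y powr (r / p) \<partial>lborel) = Q"
            unfolding hr Q_def by (rule integral_lborel_translation[where f = "\<lambda>x. \<bar>w x\<bar> powr r"]) measurable
          finally have "(\<integral>y. indicator (B j) y * h y \<partial>lborel) powr (r / p) \<le> v powr (r / p - 1) * Q"
            by (simp add: mult_left_mono)
          then have "((\<integral>y. indicator (B j) y * h y \<partial>lborel) powr (r / p)) powr (p / r) \<le> (v powr (r / p - 1) * Q) powr (p / r)"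
            using p pr by (intro powr_mono2) auto
          also have "((\<integral>y. indicator (B j) y * h y \<partial>lborel) powr (r / p)) powr (p / r) = (\<integral>y. indicator (B j) y * h y \<partial>lborel)"
            using p pr by (simp add: powr_powr h_def)
          also have "(v powr (r / p - 1) * Q) powr (p / r) = v powr (1 - p / r) * P"
          proof -
            have "(r / p - 1) * (p / r) = 1 - p / r" using p pr by (simp add: field_simps)
            then show ?thesis using Q0 v by (simp add: powr_mult powr_powr P_def)
          qed
          finally have hB: "(\<integral>y. indicator (B j) y * h y \<partial>lborel) \<le> v powr (1 - p / r) * P" .
          have "W \<le> 2 powr p * (d y + h y)" for y
          proof -
            have "W \<le> (\<bar>w (x + y) - w x\<bar> + \<bar>w (x + y)\<bar>) powr p"
              unfolding W_def using p by (intro powr_mono2) auto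
            also have "\<dots> \<le> 2 powr p * (d y + h y)"
              unfolding d_def h_def using p by (intro powr_add_le) auto
            finally show ?thesis .
          qed
          then have "(\<integral>y. indicator (B j) y * W \<partial>lborel) \<le> (\<integral>y. 2 powr p * (indicator (B j) y * d y + indicator (B j) y * h y) \<partial>lborel)"
            by (intro integral_mono intB Bochner_Integration.integrable_add integrable_mult_right cd ch continuous_on_const)
               (auto simp: indicator_def)
          also have "\<dots> = 2 powr p * (A j + (\<integral>y. indicator (B j) y * h y \<partial>lborel))"
            using intB[OF cd, of j] intB[OF ch, of j] by (simp add: A_def)
          also have "\<dots> \<le> 2 powr p * (A j + v powr (1 - p / r) * P)"
            by (intro mult_left_mono add_left_mono hB) auto
          finally have "W * v \<le> 2 powr p * (A j + v powr (1 - p / r) * P)"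
            by (simp only: WB v_def)
          then have "W \<le> 2 powr p * (A j + v powr (1 - p / r) * P) / v"
            using v by (simp add: field_simps)
          also have "\<dots> = 2 powr p * (A j * (b ^ j / V) + v powr (- (p / r)) * P)"
          proof -
            have "v powr (1 - p / r) = v * v powr (- (p / r))"
              using v powr_add[of v 1 "- (p / r)"] by simp
            note 1 = this
            have 2: "b ^ j / V = 1 / v"
              by (simp add: v_def)
            show ?thesis
              unfolding 1 2 using v by (simp add: field_simps)
          qed
          also have "v powr (- (p / r)) = V powr (- (p / r)) * (b ^ j) powr (p / r)"
            using V b by (simp add: v_def powr_divide powr_minus divide_simps)
          also have "2 powr p * (A j * (b ^ j / V) + V powr (- (p / r)) * (b ^ j) powr (p / r) * P)
              \<le> 2 powr p * ((1 + V powr (- (p / r))) * ((b ^ j) powr (- \<sigma>) * \<Gamma>) + (1 + V powr (- (p / r))) * ((b ^ j) powr (p / r) * P))"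
          proof (intro mult_left_mono add_mono)
            have "A j * (b ^ j / V) \<le> 1 * ((b ^ j) powr (- \<sigma>) * \<Gamma>)" using A\<Gamma>[of j] by simp
            also have "\<dots> \<le> (1 + V powr (- (p / r))) * ((b ^ j) powr (- \<sigma>) * \<Gamma>)"
              using \<Gamma>0 by (intro mult_right_mono) auto
            finally show "A j * (b ^ j / V) \<le> (1 + V powr (- (p / r))) * ((b ^ j) powr (- \<sigma>) * \<Gamma>)" .
            show "V powr (- (p / r)) * (b ^ j) powr (p / r) * P \<le> (1 + V powr (- (p / r))) * ((b ^ j) powr (p / r) * P)"
              using P by (simp add: mult.assoc mult_right_mono)
          qed auto
          finally show ?thesis
            by (simp add: K_def algebra_simps)
        qed
        have "W powr (r / p) \<le> C0 * P powr (r / p - 1) * \<Gamma>"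
          unfolding C0_def
          by (rule dyadic_interpolation[OF P \<Gamma>0 _ _ pr \<sigma>_def _ _ W1 Wj]) (use p b K in \<open>auto simp: W_def\<close>)
        moreover have "W powr (r / p) = \<bar>w x\<bar> powr r"
          using p by (simp add: W_def powr_powr)
        ultimately show ?thesis
          using \<Gamma>0 C0 by (simp add: G\<Gamma> ennreal_leI flip: ennreal_mult')
      qed
      have "ennreal Q = (\<integral>\<^sup>+x. ennreal (\<bar>w x\<bar> powr r) \<partial>lborel)"
        using wi[of r] p pr by (simp add: Q_def nn_integral_eq_integral)
      also have "\<dots> \<le> (\<integral>\<^sup>+x. ennreal (C0 * P powr (r / p - 1)) * G x \<partial>lborel)"
        by (intro nn_integral_mono pw)
      also have "\<dots> = ennreal (C0 * P powr (r / p - 1)) * (\<integral>\<^sup>+x. G x \<partial>lborel)"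
        by (rule nn_integral_cmult) measurable
      also have "\<dots> \<le> ennreal (C0 * P powr (r / p - 1)) * ennreal (I / (1 - \<theta>))"
        by (intro mult_left_mono G_int) auto
      also have "\<dots> = ennreal (C0 * P powr (r / p - 1) * (I / (1 - \<theta>)))"
        by (rule ennreal_mult[symmetric]) (use C0 I0 \<theta> in auto)
      finally have "Q \<le> C0 * P powr (r / p - 1) * (I / (1 - \<theta>))"
        using C0 I0 \<theta> by (subst (asm) ennreal_le_iff) auto
      \<comment> \<open>The left-hand side is \<open>Q\<close> itself, which is finite and nonzero,
        so the common factor cancels and leaves a bound for \<open>P\<close> by the gradient
        integral alone.\<close>
      then have "P powr (r / p - 1) * P \<le> P powr (r / p - 1) * (C0 / (1 - \<theta>) * I)"
        unfolding PQ[symmetric] by (simp add: mult_ac)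
      then have "P \<le> C0 / (1 - \<theta>) * I"
        using P by (subst (asm) mult_le_cancel_left_pos) auto
      then have "P powr (r / p) \<le> (C0 / (1 - \<theta>) * I) powr (r / p)"
        using P rp by (intro powr_mono2) auto
      also have "\<dots> = C * I powr (r / p)"
        unfolding C_def by (rule powr_mult)
      also have "P powr (r / p) = Q"
        using Q0 p pr by (simp add: P_def powr_powr)
      finally show "Q \<le> C * I powr (r / p)" .
    qed
  qed
qed

subsection \<open>Smooth truncations\<close>

text \<open>
  A smooth substitute for \<open>(t - k)\<^sub>+\<close>. Since its derivative takes values in \<open>[0,1]\<close> and it stays above a multiple
  of \<open>(t - k - \<delta>)\<^sub>+\<close>, the chain rule for nonsmooth truncations of Sobolev functions is not needed.
\<close>

definition ramp :: "real \<Rightarrow> real \<Rightarrow> real \<Rightarrow> real" where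
  "ramp k \<delta> t = (t - k) * flat 1 ((t - k) / \<delta>)"

definition ramp' :: "real \<Rightarrow> real \<Rightarrow> real \<Rightarrow> real" where
  "ramp' k \<delta> t = flat 1 ((t - k) / \<delta>) + (t - k) / \<delta> * flat' ((t - k) / \<delta>)"

lemma ramp_has_derivative:
  assumes "\<delta> > 0"
  shows "(ramp k \<delta> has_real_derivative ramp' k \<delta> t) (at t)"
proof -
  have "((\<lambda>t. (t - k) / \<delta>) has_real_derivative 1 / \<delta>) (at t)"
    using assms by (auto intro!: derivative_eq_intros)
  from DERIV_chain2[OF flat1_has_derivative this]
  have "((\<lambda>t. flat 1 ((t - k) / \<delta>)) has_real_derivative flat' ((t - k) / \<delta>) * (1 / \<delta>)) (at t)" .
  then have "((\<lambda>t. (t - k) * flat 1 ((t - k) / \<delta>)) has_real_derivative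
      (1 - 0) * flat 1 ((t - k) / \<delta>) + flat' ((t - k) / \<delta>) * (1 / \<delta>) * (t - k)) (at t)"
    by (intro DERIV_mult DERIV_diff DERIV_ident DERIV_const)
  then show ?thesis
    unfolding ramp_def[abs_def] ramp'_def by (simp add: mult.commute)
qed

lemma continuous_ramp: "\<delta> > 0 \<Longrightarrow> continuous_on UNIV (ramp k \<delta>)"
  using ramp_has_derivative by (meson DERIV_isCont continuous_at_imp_continuous_on)

lemma continuous_ramp': "\<delta> > 0 \<Longrightarrow> continuous_on UNIV (ramp' k \<delta>)"
  unfolding ramp'_def[abs_def]
  by (intro continuous_intros continuous_on_compose2[OF continuous_flat]) auto

text \<open>With \<open>z = \<delta> / (t - k)\<close> the derivative is
  \<open>(1 + z) exp (- z)\<close> for \<open>t > k\<close>, and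
  \<open>1 + z \<le> exp z\<close>.\<close>

lemma ramp'_bounds:
  assumes "\<delta> > 0"
  shows "0 \<le> ramp' k \<delta> t" "ramp' k \<delta> t \<le> 1" "t \<le> k \<Longrightarrow> ramp' k \<delta> t = 0"
proof -
  define y where "y = (t - k) / \<delta>"
  have r: "ramp' k \<delta> t = flat 1 y + y * flat' y" by (simp add: ramp'_def y_def)
  have "0 \<le> flat 1 y + y * flat' y \<and> flat 1 y + y * flat' y \<le> 1"
  proof (cases "y > 0")
    case True
    define z where "z = 1 / y"
    have "flat 1 y + y * flat' y = exp (- z) * (1 + z)"
      using True by (simp add: flat_def z_def algebra_simps)
    moreover have "1 + z \<le> exp z" by (rule exp_ge_add_one_self)
    then have "exp (- z) * (1 + z) \<le> exp (- z) * exp z" by (intro mult_left_mono) auto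
    moreover have "exp (- z) * exp z = 1" by (simp add: exp_minus)
    moreover have "0 \<le> exp (- z) * (1 + z)" using True by (simp add: z_def)
    ultimately show ?thesis by simp
  qed (simp add: flat_def)
  then show "0 \<le> ramp' k \<delta> t" "ramp' k \<delta> t \<le> 1" by (simp_all add: r)
  show "ramp' k \<delta> t = 0" if "t \<le> k"
  proof -
    have "y \<le> 0" using that assms by (simp add: y_def divide_nonpos_pos)
    then show ?thesis by (simp add: r flat_eq_0)
  qed
qed

text \<open>The lower bound starts at \<open>k + \<delta>\<close> because \<open>flat 1\<close>
  reaches \<open>exp (- 1)\<close> at argument 1. The lost strip of width \<open>\<delta>\<close> is
  paid for by the spacing of the levels in the iteration.\<close>

lemma ramp_bounds:
  assumes "\<delta> > 0"
  shows "0 \<le> ramp k \<delta> t" "ramp k \<delta> t \<le> max 0 (t - k)" "exp (- 1) * max 0 (t - k - \<delta>) \<le> ramp k \<delta> t"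
proof -
  show 1: "0 \<le> ramp k \<delta> t"
    using flat_nonneg flat_eq_0[of "(t - k) / \<delta>" 1] assms
    by (cases "t \<ge> k") (auto simp: ramp_def divide_nonpos_pos)
  show "ramp k \<delta> t \<le> max 0 (t - k)"
  proof (cases "t \<ge> k")
    case True
    then have "(t - k) * flat 1 ((t - k) / \<delta>) \<le> (t - k) * 1"
      by (intro mult_left_mono flat_le_1) auto
    then show ?thesis by (simp add: ramp_def)
  next
    case False
    then show ?thesis using assms by (simp add: ramp_def flat_eq_0 divide_nonpos_pos)
  qed
  show "exp (- 1) * max 0 (t - k - \<delta>) \<le> ramp k \<delta> t"
  proof (cases "t - k - \<delta> \<le> 0")
    case True
    then show ?thesis using 1 by simp
  next
    case False
    then have "exp (- 1) \<le> flat 1 ((t - k) / \<delta>)"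
      using assms by (intro flat_ge) (simp add: field_simps)
    then have "exp (- 1) * (t - k - \<delta>) \<le> flat 1 ((t - k) / \<delta>) * (t - k)"
      using False assms by (intro mult_mono flat_nonneg) auto
    then show ?thesis using False by (simp add: ramp_def mult.commute)
  qed
qed

lemma smooth_ramp: "smooth w \<Longrightarrow> smooth (\<lambda>x. ramp k \<delta> (w x))"
  using smooth_mult[OF smooth_diff_const[of w k] smooth_flat[OF smooth_mult[OF smooth_diff_const[of w k] smooth_const[of "1 / \<delta>"]]]]
  unfolding ramp_def by simp

lemma gradient_ramp:
  assumes "smooth w" "\<delta> > 0"
  shows "gradient (\<lambda>x. ramp k \<delta> (w x)) x = ramp' k \<delta> (w x) *\<^sub>R gradient w x"
proof (rule gradient_eqI)
  from has_derivative_compose[OF smooth_has_derivative[OF assms(1)] ramp_has_derivative[OF assms(2), unfolded has_field_derivative_def]]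
  show "((\<lambda>x. ramp k \<delta> (w x)) has_derivative (\<lambda>h. (ramp' k \<delta> (w x) *\<^sub>R gradient w x) \<bullet> h)) (at x)"
    by simp
qed

text \<open>Composition of the smooth approximants with the smooth ramp gives genuine test
  functions. What is kept of them are almost everywhere limits and an \<open>L^q\<close> majorant,
  which suffice to pass to the limit in the equation and in the Sobolev inequality.\<close>

lemma truncated_test_functions:
  fixes v :: "real^'n \<Rightarrow> real" and D :: "real^'n \<Rightarrow> real^'n"
  assumes [measurable]: "v \<in> borel_measurable borel" "D \<in> borel_measurable borel"
    and v: "integrable lborel (\<lambda>x. \<bar>v x\<bar> powr q)" and D: "integrable lborel (\<lambda>x. norm (D x) powr q)"
    and v0: "\<And>x. x \<notin> cball x0 R \<Longrightarrow> v x = 0" and D0: "\<And>x. x \<notin> cball x0 R \<Longrightarrow> D x = 0"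
    and weak: "\<And>\<phi> i. \<phi> \<in> test_functions (ball x0 R) \<Longrightarrow>
        (\<integral>x. v x * partial_deriv i \<phi> x \<partial>lborel) = - (\<integral>x. D x $ i * \<phi> x \<partial>lborel)"
    and q: "1 \<le> q" and st: "0 \<le> s" "s < t" "t < R" and \<delta>: "\<delta> > 0"
  obtains \<phi> H where "\<And>j. \<phi> j \<in> test_functions (ball x0 R)"
    "H \<in> borel_measurable borel" "integrable lborel (\<lambda>x. H x powr q)" "\<And>x. 0 \<le> H x"
    "\<And>j x. x \<notin> cball x0 t \<Longrightarrow> \<phi> j x = 0" "\<And>x. x \<notin> cball x0 t \<Longrightarrow> H x = 0"
    "AE x in lborel. (\<lambda>j. \<phi> j x) \<longlonglongrightarrow> cutoff x0 s t x * ramp k \<delta> (v x)"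
    "AE x in lborel. (\<lambda>j. gradient (\<phi> j) x) \<longlonglongrightarrow>
        ramp k \<delta> (v x) *\<^sub>R gradient (cutoff x0 s t) x + (cutoff x0 s t x * ramp' k \<delta> (v x)) *\<^sub>R D x"
    "\<And>j. AE x in lborel. norm (gradient (\<phi> j) x) \<le> H x"
proof -
  \<comment> \<open>The approximants are controlled only on \<open>ball x0 R'\<close>, which must
    contain the support \<open>cball x0 t\<close> of the cutoff and be smaller than
    \<open>ball x0 R\<close>.\<close>
  define R' where "R' = (t + R) / 2"
  have R': "t < R'" "R' < R" using st by (auto simp: R'_def)
  obtain w H where w: "\<And>j. smooth (w j)" and H: "H \<in> borel_measurable borel" "integrable lborel (\<lambda>x. H x powr q)"
    "\<And>x. 0 \<le> H x"
    and wl: "AE x in lborel. x \<in> ball x0 R' \<longrightarrow> (\<lambda>j. w j x) \<longlonglongrightarrow> v x"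
    and wgl: "AE x in lborel. x \<in> ball x0 R' \<longrightarrow> (\<lambda>j. gradient (w j) x) \<longlonglongrightarrow> D x"
    and wb: "AE x in lborel. x \<in> ball x0 R' \<longrightarrow> (\<forall>j. \<bar>w j x\<bar> \<le> H x)"
    and wgb: "AE x in lborel. x \<in> ball x0 R' \<longrightarrow> (\<forall>j. norm (gradient (w j) x) \<le> H x)"
    by (rule smooth_approximation[OF assms(1,2) v D v0 D0 weak q R'(2)]) (assumption | rule that)+
  note [measurable] = H(1)
  have [measurable]: "cball x0 t \<in> sets borel" by simp
  define \<eta> where "\<eta> = cutoff x0 s t"
  define c where "c = 4 / (t - s)"
  have c: "c \<ge> 0" using st by (simp add: c_def)
  have \<eta>: "0 \<le> \<eta> x" "\<eta> x \<le> 1" "smooth \<eta>" "norm (gradient \<eta> x) \<le> c" for x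
    using gradient_cutoff_bound[OF st(1,2)] by (simp_all add: \<eta>_def c_def cutoff_nonneg cutoff_le_1 smooth_cutoff)
  have \<eta>0: "\<eta> x = 0" if "x \<notin> cball x0 t" for x
    unfolding \<eta>_def by (rule cutoff_eq_0[OF st(1,2)]) (use that ball_subset_cball in blast)
  have \<eta>g0: "gradient \<eta> x = 0" if "x \<notin> cball x0 t" for x
    by (rule gradient_eq_0_outside[OF closed_cball that \<eta>0])
  have "cball x0 t \<subseteq> ball x0 R" using st by auto
  then have \<eta>t: "\<eta> \<in> test_functions (ball x0 R)"
    unfolding \<eta>_def by (rule cutoff_test_function[OF st(1,2)])
  define \<phi> where "\<phi> j x = \<eta> x * ramp k \<delta> (w j x)" for j x
  \<comment> \<open>In the product rule \<open>|ramp| \<le> |w j| + |k|\<close> meets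
    \<open>|gradient \<eta>| \<le> c\<close>, and \<open>\<eta> * ramp' \<le> 1\<close> meets the
    gradient of \<open>w j\<close>; together they give the factor \<open>c + 1\<close>.\<close>
  define H' where "H' x = (c + 1) * (indicator (cball x0 t) x * (H x + \<bar>k\<bar>))" for x
  have sub: "x \<in> ball x0 R'" if "x \<in> cball x0 t" for x using that R' by auto
  have \<phi>g: "gradient (\<phi> j) x = ramp k \<delta> (w j x) *\<^sub>R gradient \<eta> x + (\<eta> x * ramp' k \<delta> (w j x)) *\<^sub>R gradient (w j) x" for j x
    unfolding \<phi>_def
    by (subst gradient_mult) (simp_all add: smooth_differentiable \<eta> smooth_ramp w gradient_ramp \<delta>)
  have rb: "\<bar>ramp k \<delta> u\<bar> \<le> \<bar>u\<bar> + \<bar>k\<bar>" for u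
    using ramp_bounds[OF \<delta>, of k u] by (auto simp: abs_if)
  show ?thesis
  proof (rule that[of \<phi> H'])
    show "\<phi> j \<in> test_functions (ball x0 R)" for j
      unfolding \<phi>_def by (rule test_functions_mult[OF \<eta>t smooth_ramp[OF w]])
    show "H' \<in> borel_measurable borel" unfolding H'_def[abs_def] by measurable
    show "0 \<le> H' x" for x using c H(3)[of x] by (simp add: H'_def)
    show "\<phi> j x = 0" if "x \<notin> cball x0 t" for j x using \<eta>0[OF that] by (simp add: \<phi>_def)
    show "H' x = 0" if "x \<notin> cball x0 t" for x using that by (simp add: H'_def)
    show "integrable lborel (\<lambda>x. H' x powr q)"
    proof (rule Bochner_Integration.integrable_bound)
      show "integrable lborel (\<lambda>x. (c + 1) powr q * (2 powr q * (H x powr q + \<bar>k\<bar> powr q * indicator (cball x0 t) x)))"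
        using H(2) by (intro integrable_mult_right Bochner_Integration.integrable_add integrable_real_indicator emeasure_lborel_cball_finite) auto
      have "H' x powr q \<le> (c + 1) powr q * (2 powr q * (H x powr q + \<bar>k\<bar> powr q * indicator (cball x0 t) x))" for x
      proof (cases "x \<in> cball x0 t")
        case True
        have "H' x powr q = (c + 1) powr q * (H x + \<bar>k\<bar>) powr q"
          using True c H(3)[of x] by (simp add: H'_def powr_mult)
        also have "\<dots> \<le> (c + 1) powr q * (2 powr q * (H x powr q + \<bar>k\<bar> powr q))"
          using H(3) q by (intro mult_left_mono powr_add_le) auto
        finally show ?thesis using True by simp
      qed (use q in \<open>simp add: H'_def\<close>)
      then show "AE x in lborel. norm (H' x powr q) \<le> norm ((c + 1) powr q * (2 powr q * (H x powr q + \<bar>k\<bar> powr q * indicator (cball x0 t) x)))"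
        by (intro AE_I2) (metis (no_types, lifting) abs_ge_self abs_of_nonneg order_trans powr_ge_zero real_norm_def)
    qed (auto simp: H'_def[abs_def])
    show "AE x in lborel. (\<lambda>j. \<phi> j x) \<longlonglongrightarrow> cutoff x0 s t x * ramp k \<delta> (v x)"
      using wl
    proof eventually_elim
      case (elim x)
      show ?case
      proof (cases "x \<in> cball x0 t")
        case True
        have "(\<lambda>j. ramp k \<delta> (w j x)) \<longlonglongrightarrow> ramp k \<delta> (v x)"
          by (rule continuous_on_tendsto_compose[OF continuous_ramp[OF \<delta>]]) (use elim sub[OF True] in auto)
        then show ?thesis unfolding \<phi>_def \<eta>_def by (intro tendsto_intros)
      next
        case False
        then show ?thesis using \<eta>0[OF False] by (simp add: \<phi>_def \<eta>_def[symmetric])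
      qed
    qed
    show "AE x in lborel. (\<lambda>j. gradient (\<phi> j) x) \<longlonglongrightarrow>
        ramp k \<delta> (v x) *\<^sub>R gradient (cutoff x0 s t) x + (cutoff x0 s t x * ramp' k \<delta> (v x)) *\<^sub>R D x"
      using wl wgl
    proof eventually_elim
      case (elim x)
      show ?case
      proof (cases "x \<in> cball x0 t")
        case True
        have "(\<lambda>j. ramp k \<delta> (w j x)) \<longlonglongrightarrow> ramp k \<delta> (v x)"
          by (rule continuous_on_tendsto_compose[OF continuous_ramp[OF \<delta>]]) (use elim sub[OF True] in auto)
        moreover have "(\<lambda>j. ramp' k \<delta> (w j x)) \<longlonglongrightarrow> ramp' k \<delta> (v x)"
          by (rule continuous_on_tendsto_compose[OF continuous_ramp'[OF \<delta>]]) (use elim sub[OF True] in auto)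
        moreover have "(\<lambda>j. gradient (w j) x) \<longlonglongrightarrow> D x"
          using elim(2) sub[OF True] by blast
        ultimately show ?thesis unfolding \<phi>g \<eta>_def by (intro tendsto_intros)
      next
        case False
        then show ?thesis using \<eta>0[OF False] \<eta>g0[OF False] by (simp add: \<phi>g \<eta>_def[symmetric])
      qed
    qed
    show "AE x in lborel. norm (gradient (\<phi> j) x) \<le> H' x" for j
      using wb wgb
    proof eventually_elim
      case (elim x)
      show ?case
      proof (cases "x \<in> cball x0 t")
        case True
        have 1: "\<bar>ramp k \<delta> (w j x)\<bar> \<le> H x + \<bar>k\<bar>"
          using rb[of "w j x"] spec[OF mp[OF elim(1) sub[OF True]], of j] by linarith
        have 2: "norm (gradient (w j) x) \<le> H x + \<bar>k\<bar>"
          using spec[OF mp[OF elim(2) sub[OF True]], of j] by linarith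
        have "norm (gradient (\<phi> j) x) \<le> \<bar>ramp k \<delta> (w j x)\<bar> * norm (gradient \<eta> x) + (\<eta> x * ramp' k \<delta> (w j x)) * norm (gradient (w j) x)"
          unfolding \<phi>g using \<eta>(1)[of x] ramp'_bounds[OF \<delta>]
          by (intro order_trans[OF norm_triangle_ineq]) simp
        also have "\<dots> \<le> (H x + \<bar>k\<bar>) * c + (1 * 1) * (H x + \<bar>k\<bar>)"
          using \<eta> ramp'_bounds[OF \<delta>] H(3) by (intro add_mono mult_mono 1 2) auto
        finally show ?thesis using True by (simp add: H'_def algebra_simps)
      next
        case False
        then show ?thesis by (simp add: \<phi>g \<eta>0 \<eta>g0 H'_def)
      qed
    qed
  qed
qed

subsection \<open>The Caccioppoli inequality\<close>

lemma Holder_norm_integrable: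
  fixes f :: "'a \<Rightarrow> 'b::euclidean_space" and g :: "'a \<Rightarrow> real"
  assumes [measurable]: "f \<in> borel_measurable M" "g \<in> borel_measurable M"
    and q: "q > 1" and f: "integrable M (\<lambda>x. norm (f x) powr (q / (q - 1)))" and g: "integrable M (\<lambda>x. \<bar>g x\<bar> powr q)"
  shows "integrable M (\<lambda>x. norm (f x) * g x)"
  using q f g by (intro Holder_integral(1)[of _ _ _ "q / (q - 1)" q]) (auto simp: divide_simps)

text \<open>The exponents of \<open>G\<close> and \<open>H\<close> are conjugate, so
  \<open>norm (G x) * H x\<close> is an integrable majorant.\<close>

lemma tested_equation_limit:
  fixes G :: "real^'n \<Rightarrow> real^'n" and \<phi> :: "nat \<Rightarrow> real^'n \<Rightarrow> real"
  assumes [measurable]: "G \<in> borel_measurable borel" "H \<in> borel_measurable borel" "E \<in> borel_measurable borel"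
    and q: "q > 1" and G: "integrable lborel (\<lambda>x. norm (G x) powr (q / (q - 1)))"
    and H: "integrable lborel (\<lambda>x. H x powr q)" "\<And>x. 0 \<le> H x"
    and eq: "\<And>\<phi>. \<phi> \<in> test_functions S \<Longrightarrow> (\<integral>x. G x \<bullet> gradient \<phi> x \<partial>lborel) = 0"
    and \<phi>: "\<And>j. \<phi> j \<in> test_functions S"
    and lim: "AE x in lborel. (\<lambda>j. gradient (\<phi> j) x) \<longlonglongrightarrow> E x"
    and bound: "\<And>j. AE x in lborel. norm (gradient (\<phi> j) x) \<le> H x"
  shows "(\<integral>x. G x \<bullet> E x \<partial>lborel) = 0"
proof -
  have [measurable]: "gradient (\<phi> j) \<in> borel_measurable borel" for j
    using test_function_measurable(2)[OF \<phi>] .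
  have "(\<lambda>j. \<integral>x. G x \<bullet> gradient (\<phi> j) x \<partial>lborel) \<longlonglongrightarrow> (\<integral>x. G x \<bullet> E x \<partial>lborel)"
  proof (rule integral_dominated_convergence)
    show "integrable lborel (\<lambda>x. norm (G x) * H x)"
      using H by (intro Holder_norm_integrable[OF _ _ q G]) auto
    show "AE x in lborel. (\<lambda>j. G x \<bullet> gradient (\<phi> j) x) \<longlonglongrightarrow> G x \<bullet> E x"
      using lim by eventually_elim (intro tendsto_intros)
    show "AE x in lborel. norm (G x \<bullet> gradient (\<phi> j) x) \<le> norm (G x) * H x" for j
      using bound[of j]
    proof eventually_elim
      case (elim x)
      have "norm (G x \<bullet> gradient (\<phi> j) x) \<le> norm (G x) * norm (gradient (\<phi> j) x)"
        by (simp add: Cauchy_Schwarz_ineq2)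
      also have "\<dots> \<le> norm (G x) * H x"
        by (intro mult_left_mono elim) auto
      finally show ?case .
    qed
  qed auto
  then show ?thesis
    by (simp add: eq[OF \<phi>] LIMSEQ_const_iff)
qed

text \<open>No majorant in \<open>L^r\<close> is available for \<open>\<phi> j\<close>, so Fatou's
  lemma is used on the left and dominated convergence on the right. Integrability of
  \<open>\<bar>f x\<bar> powr r\<close> is a conclusion; it is the gain from \<open>L^q\<close> to
  \<open>L^r\<close>.\<close>

lemma sobolev_limit:
  fixes \<phi> :: "nat \<Rightarrow> real^'n \<Rightarrow> real" and E :: "real^'n \<Rightarrow> real^'n"
  assumes [measurable]: "f \<in> borel_measurable borel" "H \<in> borel_measurable borel" "E \<in> borel_measurable borel"
    and p: "0 < p" and r: "0 < r" and C: "C \<ge> 0"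
    and sob: "\<And>j. (\<integral>x. \<bar>\<phi> j x\<bar> powr r \<partial>lborel) \<le> C * (\<integral>x. norm (gradient (\<phi> j) x) powr p \<partial>lborel) powr (r / p)"
    and H: "integrable lborel (\<lambda>x. H x powr p)" "\<And>x. 0 \<le> H x"
    and \<phi>: "\<And>j. \<phi> j \<in> test_functions S"
    and lim: "AE x in lborel. (\<lambda>j. \<phi> j x) \<longlonglongrightarrow> f x"
    and limg: "AE x in lborel. (\<lambda>j. gradient (\<phi> j) x) \<longlonglongrightarrow> E x"
    and bound: "\<And>j. AE x in lborel. norm (gradient (\<phi> j) x) \<le> H x"
  shows "integrable lborel (\<lambda>x. \<bar>f x\<bar> powr r)" "integrable lborel (\<lambda>x. norm (E x) powr p)"
    "(\<integral>x. \<bar>f x\<bar> powr r \<partial>lborel) \<le> C * (\<integral>x. norm (E x) powr p \<partial>lborel) powr (r / p)"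
proof -
  have [measurable]: "gradient (\<phi> j) \<in> borel_measurable borel" "\<phi> j \<in> borel_measurable borel" for j
    using test_function_measurable[OF \<phi>] by auto
  let ?I = "\<integral>x. norm (E x) powr p \<partial>lborel"
  have lim_pw: "AE x in lborel. (\<lambda>j. norm (gradient (\<phi> j) x) powr p) \<longlonglongrightarrow> norm (E x) powr p"
    using limg by eventually_elim (use p in \<open>auto intro!: tendsto_powr' tendsto_norm tendsto_const\<close>)
  have bound_pw: "AE x in lborel. norm (norm (gradient (\<phi> j) x) powr p) \<le> H x powr p" for j
    using bound[of j] by eventually_elim (use p in \<open>auto intro!: powr_mono2\<close>)
  have "(\<lambda>j. \<integral>x. norm (gradient (\<phi> j) x) powr p \<partial>lborel) \<longlonglongrightarrow> ?I"
    by (rule integral_dominated_convergence[OF _ _ H(1) lim_pw bound_pw]) auto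
  then have L: "(\<lambda>j. C * (\<integral>x. norm (gradient (\<phi> j) x) powr p \<partial>lborel) powr (r / p)) \<longlonglongrightarrow> C * ?I powr (r / p)"
    using p r by (intro tendsto_mult tendsto_const tendsto_powr') auto
  show "integrable lborel (\<lambda>x. norm (E x) powr p)"
    by (rule integrable_dominated_convergence[OF _ _ H(1) lim_pw bound_pw]) auto
  have cs: "continuous_on UNIV (\<phi> j)" for j
    by (rule smooth_continuous_on[OF test_functions_smooth[OF \<phi>]])
  have \<phi>i: "integrable lborel (\<lambda>x. \<bar>\<phi> j x\<bar> powr r)" for j
  proof -
    obtain K where "compact K" "\<And>x. x \<notin> K \<Longrightarrow> \<phi> j x = 0"
      using test_function_compact_support[OF \<phi>] by metis
    then show ?thesis
      using r by (intro continuous_compact_support_integrable[of _ K] continuous_on_powr' continuous_on_rabs cs continuous_on_const) auto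
  qed
  have "(\<integral>\<^sup>+x. ennreal (\<bar>f x\<bar> powr r) \<partial>lborel) = (\<integral>\<^sup>+x. liminf (\<lambda>j. ennreal (\<bar>\<phi> j x\<bar> powr r)) \<partial>lborel)"
  proof (rule nn_integral_cong_AE)
    show "AE x in lborel. ennreal (\<bar>f x\<bar> powr r) = liminf (\<lambda>j. ennreal (\<bar>\<phi> j x\<bar> powr r))"
      using lim
    proof eventually_elim
      case (elim x)
      have "(\<lambda>j. ennreal (\<bar>\<phi> j x\<bar> powr r)) \<longlonglongrightarrow> ennreal (\<bar>f x\<bar> powr r)"
        using elim r by (auto intro!: tendsto_ennrealI tendsto_powr' tendsto_rabs tendsto_const)
      then show ?case
        using lim_imp_Liminf[OF sequentially_bot] by metis
    qed
  qed
  also have "\<dots> \<le> liminf (\<lambda>j. \<integral>\<^sup>+x. ennreal (\<bar>\<phi> j x\<bar> powr r) \<partial>lborel)"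
    by (rule nn_integral_liminf) auto
  also have "\<dots> \<le> liminf (\<lambda>j. ennreal (C * (\<integral>x. norm (gradient (\<phi> j) x) powr p \<partial>lborel) powr (r / p)))"
    using \<phi>i by (intro Liminf_mono always_eventually allI) (auto simp: nn_integral_eq_integral intro!: ennreal_leI sob)
  also have "\<dots> = ennreal (C * ?I powr (r / p))"
    using lim_imp_Liminf[OF sequentially_bot tendsto_ennrealI[OF L]] .
  finally have F: "(\<integral>\<^sup>+x. ennreal (\<bar>f x\<bar> powr r) \<partial>lborel) \<le> ennreal (C * ?I powr (r / p))" .
  show fi: "integrable lborel (\<lambda>x. \<bar>f x\<bar> powr r)"
    by (rule integrableI_nonneg) (use F in \<open>auto intro: le_less_trans\<close>)
  show "(\<integral>x. \<bar>f x\<bar> powr r \<partial>lborel) \<le> C * ?I powr (r / p)"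
    using F C by (simp add: nn_integral_eq_integral[OF fi] ennreal_le_iff)
qed

text \<open>The Caccioppoli inequality weighted with \<open>\<eta> * ramp'\<close> bounds the
  \<open>L^p\<close> norm of the gradient of \<open>\<eta> * ramp (v)\<close>, to which the Sobolev
  inequality is applied. The condition \<open>R \<le> 1/2\<close> places the test functions in the
  range of that inequality.\<close>

lemma truncation_estimate:
  fixes v a :: "real^'n \<Rightarrow> real" and D G :: "real^'n \<Rightarrow> real^'n"
  assumes meas[measurable]: "v \<in> borel_measurable borel" "D \<in> borel_measurable borel"
      "G \<in> borel_measurable borel" "a \<in> borel_measurable borel"
    and v: "integrable lborel (\<lambda>x. \<bar>v x\<bar> powr q)" and D: "integrable lborel (\<lambda>x. norm (D x) powr q)"
    and G: "integrable lborel (\<lambda>x. norm (G x) powr (q / (q - 1)))" and a: "integrable lborel a" "\<And>x. 0 \<le> a x"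
    and v0: "\<And>x. x \<notin> cball x0 R \<Longrightarrow> v x = 0" and D0: "\<And>x. x \<notin> cball x0 R \<Longrightarrow> D x = 0"
    and weak: "\<And>\<phi> i. \<phi> \<in> test_functions (ball x0 R) \<Longrightarrow>
        (\<integral>x. v x * partial_deriv i \<phi> x \<partial>lborel) = - (\<integral>x. D x $ i * \<phi> x \<partial>lborel)"
    and eq: "\<And>\<phi>. \<phi> \<in> test_functions (ball x0 R) \<Longrightarrow> (\<integral>x. G x \<bullet> gradient \<phi> x \<partial>lborel) = 0"
    and ell: "AE x in lborel. x \<in> ball x0 R \<longrightarrow> \<nu> * norm (D x) powr p - a x \<le> G x \<bullet> D x"
    and \<nu>: "\<nu> > 0" and p: "1 < p" "p \<le> q" and r: "r > p" and C: "C > 0" and R: "R \<le> 1/2"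
    and sob: "\<And>w :: real^'n \<Rightarrow> real. smooth w \<Longrightarrow> (\<And>x. x \<notin> cball x0 (1/2) \<Longrightarrow> w x = 0) \<Longrightarrow>
      (\<integral>x. \<bar>w x\<bar> powr r \<partial>lborel) \<le> C * (\<integral>x. norm (gradient w x) powr p \<partial>lborel) powr (r / p)"
    and st: "0 \<le> s" "s < t" "t < R" and \<delta>: "\<delta> > 0"
  shows "integrable lborel (\<lambda>x. indicator (cball x0 s) x * max 0 (v x - k - \<delta>) powr r)"
    and "(\<integral>x. indicator (cball x0 s) x * max 0 (v x - k - \<delta>) powr r \<partial>lborel) \<le>
      exp (2 * r) * C * (2 powr p * ((4 / (t - s)) powr p * (\<integral>x. indicator (cball x0 t) x * max 0 (v x - k) powr p \<partial>lborel)
       + 1 / \<nu> * (4 / (t - s) * (\<integral>x. indicator (cball x0 t) x * (norm (G x) * max 0 (v x - k)) \<partial>lborel)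
          + (\<integral>x. indicator {x \<in> cball x0 t. v x > k} x * a x \<partial>lborel)))) powr (r / p)"
proof -
  have q: "q > 1" using p by simp
  obtain \<phi> H where \<phi>: "\<And>j. \<phi> j \<in> test_functions (ball x0 R)"
    and H: "H \<in> borel_measurable borel" "integrable lborel (\<lambda>x. H x powr q)" "\<And>x. 0 \<le> H x"
    and \<phi>0: "\<And>j x. x \<notin> cball x0 t \<Longrightarrow> \<phi> j x = 0" and H0: "\<And>x. x \<notin> cball x0 t \<Longrightarrow> H x = 0"
    and l: "AE x in lborel. (\<lambda>j. \<phi> j x) \<longlonglongrightarrow> cutoff x0 s t x * ramp k \<delta> (v x)"
    and lg: "AE x in lborel. (\<lambda>j. gradient (\<phi> j) x) \<longlonglongrightarrow>
        ramp k \<delta> (v x) *\<^sub>R gradient (cutoff x0 s t) x + (cutoff x0 s t x * ramp' k \<delta> (v x)) *\<^sub>R D x"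
    and bg: "\<And>j. AE x in lborel. norm (gradient (\<phi> j) x) \<le> H x"
    by (rule truncated_test_functions[OF meas(1,2) v D v0 D0 weak less_imp_le[OF q] st \<delta>, where k = k]) (assumption | rule that)+
  note [measurable] = H(1)
  define \<eta> where "\<eta> = cutoff x0 s t"
  define c where "c = 4 / (t - s)"
  have c: "c > 0" using st by (simp add: c_def)
  have \<eta>: "0 \<le> \<eta> x" "\<eta> x \<le> 1" "smooth \<eta>" "norm (gradient \<eta> x) \<le> c" for x
    using gradient_cutoff_bound[OF st(1,2)] by (simp_all add: \<eta>_def c_def cutoff_nonneg cutoff_le_1 smooth_cutoff)
  have \<eta>0: "\<eta> x = 0" if "x \<notin> cball x0 t" for x
    unfolding \<eta>_def by (rule cutoff_eq_0[OF st(1,2)]) (use that ball_subset_cball in blast)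
  have \<eta>g0: "gradient \<eta> x = 0" if "x \<notin> cball x0 t" for x
    by (rule gradient_eq_0_outside[OF closed_cball that \<eta>0])
  have [measurable]: "\<eta> \<in> borel_measurable borel" "gradient \<eta> \<in> borel_measurable borel"
    "ramp k \<delta> \<in> borel_measurable borel" "ramp' k \<delta> \<in> borel_measurable borel" "cball x0 t \<in> sets borel" "cball x0 s \<in> sets borel"
    using \<eta>(3) \<delta> by (auto intro!: borel_measurable_continuous_onI smooth_continuous_on smooth_continuous_gradient continuous_ramp continuous_ramp')
  define F F' where "F x = ramp k \<delta> (v x)" and "F' x = ramp' k \<delta> (v x)" for x
  have [measurable]: "F \<in> borel_measurable borel" "F' \<in> borel_measurable borel"
    unfolding F_def[abs_def] F'_def[abs_def] by measurable
  define m where "m x = max 0 (v x - k)" for x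
  have [measurable]: "m \<in> borel_measurable borel" unfolding m_def[abs_def] by measurable
  have F: "0 \<le> F x" "F x \<le> m x" "exp (-1) * max 0 (v x - k - \<delta>) \<le> F x"
    and F': "0 \<le> F' x" "F' x \<le> 1" "v x \<le> k \<Longrightarrow> F' x = 0" for x
    using ramp_bounds[OF \<delta>] ramp'_bounds[OF \<delta>] by (auto simp: F_def F'_def m_def)
  have m0: "0 \<le> m x" for x by (simp add: m_def)
  define E where "E x = F x *\<^sub>R gradient \<eta> x + (\<eta> x * F' x) *\<^sub>R D x" for x
  have [measurable]: "E \<in> borel_measurable borel" unfolding E_def[abs_def] by measurable
  have lg': "AE x in lborel. (\<lambda>j. gradient (\<phi> j) x) \<longlonglongrightarrow> E x"
    using lg by (simp add: E_def F_def F'_def \<eta>_def)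
  have mq: "integrable lborel (\<lambda>x. \<bar>indicator (cball x0 t) x * m x\<bar> powr q)"
  proof (rule Bochner_Integration.integrable_bound)
    show "integrable lborel (\<lambda>x. 2 powr q * (\<bar>v x\<bar> powr q + \<bar>k\<bar> powr q * indicator (cball x0 t) x))"
      using v by (intro integrable_mult_right Bochner_Integration.integrable_add integrable_real_indicator emeasure_lborel_cball_finite) auto
    have "\<bar>indicator (cball x0 t) x * m x\<bar> powr q \<le> 2 powr q * (\<bar>v x\<bar> powr q + \<bar>k\<bar> powr q * indicator (cball x0 t) x)" for x
    proof (cases "x \<in> cball x0 t")
      case True
      have "m x powr q \<le> (\<bar>v x\<bar> + \<bar>k\<bar>) powr q"
        using q by (intro powr_mono2) (auto simp: m_def)
      also have "\<dots> \<le> 2 powr q * (\<bar>v x\<bar> powr q + \<bar>k\<bar> powr q)"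
        using q by (intro powr_add_le) auto
      finally show ?thesis using True m0[of x] by simp
    qed (use q in simp)
    then show "AE x in lborel. norm (\<bar>indicator (cball x0 t) x * m x\<bar> powr q) \<le> norm (2 powr q * (\<bar>v x\<bar> powr q + \<bar>k\<bar> powr q * indicator (cball x0 t) x))"
      by (intro AE_I2) (metis (no_types, lifting) abs_ge_self abs_of_nonneg order_trans powr_ge_zero real_norm_def)
  qed auto
  have mp: "integrable lborel (\<lambda>x. indicator (cball x0 t) x * m x powr p)"
  proof -
    have "integrable lborel (\<lambda>x. \<bar>indicator (cball x0 t) x * m x\<bar> powr p)"
      by (rule integrable_of_powr_bounded_support[OF _ mq, of x0 t]) (use p in auto)
    moreover have "\<bar>indicator (cball x0 t) x * m x\<bar> powr p = indicator (cball x0 t) x * m x powr p" for x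
      using m0[of x] p by (simp add: indicator_def)
    ultimately show ?thesis by simp
  qed
  have Gm: "integrable lborel (\<lambda>x. indicator (cball x0 t) x * (norm (G x) * m x))"
    using Holder_norm_integrable[OF _ _ q G mq] by (simp add: mult_ac)
  have Dp: "integrable lborel (\<lambda>x. norm (D x) powr p)"
    using integrable_of_powr_bounded_support[of "\<lambda>x. norm (D x)" q x0 R p] D D0 p by simp
  have GD: "integrable lborel (\<lambda>x. norm (G x) * norm (D x))"
    using D by (intro Holder_norm_integrable[OF _ _ q G]) auto
  have GD': "integrable lborel (\<lambda>x. \<eta> x * F' x * (G x \<bullet> D x))"
  proof (rule Bochner_Integration.integrable_bound[OF GD])
    have "\<bar>\<eta> x * F' x * (G x \<bullet> D x)\<bar> \<le> 1 * 1 * (norm (G x) * norm (D x))" for x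
      unfolding abs_mult using \<eta>(1,2)[of x] F'(1,2)[of x]
      by (intro mult_mono Cauchy_Schwarz_ineq2) auto
    then show "AE x in lborel. norm (\<eta> x * F' x * (G x \<bullet> D x)) \<le> norm (norm (G x) * norm (D x))"
      by simp
  qed auto
  have Gg_le: "\<bar>F x * (G x \<bullet> gradient \<eta> x)\<bar> \<le> c * (indicator (cball x0 t) x * (norm (G x) * m x))" for x
  proof (cases "x \<in> cball x0 t")
    case True
    have "\<bar>F x * (G x \<bullet> gradient \<eta> x)\<bar> \<le> m x * (norm (G x) * c)"
      unfolding abs_mult using F[of x] \<eta>(4)[of x] m0[of x]
      by (intro mult_mono order_trans[OF Cauchy_Schwarz_ineq2] mult_left_mono) auto
    then show ?thesis using True by (simp add: mult_ac)
  qed (simp add: \<eta>g0)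
  have Gg: "integrable lborel (\<lambda>x. F x * (G x \<bullet> gradient \<eta> x))"
    by (rule Bochner_Integration.integrable_bound[OF integrable_mult_right[OF Gm, of c]])
       (use Gg_le in \<open>auto intro!: AE_I2 order_trans[OF Gg_le abs_ge_self]\<close>)
  have "(\<integral>x. G x \<bullet> E x \<partial>lborel) = 0"
    by (rule tested_equation_limit[OF _ _ _ q G H(2,3) eq \<phi> lg' bg]) auto
  moreover have "G x \<bullet> E x = F x * (G x \<bullet> gradient \<eta> x) + \<eta> x * F' x * (G x \<bullet> D x)" for x
    by (simp add: E_def inner_add_right)
  ultimately have energy: "(\<integral>x. \<eta> x * F' x * (G x \<bullet> D x) \<partial>lborel) = - (\<integral>x. F x * (G x \<bullet> gradient \<eta> x) \<partial>lborel)"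
    using Gg GD' by simp
  define P where "P = (\<integral>x. indicator (cball x0 t) x * m x powr p \<partial>lborel)"
  define Q where "Q = (\<integral>x. indicator (cball x0 t) x * (norm (G x) * m x) \<partial>lborel)"
  define A where "A = (\<integral>x. indicator {x \<in> cball x0 t. v x > k} x * a x \<partial>lborel)"
  have ai: "integrable lborel (\<lambda>x. indicator {x \<in> cball x0 t. v x > k} x * a x)"
    using a by (intro integrable_bounded_mult[where B = 1]) (auto simp: indicator_def)
  have Di: "integrable lborel (\<lambda>x. \<eta> x * F' x * norm (D x) powr p)"
    by (rule integrable_bounded_mult[OF Dp, where B = 1])
       (use \<eta>(1,2) F'(1,2) in \<open>auto simp: abs_mult intro!: mult_le_one\<close>)
  have cacc: "\<nu> * (\<integral>x. \<eta> x * F' x * norm (D x) powr p \<partial>lborel) \<le> c * Q + A"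
  proof -
    have "(\<integral>x. \<nu> * (\<eta> x * F' x * norm (D x) powr p) \<partial>lborel) \<le>
        (\<integral>x. \<eta> x * F' x * (G x \<bullet> D x) + indicator {x \<in> cball x0 t. v x > k} x * a x \<partial>lborel)"
    proof (rule integral_mono_AE)
      \<comment> \<open>The ellipticity condition is multiplied by the weight
        \<open>\<eta> * F'\<close>, which lies in \<open>[0,1]\<close> and vanishes off
        \<open>{x \<in> cball x0 t. v x > k}\<close>; hence \<open>a\<close> is integrated over that
        set only.\<close>
      show "AE x in lborel. \<nu> * (\<eta> x * F' x * norm (D x) powr p) \<le> \<eta> x * F' x * (G x \<bullet> D x) + indicator {x \<in> cball x0 t. v x > k} x * a x"
        using ell
      proof eventually_elim
        case (elim x)
        show ?case
        proof (cases "x \<in> cball x0 t \<and> v x > k")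
          case True
          then have "\<nu> * norm (D x) powr p \<le> G x \<bullet> D x + a x"
            using elim st by auto
          then have "\<eta> x * F' x * (\<nu> * norm (D x) powr p) \<le> \<eta> x * F' x * (G x \<bullet> D x + a x)"
            using \<eta>(1) F'(1) by (intro mult_left_mono) auto
          moreover have "\<eta> x * F' x * a x \<le> 1 * 1 * a x"
            using \<eta>(1,2)[of x] F'(1,2)[of x] a(2)[of x] by (intro mult_mono) auto
          ultimately show ?thesis using True by (simp add: algebra_simps)
        next
          case False
          then have "\<eta> x = 0 \<or> F' x = 0" using \<eta>0 F'(3) by fastforce
          then show ?thesis using a(2) by auto
        qed
      qed
    qed (use Di GD' ai in auto)
    also have "\<dots> = - (\<integral>x. F x * (G x \<bullet> gradient \<eta> x) \<partial>lborel) + A"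
      using GD' ai energy by (simp add: A_def)
    also have "- (\<integral>x. F x * (G x \<bullet> gradient \<eta> x) \<partial>lborel) \<le> (\<integral>x. c * (indicator (cball x0 t) x * (norm (G x) * m x)) \<partial>lborel)"
      unfolding integral_minus[symmetric]
      by (rule integral_mono) (use Gg Gm Gg_le in \<open>auto intro: order_trans[OF abs_ge_minus_self]\<close>)
    also have "\<dots> = c * Q" by (simp add: Q_def)
    finally show ?thesis by simp
  qed
  have sob_j: "(\<integral>x. \<bar>\<phi> j x\<bar> powr r \<partial>lborel) \<le> C * (\<integral>x. norm (gradient (\<phi> j) x) powr p \<partial>lborel) powr (r / p)" for j
  proof (rule sob[OF test_functions_smooth[OF \<phi>]])
    show "\<phi> j x = 0" if "x \<notin> cball x0 (1/2)" for x
      by (rule \<phi>0) (use that st R in auto)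
  qed
  have Hp: "integrable lborel (\<lambda>x. H x powr p)"
    using integrable_of_powr_bounded_support[of H q x0 t p] H H0 p by simp
  have l': "AE x in lborel. (\<lambda>j. \<phi> j x) \<longlonglongrightarrow> \<eta> x * F x"
    using l by (simp only: \<eta>_def F_def)
  have \<eta>F: "(\<lambda>x. \<eta> x * F x) \<in> borel_measurable borel" and E: "E \<in> borel_measurable borel"
    by measurable
  have pr: "0 < p" "0 < r" "0 \<le> C" using p r C by auto
  note S = sobolev_limit[OF \<eta>F H(1) E pr sob_j Hp H(3) \<phi> l' lg' bg]
  have E_le: "norm (E x) powr p \<le> 2 powr p * (c powr p * (indicator (cball x0 t) x * m x powr p) + \<eta> x * F' x * norm (D x) powr p)" for x
  proof (cases "x \<in> cball x0 t")
    case True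
    have "norm (E x) \<le> F x * norm (gradient \<eta> x) + \<eta> x * F' x * norm (D x)"
      unfolding E_def using F(1)[of x] F'(1)[of x] \<eta>(1)[of x]
      by (intro order_trans[OF norm_triangle_ineq]) simp
    then have "norm (E x) powr p \<le> (F x * norm (gradient \<eta> x) + \<eta> x * F' x * norm (D x)) powr p"
      using p by (intro powr_mono2) auto
    also have "\<dots> \<le> 2 powr p * ((F x * norm (gradient \<eta> x)) powr p + (\<eta> x * F' x * norm (D x)) powr p)"
      using p F(1)[of x] F'(1)[of x] \<eta>(1)[of x] by (intro powr_add_le) auto
    also have "\<dots> \<le> 2 powr p * ((m x * c) powr p + \<eta> x * F' x * norm (D x) powr p)"
    proof (intro mult_left_mono add_mono)
      show "(F x * norm (gradient \<eta> x)) powr p \<le> (m x * c) powr p"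
        using p F[of x] \<eta>(4)[of x] m0[of x] by (intro powr_mono2 mult_mono) auto
      \<comment> \<open>A number in \<open>[0,1]\<close> dominates its \<open>p\<close>-th power for
        \<open>p > 1\<close>, so the weight of the energy inequality can be used with power one in
        both places.\<close>
      have "(\<eta> x * F' x) powr p \<le> (\<eta> x * F' x) powr 1"
        using p \<eta>(1,2)[of x] F'(1,2)[of x] by (intro powr_mono') (auto intro: mult_le_one)
      then have "(\<eta> x * F' x) powr p \<le> \<eta> x * F' x"
        using \<eta>(1)[of x] F'(1)[of x] by simp
      then show "(\<eta> x * F' x * norm (D x)) powr p \<le> \<eta> x * F' x * norm (D x) powr p"
        using \<eta>(1)[of x] F'(1)[of x] by (subst powr_mult) (auto intro!: mult_right_mono)
    qed auto
    also have "(m x * c) powr p = c powr p * m x powr p"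
      using c m0 by (simp add: powr_mult mult.commute)
    finally show ?thesis using True by simp
  next
    case False
    then show ?thesis using p by (simp add: E_def \<eta>0 \<eta>g0)
  qed
  have "(\<integral>x. norm (E x) powr p \<partial>lborel) \<le> (\<integral>x. 2 powr p * (c powr p * (indicator (cball x0 t) x * m x powr p) + \<eta> x * F' x * norm (D x) powr p) \<partial>lborel)"
    using S(2) mp Di by (intro integral_mono E_le) auto
  also have "\<dots> = 2 powr p * (c powr p * P + (\<integral>x. \<eta> x * F' x * norm (D x) powr p \<partial>lborel))"
    using mp Di by (simp add: P_def)
  also have "\<dots> \<le> 2 powr p * (c powr p * P + 1 / \<nu> * (c * Q + A))"
    using cacc \<nu> by (intro mult_left_mono add_left_mono) (auto simp: field_simps)
  finally have E_int: "(\<integral>x. norm (E x) powr p \<partial>lborel) \<le> 2 powr p * (c powr p * P + 1 / \<nu> * (c * Q + A))" .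
  \<comment> \<open>One factor \<open>exp (- 1)\<close> is lost by the cutoff on the inner ball and
    one by the ramp; the power \<open>r\<close> makes this \<open>exp (2 * r)\<close>.\<close>
  have low: "indicator (cball x0 s) x * max 0 (v x - k - \<delta>) powr r \<le> exp (2 * r) * \<bar>\<eta> x * F x\<bar> powr r" for x
  proof (cases "x \<in> cball x0 s")
    case True
    have "exp (- 1) * (exp (- 1) * max 0 (v x - k - \<delta>)) \<le> \<eta> x * F x"
      using F(3)[of x] cutoff_ge[OF st(1,2) True] by (intro mult_mono) (auto simp: \<eta>_def cutoff_nonneg)
    then have "exp (- 2) * max 0 (v x - k - \<delta>) \<le> \<eta> x * F x"
      by (simp add: mult.assoc[symmetric] exp_add[symmetric])
    then have "max 0 (v x - k - \<delta>) \<le> exp 2 * (\<eta> x * F x)"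
      by (simp add: exp_minus field_simps)
    then have "max 0 (v x - k - \<delta>) powr r \<le> (exp 2 * (\<eta> x * F x)) powr r"
      using r p by (intro powr_mono2) auto
    also have "\<dots> = exp (2 * r) * (\<eta> x * F x) powr r"
      by (simp add: powr_mult exp_powr_real)
    finally show ?thesis using True \<eta>(1)[of x] F(1)[of x] by simp
  qed simp
  show "integrable lborel (\<lambda>x. indicator (cball x0 s) x * max 0 (v x - k - \<delta>) powr r)"
    by (rule Bochner_Integration.integrable_bound[OF integrable_mult_right[OF S(1), of "exp (2 * r)"]])
       (use low in \<open>auto intro!: AE_I2 order_trans[OF low abs_ge_self]\<close>)
  then have "(\<integral>x. indicator (cball x0 s) x * max 0 (v x - k - \<delta>) powr r \<partial>lborel) \<le> (\<integral>x. exp (2 * r) * \<bar>\<eta> x * F x\<bar> powr r \<partial>lborel)"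
    using S(1) low by (intro integral_mono) auto
  also have "\<dots> \<le> exp (2 * r) * (C * (\<integral>x. norm (E x) powr p \<partial>lborel) powr (r / p))"
    using S(3) by simp
  also have "\<dots> \<le> exp (2 * r) * (C * (2 powr p * (c powr p * P + 1 / \<nu> * (c * Q + A))) powr (r / p))"
    using E_int C r p by (intro mult_left_mono powr_mono2) auto
  finally show "(\<integral>x. indicator (cball x0 s) x * max 0 (v x - k - \<delta>) powr r \<partial>lborel) \<le>
      exp (2 * r) * C * (2 powr p * ((4 / (t - s)) powr p * (\<integral>x. indicator (cball x0 t) x * max 0 (v x - k) powr p \<partial>lborel)
       + 1 / \<nu> * (4 / (t - s) * (\<integral>x. indicator (cball x0 t) x * (norm (G x) * max 0 (v x - k)) \<partial>lborel)
          + (\<integral>x. indicator {x \<in> cball x0 t. v x > k} x * a x \<partial>lborel)))) powr (r / p)"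
    by (simp only: P_def Q_def A_def c_def m_def mult.assoc)
qed

subsection \<open>De Giorgi iteration\<close>

text \<open>The bound \<open>Y h \<le> \<epsilon> \<theta>^h\<close> is preserved when
  \<open>\<theta> powr \<delta> = 1 / B\<close> cancels the growth \<open>B ^ h\<close> and
  \<open>C * \<epsilon> powr \<delta> \<le> \<theta>\<close> supplies the next factor. The recursion
  is demanded only for \<open>Y h \<le> 1\<close>, which the same bound guarantees as
  \<open>\<epsilon> \<le> 1\<close>.\<close>

lemma fast_geometric_convergence:
  fixes B C \<delta> :: real
  assumes B: "B > 1" and C: "C > 0" and \<delta>: "\<delta> > 0"
  obtains \<epsilon> where "\<epsilon> > 0" "\<epsilon> \<le> 1" "\<And>Y :: nat \<Rightarrow> real. (\<And>h. 0 \<le> Y h) \<Longrightarrow>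
      (\<And>h. Y h \<le> 1 \<Longrightarrow> Y (Suc h) \<le> C * B ^ h * Y h powr (1 + \<delta>)) \<Longrightarrow> Y 0 \<le> \<epsilon> \<Longrightarrow> Y \<longlonglongrightarrow> 0"
proof -
  define \<theta> where "\<theta> = B powr (- 1 / \<delta>)"
  have \<theta>: "0 < \<theta>" "\<theta> < 1" using B \<delta> by (auto simp: \<theta>_def powr_less_one)
  define \<epsilon> where "\<epsilon> = min 1 ((\<theta> / C) powr (1 / \<delta>))"
  have \<epsilon>: "\<epsilon> > 0" "\<epsilon> \<le> 1" using \<theta> C by (auto simp: \<epsilon>_def)
  have "\<epsilon> powr \<delta> \<le> ((\<theta> / C) powr (1 / \<delta>)) powr \<delta>"
    using \<epsilon> \<delta> by (intro powr_mono2) (auto simp: \<epsilon>_def)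
  also have "\<dots> = \<theta> / C" using \<theta> C \<delta> by (simp add: powr_powr)
  finally have e\<delta>: "C * \<epsilon> powr \<delta> \<le> \<theta>" using C by (simp add: field_simps)
  show ?thesis
  proof (rule that[OF \<epsilon>])
    fix Y :: "nat \<Rightarrow> real"
    assume Y0: "\<And>h. 0 \<le> Y h" and rec: "\<And>h. Y h \<le> 1 \<Longrightarrow> Y (Suc h) \<le> C * B ^ h * Y h powr (1 + \<delta>)" and init: "Y 0 \<le> \<epsilon>"
    have le: "Y h \<le> \<epsilon> * \<theta> ^ h" for h
    proof (induction h)
      case 0
      then show ?case using init by simp
    next
      case (Suc h)
      have "\<epsilon> * \<theta> ^ h \<le> 1 * 1"
        using \<epsilon> \<theta> by (intro mult_mono power_le_one) auto
      then have "Y (Suc h) \<le> C * B ^ h * Y h powr (1 + \<delta>)"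
        using Suc by (intro rec) auto
      also have "\<dots> \<le> C * B ^ h * (\<epsilon> * \<theta> ^ h) powr (1 + \<delta>)"
        using Suc Y0 \<delta> B C by (intro mult_left_mono powr_mono2) auto
      also have "(\<epsilon> * \<theta> ^ h) powr (1 + \<delta>) = (\<epsilon> * \<theta> ^ h) * (\<epsilon> powr \<delta> * (\<theta> ^ h) powr \<delta>)"
        using \<epsilon> \<theta> by (simp add: powr_add powr_mult)
      also have "(\<theta> ^ h) powr \<delta> = 1 / B ^ h"
      proof -
        have t: "\<theta> powr \<delta> = 1 / B"
          unfolding \<theta>_def powr_powr using B \<delta> by (simp add: powr_minus_divide)
        have "(\<theta> ^ h) powr \<delta> = (\<theta> powr \<delta>) powr real h"
          using \<theta> by (simp add: powr_realpow[symmetric] powr_powr mult.commute)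
        then show ?thesis
          using B by (simp add: t powr_realpow power_divide)
      qed
      also have "C * B ^ h * (\<epsilon> * \<theta> ^ h * (\<epsilon> powr \<delta> * (1 / B ^ h))) = (C * \<epsilon> powr \<delta>) * (\<epsilon> * \<theta> ^ h)"
        using B by simp
      also have "\<dots> \<le> \<theta> * (\<epsilon> * \<theta> ^ h)"
        using e\<delta> \<epsilon> \<theta> by (intro mult_right_mono) auto
      finally show ?case by (simp add: mult_ac)
    qed
    have "(\<lambda>h. \<epsilon> * \<theta> ^ h) \<longlonglongrightarrow> \<epsilon> * 0"
      using \<theta> by (intro tendsto_mult tendsto_const LIMSEQ_power_zero) auto
    then show "Y \<longlonglongrightarrow> 0"
      by (intro tendsto_sandwich[OF _ _ tendsto_const, of 0 Y _ "\<lambda>h. \<epsilon> * \<theta> ^ h"]) (auto simp: le Y0)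
  qed
qed

text \<open>Chebyshev's inequality in pointwise form: where \<open>m > k + \<delta>\<close>, the
  quotient \<open>(m - k) / \<delta>\<close> exceeds 1, so its lower powers are dominated by the
  \<open>r\<close>-th. The case \<open>e = 0\<close> bounds the measure of the level set.\<close>

lemma truncation_power_le:
  fixes m :: real
  assumes "\<delta> > 0" "\<delta> \<le> 1" "0 \<le> e" "e \<le> r" "m > k + \<delta>"
  shows "(m - k - \<delta>) powr e \<le> (1 / \<delta>) powr r * (m - k) powr r"
proof -
  have "(m - k - \<delta>) powr e \<le> (m - k) powr e"
    using assms by (intro powr_mono2) auto
  also have "\<dots> \<le> ((m - k) / \<delta>) powr e"
  proof (rule powr_mono2)
    show "m - k \<le> (m - k) / \<delta>"
      using assms mult_left_mono[of \<delta> 1 "m - k"] by (simp add: field_simps)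
  qed (use assms in auto)
  also have "\<dots> \<le> ((m - k) / \<delta>) powr r"
    using assms by (intro powr_mono) (auto simp: field_simps)
  also have "\<dots> = (1 / \<delta>) powr r * (m - k) powr r"
    using assms by (simp add: powr_divide)
  finally show ?thesis .
qed

text \<open>All three integrals on the right of \<open>est\<close> are bounded by powers of the
  \<open>r\<close>-th power integral at a slightly lower level: 1, \<open>1 / q\<close> and
  \<open>1 - 1 / \<tau>\<close>. The hypotheses \<open>gain\<close> say that each of the last two,
  multiplied by \<open>r / p\<close>, exceeds 1.\<close>

lemma de_giorgi_iteration:
  fixes v a g :: "'a::euclidean_space \<Rightarrow> real"
  assumes meas[measurable]: "v \<in> borel_measurable borel" "g \<in> borel_measurable borel" "a \<in> borel_measurable borel"
    and g: "integrable lborel (\<lambda>x. \<bar>g x\<bar> powr (q / (q - 1)))" "\<And>x. 0 \<le> g x"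
    and a: "integrable lborel (\<lambda>x. \<bar>a x\<bar> powr \<tau>)" "\<And>x. 0 \<le> a x"
    and p: "1 < p" "p \<le> q" "q \<le> r" and \<tau>: "\<tau> > 1"
    and gain: "p * q < r" "(1 - 1 / \<tau>) * r > p" and C: "C > 0" and R: "R > 0" and \<nu>: "\<nu> > 0"
    and int: "\<And>k \<delta> s t. 0 \<le> s \<Longrightarrow> s < t \<Longrightarrow> t < R \<Longrightarrow> \<delta> > 0 \<Longrightarrow>
      integrable lborel (\<lambda>x. indicator (cball x0 s) x * max 0 (v x - k - \<delta>) powr r)"
    and est: "\<And>k \<delta> s t. 0 \<le> s \<Longrightarrow> s < t \<Longrightarrow> t < R \<Longrightarrow> \<delta> > 0 \<Longrightarrow>
      (\<integral>x. indicator (cball x0 s) x * max 0 (v x - k - \<delta>) powr r \<partial>lborel) \<le>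
      C * (2 powr p * ((4 / (t - s)) powr p * (\<integral>x. indicator (cball x0 t) x * max 0 (v x - k) powr p \<partial>lborel)
       + 1 / \<nu> * (4 / (t - s) * (\<integral>x. indicator (cball x0 t) x * (g x * max 0 (v x - k)) \<partial>lborel)
          + (\<integral>x. indicator {x \<in> cball x0 t. v x > k} x * a x \<partial>lborel)))) powr (r / p)"
  obtains N where "AE x in lborel. x \<in> cball x0 (R / 4) \<longrightarrow> v x \<le> N"
proof -
  have q: "q > 1" and r: "r > 1" and rp: "r / p \<ge> 0" using p by auto
  \<comment> \<open>The smallest of the three powers. For \<open>Y h \<le> 1\<close> it dominates
    the others, and \<open>\<delta>0\<close> is the resulting excess over 1.\<close>
  define \<kappa> where "\<kappa> = min (1 - 1 / \<tau>) (1 / q)"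
  have \<kappa>: "\<kappa> > 0" "\<kappa> \<le> 1 - 1 / \<tau>" "\<kappa> \<le> 1 / q" "\<kappa> \<le> 1"
    using q \<tau> by (auto simp: \<kappa>_def min_le_iff_disj)
  define \<delta>0 where "\<delta>0 = \<kappa> * r / p - 1"
  have \<delta>0: "\<delta>0 > 0"
    using gain p q unfolding \<delta>0_def \<kappa>_def by (auto simp: min_def field_simps)
  define g0 where "g0 = (\<integral>x. \<bar>g x\<bar> powr (q / (q - 1)) \<partial>lborel) powr (1 / (q / (q - 1)))"
  define a0 where "a0 = (\<integral>x. \<bar>a x\<bar> powr \<tau> \<partial>lborel) powr (1 / \<tau>)"
  have ga0: "g0 \<ge> 0" "a0 \<ge> 0" by (auto simp: g0_def a0_def)
  \<comment> \<open>The constants at scale \<open>h = 0\<close>: 32 comes from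
    \<open>4 / (\<rho> h - \<rho> (Suc h)) = 32 * 2 ^ h / R\<close>, and \<open>4 powr r\<close>
    from the \<open>r\<close>-th power of \<open>1 / \<delta> = 4 * 2 ^ h\<close>.\<close>
  define K where "K = 2 powr p * ((32 / R) powr p * 4 powr r + 1 / \<nu> * (32 / R * (g0 * 4 powr r) + a0 * 4 powr r))"
  have K: "K > 0"
    unfolding K_def using R \<nu> ga0 by (intro mult_pos_pos add_pos_nonneg) auto
  \<comment> \<open>Per step, a factor of at most \<open>2 powr p\<close> comes from the cutoff
    gradient and \<open>2 powr r\<close> from the truncation, all raised to
    \<open>r / p\<close>.\<close>
  define B where "B = 2 powr ((p + r) * (r / p))"
  have B: "B > 1" unfolding B_def using p r by (intro gr_one_powr) auto
  define C2 where "C2 = C * K powr (r / p)"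
  have C2: "C2 > 0" using C K by (simp add: C2_def)
  obtain \<epsilon> where \<epsilon>: "\<epsilon> > 0" "\<epsilon> \<le> 1" and fast: "\<And>Y :: nat \<Rightarrow> real. (\<And>h. 0 \<le> Y h) \<Longrightarrow>
      (\<And>h. Y h \<le> 1 \<Longrightarrow> Y (Suc h) \<le> C2 * B ^ h * Y h powr (1 + \<delta>0)) \<Longrightarrow> Y 0 \<le> \<epsilon> \<Longrightarrow> Y \<longlonglongrightarrow> 0"
    using fast_geometric_convergence[OF B C2 \<delta>0] by metis
  have [measurable]: "cball x0 s \<in> sets borel" for s by simp
  have intd: "integrable lborel (\<lambda>x. indicator (cball x0 s) x * max 0 (v x - d) powr r)" if "0 \<le> s" "s \<le> R / 2" for s d
    using int[of s "3 / 4 * R" 1 "d - 1"] that R by simp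
  define f where "f d x = indicator (cball x0 (R / 2)) x * max 0 (v x - real d) powr r" for d :: nat and x
  \<comment> \<open>Raising the initial level \<open>d\<close> makes \<open>Y 0\<close> as small as
    the convergence lemma requires, since the truncations tend to 0 in \<open>L^r\<close>.\<close>
  have "(\<lambda>d. \<integral>x. f d x \<partial>lborel) \<longlonglongrightarrow> (\<integral>x. 0 \<partial>(lborel :: 'a measure))"
  proof (rule integral_dominated_convergence)
    show "integrable lborel (\<lambda>x. indicator (cball x0 (R / 2)) x * max 0 (v x - 0) powr r)"
      by (rule intd) (use R in auto)
    show "AE x in lborel. (\<lambda>d. f d x) \<longlonglongrightarrow> 0"
    proof (rule AE_I2)
      fix x
      have "\<forall>\<^sub>F d in sequentially. v x \<le> real d"
        using eventually_ge_at_top[of "nat \<lceil>v x\<rceil>"] by eventually_elim linarith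
      then have "\<forall>\<^sub>F d in sequentially. f d x = 0"
        by eventually_elim (simp add: f_def max_def)
      then show "(\<lambda>d. f d x) \<longlonglongrightarrow> 0" by (rule tendsto_eventually)
    qed
    show "AE x in lborel. norm (f d x) \<le> indicator (cball x0 (R / 2)) x * max 0 (v x - 0) powr r" for d
      using r by (intro AE_I2) (auto simp: f_def indicator_def intro!: powr_mono2)
  qed (auto simp: f_def[abs_def])
  then have "\<forall>\<^sub>F d in sequentially. (\<integral>x. f d x \<partial>lborel) < \<epsilon>"
    using order_tendstoD(2)[of _ 0 sequentially \<epsilon>] \<epsilon> by simp
  then obtain d where d: "(\<integral>x. f d x \<partial>lborel) < \<epsilon>"
    using eventually_happens' sequentially_bot by blast
  \<comment> \<open>Radii decrease from \<open>R / 2\<close> to \<open>R / 4\<close>, while the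
    levels \<open>\<kappa>'\<close> increase from \<open>d\<close> to \<open>d + 1\<close>.\<close>
  define \<rho> where "\<rho> h = R / 4 * (1 + 1 / 2 ^ h)" for h :: nat
  define \<kappa>' where "\<kappa>' h = real d + 1 - 1 / 2 ^ h" for h :: nat
  define Y where "Y h = (\<integral>x. indicator (cball x0 (\<rho> h)) x * max 0 (v x - \<kappa>' h) powr r \<partial>lborel)" for h
  have \<rho>: "R / 4 \<le> \<rho> h" "\<rho> h \<le> R / 2" "0 \<le> \<rho> h" "\<rho> h < R" "\<rho> (Suc h) < \<rho> h" "\<rho> h - \<rho> (Suc h) = R / (8 * 2 ^ h)" for h
  proof -
    have "1 / 2 ^ h \<le> (1::real)" "0 < 1 / (2::real) ^ h" by auto
    then have "R * (1 / 2 ^ h) \<le> R * 1" "0 < R * (1 / 2 ^ h)"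
      using R by (intro mult_left_mono mult_pos_pos; simp)+
    then show "R / 4 \<le> \<rho> h" "\<rho> h \<le> R / 2" "0 \<le> \<rho> h" "\<rho> h < R" "\<rho> (Suc h) < \<rho> h" "\<rho> h - \<rho> (Suc h) = R / (8 * 2 ^ h)"
      using R by (auto simp: \<rho>_def algebra_simps intro!: divide_strict_left_mono)
  qed
  have Y0: "0 \<le> Y h" for h unfolding Y_def by (intro integral_nonneg_AE) auto
  have rec: "Y (Suc h) \<le> C2 * B ^ h * Y h powr (1 + \<delta>0)" if Y1: "Y h \<le> 1" for h
  proof -
    define \<mu> where "\<mu> = (2::real) ^ h"
    have \<mu>: "\<mu> \<ge> 1" by (simp add: \<mu>_def)
    \<comment> \<open>Half the gap \<open>\<kappa>' (Suc h) - \<kappa>' h\<close>. One half is spent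
      on passing from lower powers to the power \<open>r\<close>, the other on the strip lost by the
      ramp.\<close>
    define \<delta> where "\<delta> = 1 / (4 * \<mu>)"
    have \<delta>: "\<delta> > 0" "\<delta> \<le> 1" using \<mu> by (auto simp: \<delta>_def field_simps)
    define k where "k = \<kappa>' h + \<delta>"
    have k: "k + \<delta> = \<kappa>' (Suc h)"
      using \<mu> by (simp add: k_def \<kappa>'_def \<delta>_def \<mu>_def field_simps)
    define I where "I = cball x0 (\<rho> h)"
    have [measurable]: "I \<in> sets borel" by (simp add: I_def)
    define y where "y x = max 0 (v x - \<kappa>' h)" for x
    have [measurable]: "y \<in> borel_measurable borel" unfolding y_def[abs_def] by measurable
    have yi: "integrable lborel (\<lambda>x. indicator I x * y x powr r)"
      unfolding I_def y_def by (rule intd[OF \<rho>(3,2)])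
    define m where "m x = max 0 (v x - k)" for x
    have [measurable]: "m \<in> borel_measurable borel" unfolding m_def[abs_def] by measurable
    define Z where "Z = (4 * \<mu>) powr r * Y h"
    have Z0: "Z \<ge> 0" using Y0[of h] by (simp add: Z_def)
    have Zint: "(\<integral>x. (4 * \<mu>) powr r * (indicator I x * y x powr r) \<partial>lborel) = Z"
      by (simp add: Z_def Y_def I_def y_def)
    have pw: "m x powr e \<le> (4 * \<mu>) powr r * y x powr r" if "v x > k" "0 \<le> e" "e \<le> r" for x e
    proof -
      have "v x > \<kappa>' h + \<delta>" "v x > \<kappa>' h" using that \<delta> by (auto simp: k_def)
      then show ?thesis
        using truncation_power_le[of \<delta> e r "\<kappa>' h" "v x"] that \<delta>
        by (simp add: m_def y_def k_def \<delta>_def diff_diff_eq max_def)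
    qed
    have bnd: "integrable lborel (\<lambda>x. indicator I x * m x powr e)" "(\<integral>x. indicator I x * m x powr e \<partial>lborel) \<le> Z"
      if e: "0 < e" "e \<le> r" for e
    proof -
      have le: "indicator I x * m x powr e \<le> (4 * \<mu>) powr r * (indicator I x * y x powr r)" for x
        using pw[of x e] e by (cases "v x > k") (auto simp: m_def indicator_def)
      show i: "integrable lborel (\<lambda>x. indicator I x * m x powr e)"
        by (rule Bochner_Integration.integrable_bound[OF integrable_mult_right[OF yi, of "(4 * \<mu>) powr r"]])
           (use le in \<open>auto intro!: AE_I2 order_trans[OF le abs_ge_self]\<close>)
      show "(\<integral>x. indicator I x * m x powr e \<partial>lborel) \<le> Z"
        unfolding Zint[symmetric] by (rule integral_mono[OF i integrable_mult_right[OF yi] le])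
    qed
    define A where "A = {x \<in> I. v x > k}"
    have Ain: "indicator A x = indicator I x * (if v x > k then 1 else (0::real))" for x by (auto simp: A_def indicator_def)
    have Am[measurable]: "A \<in> sets borel"
    proof -
      have "A = I \<inter> {x \<in> space borel. v x > k}" by (auto simp: A_def)
      then show ?thesis by simp
    qed
    \<comment> \<open>Exponent 0 in \<open>pw\<close>: on \<open>A\<close> the base
      \<open>m x\<close> is positive, so its zeroth power is 1.\<close>
    have lA: "indicator A x \<le> (4 * \<mu>) powr r * (indicator I x * y x powr r)" for x
      using pw[of x 0] r by (cases "x \<in> A") (auto simp: A_def m_def)
    have iA: "integrable lborel (indicator A :: 'a \<Rightarrow> real)"
      by (rule Bochner_Integration.integrable_bound[OF integrable_mult_right[OF yi, of "(4 * \<mu>) powr r"]])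
           (use lA in \<open>auto intro!: AE_I2 order_trans[OF lA abs_ge_self]\<close>)
    have AZ: "(\<integral>x. indicator A x \<partial>lborel) \<le> Z"
      unfolding Zint[symmetric] by (rule integral_mono[OF iA integrable_mult_right[OF yi] lA])
    have 1: "(\<integral>x. indicator I x * m x powr p \<partial>lborel) \<le> Z"
      using p by (intro bnd(2)) auto
    have 2: "(\<integral>x. indicator I x * (g x * m x) \<partial>lborel) \<le> g0 * Z powr (1 / q)"
    proof -
      have e: "\<bar>indicator I x * m x\<bar> powr q = indicator I x * m x powr q" for x
        using q by (auto simp: indicator_def m_def)
      have "(\<integral>x. \<bar>g x * (indicator I x * m x)\<bar> \<partial>lborel) \<le> g0 * (\<integral>x. \<bar>indicator I x * m x\<bar> powr q \<partial>lborel) powr (1 / q)"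
        unfolding g0_def
        by (rule Holder_integral(2)) (use q g bnd(1)[of q] p in \<open>auto simp: e divide_simps\<close>)
      also have "\<dots> \<le> g0 * Z powr (1 / q)"
        unfolding e using bnd(2)[of q] p q ga0
        by (intro mult_left_mono powr_mono2) (auto intro!: integral_nonneg_AE simp: m_def)
      also have "(\<integral>x. \<bar>g x * (indicator I x * m x)\<bar> \<partial>lborel) = (\<integral>x. indicator I x * (g x * m x) \<partial>lborel)"
        using g by (intro Bochner_Integration.integral_cong) (auto simp: m_def indicator_def)
      finally show ?thesis .
    qed
    have 3: "(\<integral>x. indicator A x * a x \<partial>lborel) \<le> a0 * Z powr (1 - 1 / \<tau>)"
    proof -
      define \<tau>' where "\<tau>' = \<tau> / (\<tau> - 1)"
      have \<tau>': "\<tau>' > 1" "1 / \<tau> + 1 / \<tau>' = 1" using \<tau> by (auto simp: \<tau>'_def divide_simps)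
      have e: "\<bar>indicator A x\<bar> powr \<tau>' = (indicator A x :: real)" for x
        using \<tau>' by (auto simp: indicator_def)
      have e': "(indicator A x :: real) powr \<tau>' = indicator A x" for x
        using \<tau>' by (auto simp: indicator_def)
      have "(\<integral>x. \<bar>a x * indicator A x\<bar> \<partial>lborel) \<le> a0 * (\<integral>x. \<bar>indicator A x\<bar> powr \<tau>' \<partial>lborel) powr (1 / \<tau>')"
        unfolding a0_def
        by (rule Holder_integral(2)) (use \<tau> \<tau>' a iA in \<open>auto simp: e'\<close>)
      also have "\<dots> \<le> a0 * Z powr (1 / \<tau>')"
        unfolding e using AZ \<tau>' ga0
        by (intro mult_left_mono powr_mono2) (auto intro!: integral_nonneg_AE)
      also have "1 / \<tau>' = 1 - 1 / \<tau>" using \<tau>' by linarith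
      also have "(\<integral>x. \<bar>a x * indicator A x\<bar> \<partial>lborel) = (\<integral>x. indicator A x * a x \<partial>lborel)"
        using a by (intro Bochner_Integration.integral_cong) (auto simp: indicator_def)
      finally show ?thesis .
    qed
    \<comment> \<open>The exponent is raised to 1 on \<open>(4 * \<mu>) powr r \<ge> 1\<close> and
      lowered to \<open>\<kappa>\<close> on \<open>Y h \<le> 1\<close>.\<close>
    have Zk: "Z powr e \<le> 4 powr r * \<mu> powr r * Y h powr \<kappa>" if "\<kappa> \<le> e" "e \<le> 1" for e
    proof -
      have "Z powr e = ((4 * \<mu>) powr r) powr e * Y h powr e"
        using Y0 \<mu> by (simp add: Z_def powr_mult)
      also have "\<dots> \<le> ((4 * \<mu>) powr r) powr 1 * Y h powr \<kappa>"
      proof (rule mult_mono)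
        show "((4 * \<mu>) powr r) powr e \<le> ((4 * \<mu>) powr r) powr 1"
          using that \<mu> r by (intro powr_mono ge_one_powr_ge_zero) auto
        show "Y h powr e \<le> Y h powr \<kappa>"
          using that Y0 Y1 by (intro powr_mono') auto
      qed auto
      also have "((4 * \<mu>) powr r) powr 1 = 4 powr r * \<mu> powr r"
        using \<mu> by (simp add: powr_mult)
      finally show ?thesis .
    qed
    have \<mu>e: "\<mu> powr e * \<mu> powr r \<le> \<mu> powr (p + r)" if "e \<le> p" for e
      using \<mu> that by (simp add: powr_add[symmetric] powr_mono)
    let ?Yk = "Y h powr \<kappa>"
    have E1: "(32 * \<mu> / R) powr p * Z \<le> (32 / R) powr p * 4 powr r * (\<mu> powr (p + r) * ?Yk)"
    proof -
      have "(32 * \<mu> / R) powr p = (32 / R) powr p * \<mu> powr p"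
        using R \<mu> by (simp add: powr_mult[symmetric])
      then have "(32 * \<mu> / R) powr p * Z \<le> (32 / R) powr p * \<mu> powr p * (4 powr r * \<mu> powr r * ?Yk)"
        using Zk[of 1] \<kappa> Z0 by (intro mult_mono) auto
      also have "\<dots> = (32 / R) powr p * 4 powr r * ((\<mu> powr p * \<mu> powr r) * ?Yk)"
        by (simp add: mult_ac)
      also have "\<dots> \<le> (32 / R) powr p * 4 powr r * (\<mu> powr (p + r) * ?Yk)"
        by (intro mult_left_mono mult_right_mono \<mu>e) auto
      finally show ?thesis .
    qed
    have E2: "32 * \<mu> / R * (g0 * Z powr (1 / q)) \<le> 32 / R * (g0 * 4 powr r) * (\<mu> powr (p + r) * ?Yk)"
    proof -
      have "32 * \<mu> / R * (g0 * Z powr (1 / q)) \<le> 32 * \<mu> / R * (g0 * (4 powr r * \<mu> powr r * ?Yk))"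
        using Zk[of "1 / q"] \<kappa> q \<mu> R ga0 by (intro mult_left_mono) auto
      also have "\<dots> = 32 / R * (g0 * 4 powr r) * ((\<mu> powr 1 * \<mu> powr r) * ?Yk)"
        using \<mu> by (simp add: mult_ac)
      also have "\<dots> \<le> 32 / R * (g0 * 4 powr r) * (\<mu> powr (p + r) * ?Yk)"
        using R ga0 p by (intro mult_left_mono mult_right_mono \<mu>e) auto
      finally show ?thesis .
    qed
    have E3: "a0 * Z powr (1 - 1 / \<tau>) \<le> a0 * 4 powr r * (\<mu> powr (p + r) * ?Yk)"
    proof -
      have "a0 * Z powr (1 - 1 / \<tau>) \<le> a0 * (4 powr r * \<mu> powr r * ?Yk)"
        using Zk[of "1 - 1 / \<tau>"] \<kappa> \<tau> ga0 by (intro mult_left_mono) auto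
      also have "\<dots> = a0 * 4 powr r * ((\<mu> powr 0 * \<mu> powr r) * ?Yk)"
        using \<mu> by (simp add: mult_ac)
      also have "\<dots> \<le> a0 * 4 powr r * (\<mu> powr (p + r) * ?Yk)"
        using ga0 p by (intro mult_left_mono mult_right_mono \<mu>e) auto
      finally show ?thesis .
    qed
    have t: "4 / (\<rho> h - \<rho> (Suc h)) = 32 * \<mu> / R"
      using R by (simp add: \<rho>(6) \<mu>_def)
    let ?P = "\<integral>x. indicator I x * m x powr p \<partial>lborel" and ?Q = "\<integral>x. indicator I x * (g x * m x) \<partial>lborel"
      and ?A = "\<integral>x. indicator A x * a x \<partial>lborel"
    have nn: "?P \<ge> 0" "?Q \<ge> 0" "?A \<ge> 0"
      using g a by (auto intro!: integral_nonneg_AE AE_I2 simp: m_def)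
    have "Y (Suc h) = (\<integral>x. indicator (cball x0 (\<rho> (Suc h))) x * max 0 (v x - k - \<delta>) powr r \<partial>lborel)"
      unfolding Y_def k[symmetric] by (simp add: diff_diff_eq)
    also have "\<dots> \<le> C * (2 powr p * ((32 * \<mu> / R) powr p * ?P + 1 / \<nu> * (32 * \<mu> / R * ?Q + ?A))) powr (r / p)"
      using est[OF \<rho>(3) \<rho>(5) \<rho>(4) \<delta>(1), of h k] unfolding t by (simp only: I_def A_def m_def)
    also have "\<dots> \<le> C * (2 powr p * ((32 * \<mu> / R) powr p * Z + 1 / \<nu> * (32 * \<mu> / R * (g0 * Z powr (1 / q)) + a0 * Z powr (1 - 1 / \<tau>)))) powr (r / p)"
      using C \<nu> R \<mu> nn rp
      by (intro mult_left_mono powr_mono2 add_mono 1 2 3 mult_nonneg_nonneg add_nonneg_nonneg) auto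
    also have "\<dots> \<le> C * (2 powr p * ((32 / R) powr p * 4 powr r * (\<mu> powr (p + r) * ?Yk) + 1 / \<nu> * (32 / R * (g0 * 4 powr r) * (\<mu> powr (p + r) * ?Yk) + a0 * 4 powr r * (\<mu> powr (p + r) * ?Yk)))) powr (r / p)"
      using C \<nu> R \<mu> Z0 ga0 rp
      by (intro mult_left_mono powr_mono2 add_mono E1 E2 E3 mult_nonneg_nonneg add_nonneg_nonneg) auto
    also have "2 powr p * ((32 / R) powr p * 4 powr r * (\<mu> powr (p + r) * ?Yk) + 1 / \<nu> * (32 / R * (g0 * 4 powr r) * (\<mu> powr (p + r) * ?Yk) + a0 * 4 powr r * (\<mu> powr (p + r) * ?Yk)))
        = K * (\<mu> powr (p + r) * ?Yk)"
      by (simp only: K_def distrib_right distrib_left mult.assoc)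
    also have "C * (K * (\<mu> powr (p + r) * ?Yk)) powr (r / p) = C2 * \<mu> powr ((p + r) * (r / p)) * Y h powr (\<kappa> * (r / p))"
      by (simp only: C2_def powr_mult powr_powr mult.assoc)
    also have "\<kappa> * (r / p) = 1 + \<delta>0" by (simp add: \<delta>0_def)
    also have "\<mu> powr ((p + r) * (r / p)) = B ^ h"
      by (simp add: \<mu>_def B_def powr_realpow[symmetric] powr_powr mult_ac)
    finally show ?thesis .
  qed
  have "Y 0 \<le> \<epsilon>"
    using d by (simp add: Y_def \<rho>_def \<kappa>'_def f_def)
  then have Yl: "Y \<longlonglongrightarrow> 0"
    by (intro fast Y0 rec)
  let ?T = "\<integral>x. indicator (cball x0 (R / 4)) x * max 0 (v x - (real d + 1)) powr r \<partial>lborel"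
  have Ti: "integrable lborel (\<lambda>x. indicator (cball x0 (R / 4)) x * max 0 (v x - (real d + 1)) powr r)"
    by (rule intd) (use R in auto)
  \<comment> \<open>The limiting ball and level are contained in every stage, so the truncation at
    level \<open>d + 1\<close> has integral 0 on \<open>cball x0 (R / 4)\<close>.\<close>
  have "?T \<le> Y h" for h
    unfolding Y_def
  proof (rule integral_mono[OF Ti intd[OF \<rho>(3,2)]])
    fix x
    show "indicator (cball x0 (R / 4)) x * max 0 (v x - (real d + 1)) powr r \<le> indicator (cball x0 (\<rho> h)) x * max 0 (v x - \<kappa>' h) powr r"
    proof (cases "x \<in> cball x0 (R / 4)")
      case True
      then have "x \<in> cball x0 (\<rho> h)" using \<rho>(1)[of h] by auto
      moreover have "max 0 (v x - (real d + 1)) powr r \<le> max 0 (v x - \<kappa>' h) powr r"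
        using r by (intro powr_mono2 max.mono) (auto simp: \<kappa>'_def)
      ultimately show ?thesis using True by simp
    qed simp
  qed
  then have "?T \<le> 0"
    using LIMSEQ_le_const[OF Yl] by blast
  moreover have "?T \<ge> 0" by (intro integral_nonneg_AE) auto
  ultimately have "?T = 0" by simp
  then have "AE x in lborel. indicator (cball x0 (R / 4)) x * max 0 (v x - (real d + 1)) powr r = 0"
    by (subst (asm) integral_nonneg_eq_0_iff_AE[OF Ti]) auto
  then have "AE x in lborel. x \<in> cball x0 (R / 4) \<longrightarrow> v x \<le> real d + 1"
    by eventually_elim (auto simp: max_def split: if_splits)
  then show ?thesis by (rule that)
qed

text \<open>It remains to choose \<open>r\<close>. It must lie below the critical exponent for the
  Sobolev inequality, and above \<open>p * q\<close> and \<open>p * \<tau> / (\<tau> - 1)\<close>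
  for the gain in the iteration. The last bound is below the critical exponent because
  \<open>\<tau> > n / p\<close>.\<close>

lemma weak_subsolution_upper_bound:
  fixes v a :: "real^'n \<Rightarrow> real" and D G :: "real^'n \<Rightarrow> real^'n"
  defines "n \<equiv> real CARD('n)"
  assumes meas[measurable]: "v \<in> borel_measurable borel" "D \<in> borel_measurable borel"
      "G \<in> borel_measurable borel" "a \<in> borel_measurable borel"
    and v: "integrable lborel (\<lambda>x. \<bar>v x\<bar> powr q)" and D: "integrable lborel (\<lambda>x. norm (D x) powr q)"
    and G: "integrable lborel (\<lambda>x. norm (G x) powr (q / (q - 1)))"
    and a: "integrable lborel (\<lambda>x. \<bar>a x\<bar> powr \<tau>)" "\<And>x. 0 \<le> a x"
    and v0: "\<And>x. x \<notin> cball x0 R \<Longrightarrow> v x = 0" and D0: "\<And>x. x \<notin> cball x0 R \<Longrightarrow> D x = 0"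
    and a0: "\<And>x. x \<notin> cball x0 R \<Longrightarrow> a x = 0"
    and weak: "\<And>\<phi> i. \<phi> \<in> test_functions (ball x0 R) \<Longrightarrow>
        (\<integral>x. v x * partial_deriv i \<phi> x \<partial>lborel) = - (\<integral>x. D x $ i * \<phi> x \<partial>lborel)"
    and eq: "\<And>\<phi>. \<phi> \<in> test_functions (ball x0 R) \<Longrightarrow> (\<integral>x. G x \<bullet> gradient \<phi> x \<partial>lborel) = 0"
    and ell: "AE x in lborel. x \<in> ball x0 R \<longrightarrow> \<nu> * norm (D x) powr p - a x \<le> G x \<bullet> D x"
    and \<nu>: "\<nu> > 0" and p: "1 < p" "p < n" "p \<le> q" and q: "p * q < n * p / (n - p)" and \<tau>: "\<tau> > n / p"
    and R: "0 < R" "R \<le> 1/2"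
  shows "\<exists>N. AE x in lborel. x \<in> cball x0 (R / 4) \<longrightarrow> v x \<le> N"
proof -
  have "1 < n / p" using p by simp
  then have \<tau>1: "\<tau> > 1" using \<tau> by linarith
  have "p * \<tau> / (\<tau> - 1) < n * p / (n - p)"
  proof -
    have "n < p * \<tau>" using \<tau> p by (simp add: field_simps)
    then have "p * (\<tau> * (n - p)) < p * (n * (\<tau> - 1))"
      using p by (intro mult_strict_left_mono) (auto simp: algebra_simps)
    then show ?thesis using p \<tau>1 by (simp add: field_simps)
  qed
  then have "max (p * q) (p * \<tau> / (\<tau> - 1)) < n * p / (n - p)" using q by simp
  then obtain r where r: "max (p * q) (p * \<tau> / (\<tau> - 1)) < r" "r < n * p / (n - p)"
    using dense by blast
  have q1: "q > 1" using p by simp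
  have rq: "p * q < r" using r by simp
  have qr: "q < r"
  proof -
    have "1 * q < p * q" using p q1 by (intro mult_strict_right_mono) auto
    then show ?thesis using rq by simp
  qed
  have pr: "p < r" using qr p by simp
  have r\<tau>: "(1 - 1 / \<tau>) * r > p"
    using r(1) \<tau>1 by (simp add: field_simps)
  have sub: "real CARD('n) * (1 - p / r) < p"
  proof -
    have "r * (n - p) < n * p" using r(2) p by (simp add: field_simps)
    then have "n * (r - p) < p * r" by (simp add: algebra_simps)
    then show ?thesis using pr p by (simp add: n_def field_simps)
  qed
  obtain C where C: "C > 0" and sob: "\<And>(w :: real^'n \<Rightarrow> real) x0. smooth w \<Longrightarrow> (\<And>x. x \<notin> cball x0 (1/2) \<Longrightarrow> w x = 0) \<Longrightarrow>
    (\<integral>x. \<bar>w x\<bar> powr r \<partial>lborel) \<le> C * (\<integral>x. norm (gradient w x) powr p \<partial>lborel) powr (r / p)"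
    using subcritical_sobolev[OF less_imp_le[OF p(1)] pr sub] by blast
  have ai: "integrable lborel a"
    by (rule integrable_of_powr_bounded_support1[OF meas(4) a(1)]; (rule a0 less_imp_le[OF \<tau>1] | assumption)+)
  note est = truncation_estimate[where v = v and D = D and G = G and a = a and q = q and R = R
      and \<nu> = \<nu> and p = p and C = C and r = r]
  note facts = meas v D G ai a(2) v0 D0 weak eq ell \<nu> p(1,3) pr C R(2) sob
  show ?thesis
  proof (rule de_giorgi_iteration[where v = v and g = "\<lambda>x. norm (G x)" and a = a and R = R
        and C = "exp (2 * r) * C" and p = p and q = q and r = r and \<tau> = \<tau> and \<nu> = \<nu>])
    show "integrable lborel (\<lambda>x. indicator (cball x0 s) x * max 0 (v x - k - \<delta>) powr r)"
      if "0 \<le> s" "s < t" "t < R" "\<delta> > 0" for k \<delta> s t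
      by (rule est(1); (rule facts that | assumption)+)
    show "(\<integral>x. indicator (cball x0 s) x * max 0 (v x - k - \<delta>) powr r \<partial>lborel) \<le>
      exp (2 * r) * C * (2 powr p * ((4 / (t - s)) powr p * (\<integral>x. indicator (cball x0 t) x * max 0 (v x - k) powr p \<partial>lborel)
       + 1 / \<nu> * (4 / (t - s) * (\<integral>x. indicator (cball x0 t) x * (norm (G x) * max 0 (v x - k)) \<partial>lborel)
          + (\<integral>x. indicator {x \<in> cball x0 t. v x > k} x * a x \<partial>lborel)))) powr (r / p)"
      if "0 \<le> s" "s < t" "t < R" "\<delta> > 0" for k \<delta> s t
      by (rule est(2); (rule facts that | assumption)+)
    show ?thesis if "AE x in lborel. x \<in> cball x0 (R / 4) \<longrightarrow> v x \<le> N" for N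
      using that by (rule exI)
  qed (use p qr \<tau>1 rq r\<tau> C R \<nu> G a in auto)
qed

subsection \<open>Passing from Lebesgue to Borel measurable representatives\<close>

text \<open>The hypotheses speak of \<open>lebesgue_on\<close>, while Fubini, translation and
  mollification are carried out in \<open>lborel\<close>. A Borel representative extended by zero
  mediates between the two.\<close>

lemma borel_version:
  fixes f :: "'a::euclidean_space \<Rightarrow> real"
  assumes f: "f \<in> borel_measurable (lebesgue_on K)" and K: "K \<in> sets borel"
  obtains g where "g \<in> borel_measurable borel" "\<And>x. x \<notin> K \<Longrightarrow> g x = 0" "AE x in lborel. x \<in> K \<longrightarrow> g x = f x"
proof -
  have "(\<lambda>x. if x \<in> K then f x else 0) \<in> borel_measurable lebesgue"
    using f K by (intro borel_measurable_if_I) auto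
  then obtain g where g: "g \<in> borel_measurable lborel" "AE x in lborel. (if x \<in> K then f x else 0) = g x"
    using completion_ex_borel_measurable_real by blast
  show ?thesis
  proof (rule that[of "\<lambda>x. indicator K x * g x"])
    show "(\<lambda>x. indicator K x * g x) \<in> borel_measurable borel"
      using g(1) K by simp
    show "AE x in lborel. x \<in> K \<longrightarrow> indicator K x * g x = f x"
      using g(2) by eventually_elim auto
  qed auto
qed

lemma borel_version_vec:
  fixes f :: "'a::euclidean_space \<Rightarrow> real^'n"
  assumes f: "\<And>i. (\<lambda>x. f x $ i) \<in> borel_measurable (lebesgue_on K)" and K: "K \<in> sets borel"
  obtains g where "g \<in> borel_measurable borel" "\<And>x. x \<notin> K \<Longrightarrow> g x = 0" "AE x in lborel. x \<in> K \<longrightarrow> g x = f x"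
proof -
  have "\<forall>i. \<exists>g. g \<in> borel_measurable borel \<and> (\<forall>x. x \<notin> K \<longrightarrow> g x = 0) \<and> (AE x in lborel. x \<in> K \<longrightarrow> g x = f x $ i)"
  proof
    show "\<exists>g. g \<in> borel_measurable borel \<and> (\<forall>x. x \<notin> K \<longrightarrow> g x = 0) \<and> (AE x in lborel. x \<in> K \<longrightarrow> g x = f x $ i)" for i
      by (rule borel_version[OF f[of i] K]) blast
  qed
  from choice[OF this] obtain g where g: "\<forall>i. g i \<in> borel_measurable borel \<and> (\<forall>x. x \<notin> K \<longrightarrow> g i x = 0) \<and> (AE x in lborel. x \<in> K \<longrightarrow> g i x = f x $ i)"
    by (rule exE)
  show ?thesis
  proof (rule that[of "\<lambda>x. \<chi> i. g i x"])
    show "(\<lambda>x. \<chi> i. g i x) \<in> borel_measurable borel"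
      using g by (subst borel_measurable_euclidean_space) (auto simp: Basis_vec_def inner_axis)
    show "(\<chi> i. g i x) = 0" if "x \<notin> K" for x
      using g that by (simp add: vec_eq_iff)
    have "AE x in lborel. \<forall>i. x \<in> K \<longrightarrow> g i x = f x $ i"
      using g by (intro eventually_all_finite) auto
    then show "AE x in lborel. x \<in> K \<longrightarrow> (\<chi> i. g i x) = f x"
      by eventually_elim (auto simp: vec_eq_iff)
  qed
qed

lemma borel_measurable_lebesgue_AE:
  fixes f g :: "'a::euclidean_space \<Rightarrow> 'b::topological_space"
  assumes g: "g \<in> borel_measurable lebesgue" and ae: "AE x in lebesgue. f x = g x"
  shows "f \<in> borel_measurable lebesgue"
proof (rule measurableI)
  fix A :: "'b set" assume A: "A \<in> sets borel"
  show "f -` A \<inter> space lebesgue \<in> sets lebesgue"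
  proof (rule completion.in_sets_AE)
    show "g -` A \<inter> space lebesgue \<in> sets lebesgue"
      using measurable_sets[OF g A] .
    show "AE x in lebesgue. (x \<in> g -` A \<inter> space lebesgue) = (x \<in> f -` A \<inter> space lebesgue)"
      using ae by eventually_elim auto
  qed auto
qed auto

text \<open>Measurability of \<open>h\<close> on \<open>K\<close> is not assumed: it follows from
  the almost everywhere equality with the Borel function \<open>g\<close>, since Lebesgue measure is
  complete.\<close>

lemma lebesgue_on_eq_lborel:
  fixes h g :: "'a::euclidean_space \<Rightarrow> real"
  assumes K: "K \<in> sets borel" and g: "g \<in> borel_measurable borel"
    and ae: "AE x in lborel. g x = indicator K x * h x"
  shows "integrable (lebesgue_on K) h \<longleftrightarrow> integrable lborel g" "(\<integral>x. h x \<partial>lebesgue_on K) = (\<integral>x. g x \<partial>lborel)"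
proof -
  have K': "K \<inter> space lebesgue \<in> sets lebesgue" using K by simp
  have gl: "g \<in> borel_measurable lebesgue" using g by (simp add: measurable_completion)
  have ae': "AE x in lebesgue. indicator K x *\<^sub>R h x = g x"
    using AE_completion[OF ae] by eventually_elim simp
  have hm: "(\<lambda>x. indicator K x *\<^sub>R h x) \<in> borel_measurable lebesgue"
    by (rule borel_measurable_lebesgue_AE[OF gl ae'])
  have "integrable (lebesgue_on K) h \<longleftrightarrow> integrable lebesgue (\<lambda>x. indicator K x *\<^sub>R h x)"
    by (rule integrable_restrict_space[OF K'])
  also have "\<dots> \<longleftrightarrow> integrable lebesgue g"
    by (rule integrable_cong_AE[OF hm gl ae'])
  also have "\<dots> \<longleftrightarrow> integrable lborel g"
    using g by (intro integrable_completion) simp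
  finally show "integrable (lebesgue_on K) h \<longleftrightarrow> integrable lborel g" .
  have "(\<integral>x. h x \<partial>lebesgue_on K) = (\<integral>x. indicator K x *\<^sub>R h x \<partial>lebesgue)"
    by (rule integral_restrict_space[OF K'])
  also have "\<dots> = (\<integral>x. g x \<partial>lebesgue)"
    by (rule integral_cong_AE[OF hm gl ae'])
  also have "\<dots> = (\<integral>x. g x \<partial>lborel)"
    using g by (intro integral_completion) simp
  finally show "(\<integral>x. h x \<partial>lebesgue_on K) = (\<integral>x. g x \<partial>lborel)" .
qed

text \<open>For a simple function in place of \<open>g\<close> the composition is a finite sum of
  measurable functions; continuity in the second argument passes to the limit. As continuity holds
  only almost everywhere, the result is a measurable version of the composition.\<close>

lemma caratheodory_composition:
  fixes f :: "'a \<Rightarrow> 'b::{metric_space, second_countable_topology} \<Rightarrow> real"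
  assumes f: "\<And>z. (\<lambda>x. f x z) \<in> borel_measurable M" and c: "AE x in M. continuous_on UNIV (f x)"
    and g: "g \<in> borel_measurable M"
  obtains h where "h \<in> borel_measurable M" "AE x in M. h x = f x (g x)"
proof -
  obtain F where F: "\<And>i. simple_function M (F i)" "\<And>x. x \<in> space M \<Longrightarrow> (\<lambda>i. F i x) \<longlonglongrightarrow> g x"
    using borel_measurable_implies_sequence_metric[OF g, of undefined] by blast
  have fF: "(\<lambda>x. f x (F i x)) \<in> borel_measurable M" for i
  proof -
    have fin: "finite (F i ` space M)" using F(1)[of i] by (rule simple_functionD)
    have "(\<lambda>x. \<Sum>z\<in>F i ` space M. indicator (F i -` {z} \<inter> space M) x * f x z) \<in> borel_measurable M"
      using simple_functionD(2)[OF F(1)[of i]] f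
      by (intro borel_measurable_sum borel_measurable_times borel_measurable_indicator) auto
    moreover have "(\<Sum>z\<in>F i ` space M. indicator (F i -` {z} \<inter> space M) x * f x z) = f x (F i x)" if "x \<in> space M" for x
    proof -
      have "(\<Sum>z\<in>F i ` space M. indicator (F i -` {z} \<inter> space M) x * f x z) = (\<Sum>z\<in>F i ` space M. if z = F i x then f x (F i x) else 0)"
        using that by (intro sum.cong) (auto simp: indicator_def)
      then show ?thesis using fin that by simp
    qed
    ultimately show ?thesis
      by (subst measurable_cong[where g = "\<lambda>x. \<Sum>z\<in>F i ` space M. indicator (F i -` {z} \<inter> space M) x * f x z"]) auto
  qed
  show ?thesis
  proof (rule that[of "\<lambda>x. lim (\<lambda>i. f x (F i x))"])
    show "(\<lambda>x. lim (\<lambda>i. f x (F i x))) \<in> borel_measurable M"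
      by (rule borel_measurable_lim_metric[OF fF])
    show "AE x in M. lim (\<lambda>i. f x (F i x)) = f x (g x)"
      using c AE_space
    proof eventually_elim
      case (elim x)
      have "(\<lambda>i. f x (F i x)) \<longlonglongrightarrow> f x (g x)"
        by (rule continuous_on_tendsto_compose[OF elim(1) F(2)[OF elim(2)]]) auto
      then show ?case by (rule limI)
    qed
  qed
qed

text \<open>On a set of finite measure a lower power is controlled by
  \<open>1 + norm (f x) powr t\<close>, or by a constant when \<open>r\<close> is infinite. It lets
  real exponents replace the extended ones \<open>\<tau>1\<close> and
  \<open>\<tau>2\<close>.\<close>

lemma Lp_on_imp_integrable_powr:
  fixes f :: "real^'n \<Rightarrow> 'b::euclidean_space"
  assumes f: "f \<in> Lp_on r K" and K: "compact K" and s: "0 < s" "ereal s \<le> r"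
  shows "integrable (lebesgue_on K) (\<lambda>x. norm (f x) powr s)"
proof -
  have [measurable]: "f \<in> borel_measurable (lebesgue_on K)" using f by (simp add: Lp_on_def)
  interpret finite_measure "lebesgue_on K"
    by (intro finite_measure_lebesgue_on lmeasurable_compact K)
  have c: "integrable (lebesgue_on K) (\<lambda>x. c)" for c :: real
    by (rule integrable_const)
  show ?thesis
  proof (cases r)
    case (real t)
    then have t: "s \<le> t" "integrable (lebesgue_on K) (\<lambda>x. norm (f x) powr t)"
      using f s by (simp_all add: Lp_on_def)
    have le: "norm (f x) powr s \<le> 1 + norm (f x) powr t" for x
      by (rule powr_le_one_plus_powr) (use s t in auto)
    show ?thesis
    proof (rule Bochner_Integration.integrable_bound)
      show "integrable (lebesgue_on K) (\<lambda>x. 1 + norm (f x) powr t)"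
        by (rule Bochner_Integration.integrable_add[OF c t(2)])
      show "AE x in lebesgue_on K. norm (norm (f x) powr s) \<le> norm (1 + norm (f x) powr t)"
      proof (rule AE_I2)
        fix x
        have "\<bar>norm (f x) powr s\<bar> = norm (f x) powr s" by (rule abs_of_nonneg[OF powr_ge_zero])
        also note le[of x]
        also have "1 + norm (f x) powr t \<le> \<bar>1 + norm (f x) powr t\<bar>" by (rule abs_ge_self)
        finally show "norm (norm (f x) powr s) \<le> norm (1 + norm (f x) powr t)"
          by (simp only: real_norm_def)
      qed
      show "(\<lambda>x. norm (f x) powr s) \<in> borel_measurable (lebesgue_on K)"
        by measurable
    qed
  next
    case PInf
    obtain C where C: "AE x in lebesgue_on K. norm (f x) \<le> C"
      using f unfolding Lp_on_def PInf infinity_ereal_def mem_Collect_eq ereal.case by blast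
    show ?thesis
    proof (rule Bochner_Integration.integrable_bound[OF c[of "\<bar>C\<bar> powr s"]])
      show "AE x in lebesgue_on K. norm (norm (f x) powr s) \<le> norm (\<bar>C\<bar> powr s)"
        using C
      proof eventually_elim
        case (elim x)
        have "norm (f x) powr s \<le> \<bar>C\<bar> powr s"
          by (rule powr_mono2) (use s(1) elim in linarith, rule norm_ge_zero, use elim in linarith)
        then show ?case
          by (simp only: real_norm_def abs_of_nonneg[OF powr_ge_zero])
      qed
      show "(\<lambda>x. norm (f x) powr s) \<in> borel_measurable (lebesgue_on K)"
        by measurable
    qed
  next
    case MInf
    then show ?thesis using s by simp
  qed
qed

subsection \<open>Test functions for the system\<close>

lemma continuous_compact_support_Lp_on:
  fixes f :: "real^'n \<Rightarrow> 'b::euclidean_space"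
  assumes f: "continuous_on UNIV f" "compact K" "\<And>x. x \<notin> K \<Longrightarrow> f x = 0" and S: "S \<in> sets borel" and s: "s > 0"
  shows "f \<in> Lp_on (ereal s) S"
proof -
  have fm: "f \<in> borel_measurable borel" by (rule borel_measurable_continuous_onI[OF f(1)])
  have m: "f \<in> borel_measurable (lebesgue_on S)"
    using fm by (intro measurable_restrict_space1) (simp add: measurable_completion)
  have c: "continuous_on UNIV (\<lambda>x. norm (f x) powr s)"
    using s by (intro continuous_on_powr' continuous_on_norm f(1) continuous_on_const) auto
  have i: "integrable lborel (\<lambda>x. norm (f x) powr s)"
    using s f(3) by (intro continuous_compact_support_integrable[OF c f(2)]) auto
  have "integrable lborel (\<lambda>x. indicator S x * norm (f x) powr s)"
    using S by (intro integrable_bounded_mult[OF i, where B = 1]) (auto simp: indicator_def)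
  then have "integrable (lebesgue_on S) (\<lambda>x. norm (f x) powr s)"
    using S fm by (subst lebesgue_on_eq_lborel(1)[where g = "\<lambda>x. indicator S x * norm (f x) powr s"]) auto
  then show ?thesis using m by (simp add: Lp_on_def)
qed

lemma jacobian_axis:
  fixes \<phi> :: "real^'n \<Rightarrow> real"
  assumes "smooth \<phi>"
  shows "jacobian (\<lambda>x. axis \<alpha> (\<phi> x) :: real^'m) (at x) = axis \<alpha> (gradient \<phi> x)"
proof -
  have e: "axis \<alpha> t = t *\<^sub>R (axis \<alpha> 1 :: real^'m)" for t :: real
    by (simp add: vec_eq_iff axis_def)
  have "((\<lambda>x. \<phi> x *\<^sub>R (axis \<alpha> 1 :: real^'m)) has_derivative (\<lambda>h. (gradient \<phi> x \<bullet> h) *\<^sub>R axis \<alpha> 1)) (at x)"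
    by (intro has_derivative_scaleR_left smooth_has_derivative assms)
  then have "((\<lambda>x. axis \<alpha> (\<phi> x) :: real^'m) has_derivative (\<lambda>h. axis \<alpha> (gradient \<phi> x \<bullet> h))) (at x)"
    unfolding e[symmetric] .
  then have "frechet_derivative (\<lambda>x. axis \<alpha> (\<phi> x) :: real^'m) (at x) = (\<lambda>h. axis \<alpha> (gradient \<phi> x \<bullet> h))"
    by (rule frechet_derivative_at[symmetric])
  then show ?thesis
    by (simp add: jacobian_def matrix_def vec_eq_iff inner_axis) (simp add: axis_def)
qed

lemma integral_lebesgue_on_support:
  fixes f :: "real^'n \<Rightarrow> real"
  assumes "f \<in> borel_measurable borel" "B \<in> sets borel" "\<And>x. x \<notin> B \<Longrightarrow> f x = 0"
  shows "(\<integral>x. f x \<partial>lebesgue_on B) = (\<integral>x. f x \<partial>lborel)"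
  using assms by (intro lebesgue_on_eq_lborel(2)) (auto simp: indicator_def)

text \<open>The approximating sequence required by \<open>W1_0\<close> is constant, and the weak
  gradient is the classical one by integration by parts. This makes a test function in a single
  component admissible for the system.\<close>

lemma W1_0_test_function:
  fixes \<phi> :: "real^'n \<Rightarrow> real"
  assumes \<phi>: "\<phi> \<in> test_functions B" and B: "open B" and q: "q \<ge> 1"
  shows "W1_0 q B (\<lambda>x. axis \<alpha> (\<phi> x) :: real^'m) (\<lambda>x. axis \<alpha> (gradient \<phi> x))"
proof -
  let ?\<psi> = "\<lambda>x. axis \<alpha> (\<phi> x) :: real^'m" and ?D = "\<lambda>x. axis \<alpha> (gradient \<phi> x) :: real^'n^'m"
  have sm: "smooth \<phi>" by (rule test_functions_smooth[OF \<phi>])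
  have ax: "axis \<alpha> y $ \<beta> = (if \<beta> = \<alpha> then y else 0)" for y :: "'b::zero" and \<beta> :: 'm
    by (simp add: axis_def)
  obtain K where K: "compact K" "K \<subseteq> B" "\<And>x. x \<notin> K \<Longrightarrow> \<phi> x = 0" "\<And>x. x \<notin> K \<Longrightarrow> gradient \<phi> x = 0"
    using test_function_compact_support[OF \<phi>] by metis
  have "continuous_on UNIV (\<lambda>x. if \<beta> = \<alpha> then \<phi> x else 0)" for \<beta>
    by (cases "\<beta> = \<alpha>") (simp_all add: smooth_continuous_on[OF sm])
  then have c1: "continuous_on UNIV ?\<psi>"
    unfolding axis_def by (rule continuous_on_vec_lambda)
  have "continuous_on UNIV (\<lambda>x. if \<beta> = \<alpha> then gradient \<phi> x else 0)" for \<beta>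
    by (cases "\<beta> = \<alpha>") (simp_all add: smooth_continuous_gradient[OF sm])
  then have c2: "continuous_on UNIV ?D"
    unfolding axis_def by (rule continuous_on_vec_lambda)
  have z1: "?\<psi> x = 0" if "x \<notin> K" for x using K(3)[OF that] by (simp add: vec_eq_iff ax)
  have z2: "?D x = 0" if "x \<notin> K" for x using K(4)[OF that] by (simp add: vec_eq_iff ax)
  have L1: "?\<psi> \<in> Lp_on (ereal s) S" and L2: "?D \<in> Lp_on (ereal s) S" if "S \<in> sets borel" "s > 0" for s S
    by (rule continuous_compact_support_Lp_on[OF c1 K(1) z1 that] continuous_compact_support_Lp_on[OF c2 K(1) z2 that]; assumption)+
  have loc: "?\<psi> \<in> Lp_loc 1 B" "?D \<in> Lp_loc 1 B"
    unfolding Lp_loc_def one_ereal_def using L1[of _ 1] L2[of _ 1]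
    by (auto intro: borel_compact)
  have weak: "(\<integral>x. ?\<psi> x $ \<beta> * partial_deriv i \<zeta> x \<partial>lebesgue_on B) = - (\<integral>x. ?D x $ \<beta> $ i * \<zeta> x \<partial>lebesgue_on B)"
    if \<zeta>: "\<zeta> \<in> test_functions B" for \<zeta> \<beta> i
  proof (cases "\<beta> = \<alpha>")
    case True
    note [measurable] = test_function_measurable(1)[OF \<phi>] test_function_measurable(1)[OF \<zeta>]
      test_function_measurable(1)[OF test_functions_partial_deriv[OF \<phi>]]
      test_function_measurable(1)[OF test_functions_partial_deriv[OF \<zeta>]]
    have "(\<integral>x. \<phi> x * partial_deriv i \<zeta> x \<partial>lebesgue_on B) = (\<integral>x. \<phi> x * partial_deriv i \<zeta> x \<partial>lborel)"
      using K B by (intro integral_lebesgue_on_support) auto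
    moreover have "(\<integral>x. partial_deriv i \<phi> x * \<zeta> x \<partial>lebesgue_on B) = (\<integral>x. partial_deriv i \<phi> x * \<zeta> x \<partial>lborel)"
    proof (intro integral_lebesgue_on_support)
      show "partial_deriv i \<phi> x * \<zeta> x = 0" if "x \<notin> B" for x
      proof -
        have "x \<notin> K" using that K(2) by blast
        then show ?thesis by (simp add: partial_deriv_gradient K(4))
      qed
    qed (use B in auto)
    ultimately show ?thesis
      using True integration_by_parts_test_function[OF \<zeta> sm, of i] by (simp add: ax partial_deriv_gradient)
  qed (simp add: ax)
  have "smooth (\<lambda>x::real^'n. 0)" by (rule smooth_const)
  then have t0: "(\<lambda>x. 0) \<in> test_functions B"
    using K by (intro test_functionsI[of _ K]) auto
  have t: "(\<lambda>x. ?\<psi> x $ \<beta>) \<in> test_functions B" for \<beta>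
    using \<phi> t0 by (cases "\<beta> = \<alpha>") (simp_all add: ax)
  have "W1 q B ?\<psi> ?D"
    unfolding W1_def has_weak_gradient_def using loc weak L1 L2 B q by auto
  moreover have "Lp_norm q B (\<lambda>x. ?\<psi> x - ?\<psi> x) = 0" "Lp_norm q B (\<lambda>x. jacobian ?\<psi> (at x) - ?D x) = 0"
    by (simp_all add: Lp_norm_def jacobian_axis[OF sm])
  ultimately show ?thesis
    unfolding W1_0_def using t by (intro conjI exI[of _ "\<lambda>_. ?\<psi>"]) simp_all
qed

lemma version_integrable_powr:
  fixes f g :: "real^'n \<Rightarrow> real"
  assumes K: "K \<in> sets borel" and g: "g \<in> borel_measurable borel" and z: "\<And>x. x \<notin> K \<Longrightarrow> g x = 0"
    and ae: "AE x in lborel. x \<in> K \<longrightarrow> g x = f x" and f: "integrable (lebesgue_on K) (\<lambda>x. \<bar>f x\<bar> powr s)" and s: "s > 0"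
  shows "integrable lborel (\<lambda>x. \<bar>g x\<bar> powr s)"
proof -
  have "AE x in lborel. \<bar>g x\<bar> powr s = indicator K x * \<bar>f x\<bar> powr s"
    using ae by eventually_elim (use z s in \<open>auto simp: indicator_def\<close>)
  then show ?thesis
    using f g by (subst (asm) lebesgue_on_eq_lborel(1)[OF K, where g = "\<lambda>x. \<bar>g x\<bar> powr s"]) auto
qed

text \<open>The sign \<open>\<sigma> = 1\<close> or \<open>\<sigma> = -1\<close> treats the bounds
  for \<open>u $ \<alpha>\<close> from above and below at once. Function, gradient and flux are all
  multiplied by \<open>\<sigma>\<close>; the equation is linear in the flux, and the product of flux
  and gradient in the ellipticity condition only sees
  \<open>\<sigma> * \<sigma> = 1\<close>.\<close>

lemma component_upper_bound:
  fixes \<Omega> :: "(real^'n) set" and A :: "'n \<Rightarrow> real^'n \<Rightarrow> real^'n^'m \<Rightarrow> real"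
    and u :: "real^'n \<Rightarrow> real^'m" and Du :: "real^'n \<Rightarrow> real^'n^'m" and a b :: "real^'n \<Rightarrow> real"
    and p q \<nu> M n \<sigma> :: real and \<tau>1 \<tau>2 :: ereal
  defines "n \<equiv> real CARD('n)"
  assumes \<Omega>: "open \<Omega>" and p: "1 < p" "p < n" "p \<le> q"
    and q: "p * q < n * p / (n - p)"
    and \<tau>: "\<tau>1 > ereal (n / p)" "\<tau>2 \<ge> ereal (q / (q - 1))"
    and car: "\<And>i. caratheodory \<Omega> (A i)"
    and \<nu>: "\<nu> > 0" and M: "M > 0"
    and a0: "\<And>x. x \<in> \<Omega> \<Longrightarrow> a x \<ge> 0" and b0: "\<And>x. x \<in> \<Omega> \<Longrightarrow> b x \<ge> 0"
    and a: "a \<in> Lp_loc \<tau>1 \<Omega>" and b: "b \<in> Lp_loc \<tau>2 \<Omega>"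
    and ell: "\<And>x z. x \<in> \<Omega> \<Longrightarrow> \<nu> * norm (z $ \<alpha>) powr p - a x \<le> (\<Sum>i\<in>UNIV. A i x z * z $ \<alpha> $ i)"
    and grow: "\<And>x z. x \<in> \<Omega> \<Longrightarrow> (\<Sum>i\<in>UNIV. \<bar>A i x z\<bar>) \<le> M * (norm z powr (q - 1) + b x)"
    and u: "W1_loc q \<Omega> u Du"
    and eq: "\<And>B \<phi>. open B \<Longrightarrow> compactly_contained B \<Omega> \<Longrightarrow> \<phi> \<in> test_functions B \<Longrightarrow>
      (\<integral>x. (\<Sum>i\<in>UNIV. A i x (Du x) * gradient \<phi> x $ i) \<partial>lebesgue_on B) = 0"
    and \<sigma>: "\<sigma> * \<sigma> = 1"
    and R: "0 < R" "R \<le> 1/2" "cball x0 R \<subseteq> \<Omega>"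
  shows "\<exists>N. AE x in lborel. x \<in> cball x0 (R / 4) \<longrightarrow> \<sigma> * u x $ \<alpha> \<le> N"
proof -
  define K where "K = cball x0 R"
  have K: "compact K" "K \<subseteq> \<Omega>" "K \<in> sets borel" using R by (auto simp: K_def)
  have q1: "q > 1" using p by simp
  have \<sigma>a: "\<bar>\<sigma>\<bar> = 1" using \<sigma> by (metis abs_mult_self_eq abs_1 power2_eq_1_iff power2_eq_square abs_minus_cancel)
  have ulp: "u \<in> Lp_on (ereal q) K" and Dulp: "Du \<in> Lp_on (ereal q) K"
    and alp: "a \<in> Lp_on \<tau>1 K" and blp: "b \<in> Lp_on \<tau>2 K"
    using u a b K by (auto simp: W1_loc_def Lp_loc_def)
  have um: "u \<in> borel_measurable (lebesgue_on K)" and Dum: "Du \<in> borel_measurable (lebesgue_on K)"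
    and am: "a \<in> borel_measurable (lebesgue_on K)" and bm: "b \<in> borel_measurable (lebesgue_on K)"
    using ulp Dulp alp blp by (auto simp: Lp_on_def)
  have nth: "(\<lambda>x. f x $ i) \<in> borel_measurable N" if "f \<in> borel_measurable N" for f :: "real^'n \<Rightarrow> 'c::euclidean_space^'d" and i N
    by (rule measurable_compose[OF that borel_measurable_continuous_onI]) (intro continuous_intros)
  obtain s where s: "n / p < s" "ereal s \<le> \<tau>1"
  proof (cases \<tau>1)
    case (real t)
    then show ?thesis using that[of t] \<tau>(1) by simp
  next
    case PInf
    then show ?thesis using that[of "n / p + 1"] by simp
  next
    case MInf
    then show ?thesis using \<tau>(1) by simp
  qed
  have "1 < n / p" using p by simp
  then have s0: "s > 0" using s by linarith
  obtain v where v: "v \<in> borel_measurable borel" "\<And>x. x \<notin> K \<Longrightarrow> v x = 0" "AE x in lborel. x \<in> K \<longrightarrow> v x = \<sigma> * u x $ \<alpha>"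
    using borel_version[OF borel_measurable_times[OF borel_measurable_const nth[OF um]] K(3)] by blast
  obtain D where D: "D \<in> borel_measurable borel" "\<And>x. x \<notin> K \<Longrightarrow> D x = 0" "AE x in lborel. x \<in> K \<longrightarrow> D x = \<sigma> *\<^sub>R Du x $ \<alpha>"
    by (rule borel_version_vec[of "\<lambda>x. \<sigma> *\<^sub>R Du x $ \<alpha>", OF _ K(3)])
       (use nth[OF nth[OF Dum]] in \<open>auto\<close>)
  obtain a' where a': "a' \<in> borel_measurable borel" "\<And>x. x \<notin> K \<Longrightarrow> a' x = 0" "AE x in lborel. x \<in> K \<longrightarrow> a' x = a x"
    using borel_version[OF am K(3)] by blast
  obtain b' where b': "b' \<in> borel_measurable borel" "\<And>x. x \<notin> K \<Longrightarrow> b' x = 0" "AE x in lborel. x \<in> K \<longrightarrow> b' x = b x"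
    using borel_version[OF bm K(3)] by blast
  \<comment> \<open>The norm of the full matrix is needed in addition to row \<alpha>, since the
    growth condition on \<open>A\<close> involves all components.\<close>
  obtain d where d: "d \<in> borel_measurable borel" "\<And>x. x \<notin> K \<Longrightarrow> d x = 0" "AE x in lborel. x \<in> K \<longrightarrow> d x = norm (Du x)"
    using borel_version[OF measurable_compose[OF Dum borel_measurable_norm] K(3)] by blast
  have "\<exists>g. g \<in> borel_measurable borel \<and> (\<forall>x. x \<notin> K \<longrightarrow> g x = 0) \<and> (AE x in lborel. x \<in> K \<longrightarrow> g x = A i x (Du x))" for i
  proof -
    have "(\<lambda>x. A i x z) \<in> borel_measurable (lebesgue_on K)" for z
      using car[of i] K(2) by (auto simp: caratheodory_def intro: measurable_restrict_mono)
    moreover have "AE x in lebesgue_on K. continuous_on UNIV (A i x)"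
    proof -
      have "AE x in lebesgue. x \<in> \<Omega> \<longrightarrow> continuous_on UNIV (A i x)"
        using car[of i] \<Omega> by (simp add: caratheodory_def AE_restrict_space_iff)
      then have "AE x in lebesgue. x \<in> K \<longrightarrow> continuous_on UNIV (A i x)"
        by eventually_elim (use K in auto)
      then show ?thesis using K by (simp add: AE_restrict_space_iff)
    qed
    ultimately obtain h where h: "h \<in> borel_measurable (lebesgue_on K)" "AE x in lebesgue_on K. h x = A i x (Du x)"
      using caratheodory_composition[OF _ _ Dum, of "A i"] by blast
    obtain g where g: "g \<in> borel_measurable borel" "\<And>x. x \<notin> K \<Longrightarrow> g x = 0" "AE x in lborel. x \<in> K \<longrightarrow> g x = h x"
      using borel_version[OF h(1) K(3)] by blast
    have "AE x in lborel. x \<in> K \<longrightarrow> h x = A i x (Du x)"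
      using h(2) K by (simp add: AE_restrict_space_iff AE_completion_iff)
    with g(3) have "AE x in lborel. x \<in> K \<longrightarrow> g x = A i x (Du x)"
      by eventually_elim auto
    then show ?thesis using g by blast
  qed
  from choice[OF allI[OF this]] obtain Gc where Gc: "\<forall>i. Gc i \<in> borel_measurable borel \<and> (\<forall>x. x \<notin> K \<longrightarrow> Gc i x = 0) \<and> (AE x in lborel. x \<in> K \<longrightarrow> Gc i x = A i x (Du x))"
    by (rule exE)
  define G where "G x = \<sigma> *\<^sub>R (\<chi> i. Gc i x)" for x
  have Gm: "G \<in> borel_measurable borel"
    unfolding G_def[abs_def] using Gc
    by (subst borel_measurable_euclidean_space) (auto simp: Basis_vec_def inner_axis intro!: borel_measurable_times)
  have Gz: "G x = 0" if "x \<notin> K" for x using Gc that by (simp add: G_def vec_eq_iff)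
  have Gae: "AE x in lborel. \<forall>i. x \<in> K \<longrightarrow> Gc i x = A i x (Du x)"
    using Gc by (intro eventually_all_finite) auto
  have vi: "integrable lborel (\<lambda>x. \<bar>v x\<bar> powr q)"
  proof (rule version_integrable_powr[OF K(3) v])
    have "integrable (lebesgue_on K) (\<lambda>x. norm (u x) powr q)"
      using ulp by (simp add: Lp_on_def)
    then show "integrable (lebesgue_on K) (\<lambda>x. \<bar>\<sigma> * u x $ \<alpha>\<bar> powr q)"
      by (rule Bochner_Integration.integrable_bound)
         (use nth[OF um] q1 component_le_norm_cart in \<open>auto simp: abs_mult \<sigma>a intro!: powr_mono2 AE_I2\<close>)
  qed (use q1 in auto)
  have di: "integrable lborel (\<lambda>x. \<bar>d x\<bar> powr q)"
    by (rule version_integrable_powr[OF K(3) d]) (use Dulp q1 in \<open>auto simp: Lp_on_def\<close>)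
  have bi: "integrable lborel (\<lambda>x. \<bar>b' x\<bar> powr (q / (q - 1)))"
    by (rule version_integrable_powr[OF K(3) b'])
       (use Lp_on_imp_integrable_powr[OF blp K(1) _ \<tau>(2)] q1 in auto)
  \<comment> \<open>The Borel version \<open>a'\<close> could be negative on a null set, so its
    absolute value serves as the nonnegative datum.\<close>
  have ai: "integrable lborel (\<lambda>x. \<bar>\<bar>a' x\<bar>\<bar> powr s)"
    using version_integrable_powr[OF K(3) a', of s] Lp_on_imp_integrable_powr[OF alp K(1) s0 s(2)] s0 by simp
  have Di: "integrable lborel (\<lambda>x. norm (D x) powr q)"
  proof (rule Bochner_Integration.integrable_bound[OF di])
    show "AE x in lborel. norm (norm (D x) powr q) \<le> norm (\<bar>d x\<bar> powr q)"
      using D(3) d(3)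
    proof eventually_elim
      case (elim x)
      show ?case
      proof (cases "x \<in> K")
        case True
        then have "norm (D x) \<le> \<bar>d x\<bar>"
          using elim Finite_Cartesian_Product.norm_nth_le[of "Du x" \<alpha>] by (simp add: \<sigma>a)
        then show ?thesis using q1 by (auto intro!: powr_mono2)
      qed (simp add: D(2))
    qed
  qed (use D(1) in measurable)
  have Gi: "integrable lborel (\<lambda>x. norm (G x) powr (q / (q - 1)))"
  proof (rule Bochner_Integration.integrable_bound)
    \<comment> \<open>The exponent conjugate to \<open>q\<close> turns \<open>|Du|^(q - 1)\<close>
      into \<open>|Du|^q\<close>, and the bound on \<open>\<tau>2\<close> makes \<open>b\<close>
      integrable to it.\<close>
    let ?r = "q / (q - 1)"
    show "integrable lborel (\<lambda>x. M powr ?r * (2 powr ?r * (\<bar>d x\<bar> powr q + \<bar>b' x\<bar> powr ?r)))"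
      using di bi by auto
    show "AE x in lborel. norm (norm (G x) powr ?r) \<le> norm (M powr ?r * (2 powr ?r * (\<bar>d x\<bar> powr q + \<bar>b' x\<bar> powr ?r)))"
      using Gae d(3) b'(3)
    proof eventually_elim
      case (elim x)
      show ?case
      proof (cases "x \<in> K")
        case True
        then have x: "x \<in> \<Omega>" using K by auto
        have "norm (G x) = norm (\<chi> i. Gc i x)" by (simp add: G_def \<sigma>a)
        also have "\<dots> \<le> (\<Sum>i\<in>UNIV. \<bar>A i x (Du x)\<bar>)"
          using norm_le_l1_cart[of "\<chi> i. Gc i x"] elim True by simp
        also have "\<dots> \<le> M * (norm (Du x) powr (q - 1) + b x)" by (rule grow[OF x])
        also have "\<dots> = M * (\<bar>d x\<bar> powr (q - 1) + \<bar>b' x\<bar>)"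
          using elim True b0[OF x] by simp
        finally have "norm (G x) powr ?r \<le> (M * (\<bar>d x\<bar> powr (q - 1) + \<bar>b' x\<bar>)) powr ?r"
          using q1 by (intro powr_mono2) auto
        also have "\<dots> = M powr ?r * (\<bar>d x\<bar> powr (q - 1) + \<bar>b' x\<bar>) powr ?r"
          by (rule powr_mult)
        also have "\<dots> \<le> M powr ?r * (2 powr ?r * ((\<bar>d x\<bar> powr (q - 1)) powr ?r + \<bar>b' x\<bar> powr ?r))"
          using q1 by (intro mult_left_mono powr_add_le) auto
        also have "(\<bar>d x\<bar> powr (q - 1)) powr ?r = \<bar>d x\<bar> powr q"
          using q1 by (simp add: powr_powr)
        finally show ?thesis by simp
      qed (simp add: Gz)
    qed
  qed (use Gm in measurable)
  have ball: "ball x0 R \<subseteq> K" "ball x0 R \<subseteq> \<Omega>" using R by (auto simp: K_def)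
  have weak: "(\<integral>x. v x * partial_deriv i \<phi> x \<partial>lborel) = - (\<integral>x. D x $ i * \<phi> x \<partial>lborel)"
    if \<phi>: "\<phi> \<in> test_functions (ball x0 R)" for \<phi> i
  proof -
    obtain L where L: "compact L" "L \<subseteq> ball x0 R" "\<And>x. x \<notin> L \<Longrightarrow> \<phi> x = 0" "\<And>x. x \<notin> L \<Longrightarrow> gradient \<phi> x = 0"
      using test_function_compact_support[OF \<phi>] by metis
    note m = test_function_measurable(1)[OF \<phi>] test_function_measurable(1)[OF test_functions_partial_deriv[OF \<phi>, of i]]
    have z: "\<phi> x = 0" "partial_deriv i \<phi> x = 0" if "x \<notin> K" for x
    proof -
      have "x \<notin> L" using that L(2) ball(1) by blast
      then show "\<phi> x = 0" "partial_deriv i \<phi> x = 0"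
        by (simp_all add: partial_deriv_gradient L(3,4))
    qed
    have 1: "(\<integral>x. \<sigma> * (u x $ \<alpha> * partial_deriv i \<phi> x) \<partial>lebesgue_on \<Omega>) = (\<integral>x. v x * partial_deriv i \<phi> x \<partial>lborel)"
    proof (rule lebesgue_on_eq_lborel(2))
      show "AE x in lborel. v x * partial_deriv i \<phi> x = indicator \<Omega> x * (\<sigma> * (u x $ \<alpha> * partial_deriv i \<phi> x))"
        using v(3)
      proof eventually_elim
        case (elim x)
        then show ?case using K z[of x] by (cases "x \<in> K") (auto simp: indicator_def)
      qed
    qed (use \<Omega> v m in auto)
    have 2: "(\<integral>x. \<sigma> * (Du x $ \<alpha> $ i * \<phi> x) \<partial>lebesgue_on \<Omega>) = (\<integral>x. D x $ i * \<phi> x \<partial>lborel)"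
    proof (rule lebesgue_on_eq_lborel(2))
      show "AE x in lborel. D x $ i * \<phi> x = indicator \<Omega> x * (\<sigma> * (Du x $ \<alpha> $ i * \<phi> x))"
        using D(3)
      proof eventually_elim
        case (elim x)
        then show ?case using K z[of x] by (cases "x \<in> K") (auto simp: indicator_def)
      qed
    qed (use \<Omega> nth[OF D(1)] m in auto)
    have "\<phi> \<in> test_functions \<Omega>" using \<phi> test_functions_mono[OF ball(2)] by blast
    then have "(\<integral>x. u x $ \<alpha> * partial_deriv i \<phi> x \<partial>lebesgue_on \<Omega>) = - (\<integral>x. Du x $ \<alpha> $ i * \<phi> x \<partial>lebesgue_on \<Omega>)"
      using u unfolding W1_loc_def has_weak_gradient_def by blast
    then show ?thesis
      unfolding 1[symmetric] 2[symmetric] by simp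
  qed
  have Geq: "(\<integral>x. G x \<bullet> gradient \<phi> x \<partial>lborel) = 0" if \<phi>: "\<phi> \<in> test_functions (ball x0 R)" for \<phi>
  proof -
    obtain L where L: "compact L" "L \<subseteq> ball x0 R" "\<And>x. x \<notin> L \<Longrightarrow> gradient \<phi> x = 0"
      using test_function_compact_support[OF \<phi>] by metis
    have z: "gradient \<phi> x = 0" if "x \<notin> ball x0 R" for x
      by (rule L(3)) (use that L(2) in blast)
    have "(\<integral>x. \<sigma> * (\<Sum>i\<in>UNIV. A i x (Du x) * gradient \<phi> x $ i) \<partial>lebesgue_on (ball x0 R)) = (\<integral>x. G x \<bullet> gradient \<phi> x \<partial>lborel)"
    proof (rule lebesgue_on_eq_lborel(2))
      show "AE x in lborel. G x \<bullet> gradient \<phi> x = indicator (ball x0 R) x * (\<sigma> * (\<Sum>i\<in>UNIV. A i x (Du x) * gradient \<phi> x $ i))"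
        using Gae
      proof eventually_elim
        case (elim x)
        show ?case
        proof (cases "x \<in> ball x0 R")
          case True
          then have "x \<in> K" using ball by auto
          then show ?thesis using True elim by (simp add: G_def inner_vec_def sum_distrib_left mult.assoc)
        qed (simp add: z)
      qed
    qed (use Gm test_function_measurable(2)[OF \<phi>] in auto)
    moreover have "(\<integral>x. (\<Sum>i\<in>UNIV. A i x (Du x) * gradient \<phi> x $ i) \<partial>lebesgue_on (ball x0 R)) = 0"
      by (rule eq[OF open_ball _ \<phi>]) (use R in \<open>simp add: compactly_contained_def\<close>)
    ultimately show ?thesis by simp
  qed
  have ell': "AE x in lborel. x \<in> ball x0 R \<longrightarrow> \<nu> * norm (D x) powr p - \<bar>a' x\<bar> \<le> G x \<bullet> D x"
    using D(3) a'(3) Gae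
  proof eventually_elim
    case (elim x)
    show ?case
    proof
      assume "x \<in> ball x0 R"
      then have x: "x \<in> K" "x \<in> \<Omega>" using ball by auto
      have "G x \<bullet> D x = (\<sigma> * \<sigma>) * (\<Sum>i\<in>UNIV. A i x (Du x) * Du x $ \<alpha> $ i)"
        using elim x by (simp add: G_def inner_vec_def sum_distrib_left mult_ac)
      moreover have "norm (D x) = norm (Du x $ \<alpha>)" using elim x by (simp add: \<sigma>a)
      moreover have "\<bar>a' x\<bar> = a x" using elim x a0 by simp
      ultimately show "\<nu> * norm (D x) powr p - \<bar>a' x\<bar> \<le> G x \<bullet> D x"
        using ell[OF x(2), of "Du x"] by (simp add: \<sigma>)
    qed
  qed
  have "\<exists>N. AE x in lborel. x \<in> cball x0 (R / 4) \<longrightarrow> v x \<le> N"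
  proof (rule weak_subsolution_upper_bound[where a = "\<lambda>x. \<bar>a' x\<bar>" and G = G and D = D and q = q and \<tau> = s and \<nu> = \<nu> and p = p and R = R])
    show "(\<integral>x. v x * partial_deriv i \<phi> x \<partial>lborel) = - (\<integral>x. D x $ i * \<phi> x \<partial>lborel)"
      if "\<phi> \<in> test_functions (ball x0 R)" for \<phi> i by (rule weak[OF that])
    show "(\<integral>x. G x \<bullet> gradient \<phi> x \<partial>lborel) = 0"
      if "\<phi> \<in> test_functions (ball x0 R)" for \<phi> by (rule Geq[OF that])
    show "integrable lborel (\<lambda>x. \<bar>\<bar>a' x\<bar>\<bar> powr s)" by (rule ai)
    show "AE x in lborel. x \<in> ball x0 R \<longrightarrow> \<nu> * norm (D x) powr p - \<bar>a' x\<bar> \<le> G x \<bullet> D x" by (rule ell')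
    show "v x = 0" "D x = 0" "\<bar>a' x\<bar> = 0" if "x \<notin> cball x0 R" for x
      using that v(2) D(2) a'(2) by (simp_all add: K_def)
    show "p * q < real CARD('n) * p / (real CARD('n) - p)" "real CARD('n) / p < s" "p < real CARD('n)"
      using q s p by (simp_all add: n_def)
  qed (use v(1) D(1) Gm a'(1) vi Di Gi \<nu> p R in auto)
  then obtain N where "AE x in lborel. x \<in> cball x0 (R / 4) \<longrightarrow> v x \<le> N" by blast
  with v(3) have "AE x in lborel. x \<in> cball x0 (R / 4) \<longrightarrow> \<sigma> * u x $ \<alpha> \<le> N"
  proof eventually_elim
    case (elim x)
    have "cball x0 (R / 4) \<subseteq> K" using R by (auto simp: K_def)
    then show ?case using elim by auto
  qed
  then show ?thesis by blast
qed

section \<open>From bounds on small balls to local boundedness\<close>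

theorem theorem1p1:
  fixes \<Omega> :: "(real^'n) set"
    and A :: "'m::finite \<Rightarrow> 'n \<Rightarrow> real^'n \<Rightarrow> real^'n^'m \<Rightarrow> real"
    and u :: "real^'n \<Rightarrow> real^'m"
    and a b :: "real^'n \<Rightarrow> real"
    and p q \<nu> M n :: real
    and \<tau>1 \<tau>2 :: ereal
  defines "n \<equiv> real CARD('n)"
  assumes "CARD('n) \<ge> 2"
    and "open \<Omega>" and "bounded \<Omega>"
    and "1 < p" and "p < n" and "p \<le> q"
    and "1 < \<tau>1" and "1 < \<tau>2"
    and "q < sobolev_exponent n p * (n / (p * (n + 1)))"
    and "\<tau>1 > ereal (n / p)"
    and "\<tau>2 \<ge> ereal (q / (q - 1))"
    and "\<And>\<alpha> i. caratheodory \<Omega> (A \<alpha> i)"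
    and "\<nu> > 0" and "M > 0"
    and "\<And>x. x \<in> \<Omega> \<Longrightarrow> a x \<ge> 0" and "\<And>x. x \<in> \<Omega> \<Longrightarrow> b x \<ge> 0"
    and "a \<in> Lp_loc \<tau>1 \<Omega>" and "b \<in> Lp_loc \<tau>2 \<Omega>"
    and "\<And>x z \<alpha>. x \<in> \<Omega> \<Longrightarrow>
           \<nu> * norm (z $ \<alpha>) powr p - a x \<le> (\<Sum>i\<in>UNIV. A \<alpha> i x z * z $ \<alpha> $ i)"
    and "\<And>x z \<alpha>. x \<in> \<Omega> \<Longrightarrow>
           (\<Sum>i\<in>UNIV. \<bar>A \<alpha> i x z\<bar>) \<le> M * (norm z powr (q - 1) + b x)"
    and "weak_solution q \<Omega> A u"
  shows "locally_bounded \<Omega> u"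
proof -
  note hyps = assms(2-)
  have p: "1 < p" "p < n" "p \<le> q" by fact+
  have n: "n > 0" using p by simp
  \<comment> \<open>After cancelling \<open>p\<close>, the assumed bound on \<open>q\<close> reads
    \<open>n / (n - p)\<close> times \<open>n / (n + 1)\<close>, and the last factor is at most
    1.\<close>
  have pq: "p * q < n * p / (n - p)"
  proof -
    have "q < n * p / (n - p) * (n / (p * (n + 1)))"
      using hyps by (simp add: sobolev_exponent_def)
    also have "\<dots> = n / (n - p) * (n / (n + 1))"
    proof -
      have "n * p / x * (n / (p * y)) = n / x * (n / y)" for x y
        using p by (cases "x = 0 \<or> y = 0") (auto simp: field_simps)
      then show ?thesis .
    qed
    also have "\<dots> \<le> n / (n - p) * 1"
      using p n by (intro mult_left_mono) auto
    finally have "p * q < p * (n / (n - p))"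
      using p by (intro mult_strict_left_mono) auto
    then show ?thesis by (simp add: mult.commute)
  qed
  obtain Du where Du: "W1_loc q \<Omega> u Du" and sol: "\<And>B \<psi> D\<psi>. open B \<Longrightarrow> compactly_contained B \<Omega> \<Longrightarrow> W1_0 q B \<psi> D\<psi> \<Longrightarrow>
           (LINT x|lebesgue_on B. (\<Sum>\<beta>\<in>UNIV. \<Sum>i\<in>UNIV. A \<beta> i x (Du x) * D\<psi> x $ \<beta> $ i)) = 0"
    using \<open>weak_solution q \<Omega> A u\<close> unfolding weak_solution_def by blast
  have eq: "(\<integral>x. (\<Sum>i\<in>UNIV. A \<alpha> i x (Du x) * gradient \<phi> x $ i) \<partial>lebesgue_on B) = 0"
    if "open B" "compactly_contained B \<Omega>" "\<phi> \<in> test_functions B" for B \<phi> \<alpha>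
  proof -
    have "(\<Sum>\<beta>\<in>UNIV. \<Sum>i\<in>UNIV. A \<beta> i x (Du x) * (axis \<alpha> (gradient \<phi> x) :: real^'n^'m) $ \<beta> $ i) = (\<Sum>i\<in>UNIV. A \<alpha> i x (Du x) * gradient \<phi> x $ i)" for x
    proof -
      have "(\<Sum>\<beta>\<in>UNIV. \<Sum>i\<in>UNIV. A \<beta> i x (Du x) * (axis \<alpha> (gradient \<phi> x) :: real^'n^'m) $ \<beta> $ i)
        = (\<Sum>\<beta>\<in>UNIV. if \<beta> = \<alpha> then \<Sum>i\<in>UNIV. A \<alpha> i x (Du x) * gradient \<phi> x $ i else 0)"
        by (intro sum.cong) (auto simp: axis_def)
      then show ?thesis by simp
    qed
    then show ?thesis
      using sol[OF that(1,2) W1_0_test_function[OF that(3,1)], of \<alpha>] p by simp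
  qed
  have bound: "\<exists>r C. r > 0 \<and> (AE x in lborel. x \<in> ball x0 r \<longrightarrow> norm (u x) \<le> C)" if x0: "x0 \<in> \<Omega>" for x0
  proof -
    obtain e where e: "e > 0" "cball x0 e \<subseteq> \<Omega>"
      using \<open>open \<Omega>\<close> x0 open_contains_cball by blast
    \<comment> \<open>The cap 1/2 matches the support condition of the Sobolev inequality.\<close>
    define R where "R = min e (1/2)"
    have R: "0 < R" "R \<le> 1/2" "cball x0 R \<subseteq> \<Omega>" using e by (auto simp: R_def)
    have bnd: "\<exists>N. AE x in lborel. x \<in> cball x0 (R / 4) \<longrightarrow> \<sigma> * u x $ \<alpha> \<le> N" if "\<sigma> * \<sigma> = 1" for \<sigma> \<alpha>
      by (rule component_upper_bound[where A = "A \<alpha>" and a = a and b = b and p = p and q = q and \<nu> = \<nu> and M = M and ?\<tau>1.0 = \<tau>1 and ?\<tau>2.0 = \<tau>2 and \<Omega> = \<Omega> and Du = Du])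
         (use hyps p pq Du eq that R in \<open>simp_all add: n_def\<close>)
    have "\<forall>\<alpha>. \<exists>N. AE x in lborel. x \<in> cball x0 (R / 4) \<longrightarrow> 1 * u x $ \<alpha> \<le> N"
      and "\<forall>\<alpha>. \<exists>N. AE x in lborel. x \<in> cball x0 (R / 4) \<longrightarrow> (-1) * u x $ \<alpha> \<le> N"
      by (intro allI bnd; simp)+
    from choice[OF this(1)] choice[OF this(2)] obtain N1 N2 where
      N: "\<forall>\<alpha>. AE x in lborel. x \<in> cball x0 (R / 4) \<longrightarrow> 1 * u x $ \<alpha> \<le> N1 \<alpha>"
        "\<forall>\<alpha>. AE x in lborel. x \<in> cball x0 (R / 4) \<longrightarrow> (-1) * u x $ \<alpha> \<le> N2 \<alpha>" by blast
    have "AE x in lborel. \<forall>\<alpha>. x \<in> cball x0 (R / 4) \<longrightarrow> 1 * u x $ \<alpha> \<le> N1 \<alpha>"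
      "AE x in lborel. \<forall>\<alpha>. x \<in> cball x0 (R / 4) \<longrightarrow> (-1) * u x $ \<alpha> \<le> N2 \<alpha>"
      using N by (intro eventually_all_finite; blast)+
    then have "AE x in lborel. x \<in> ball x0 (R / 4) \<longrightarrow> norm (u x) \<le> (\<Sum>\<alpha>\<in>UNIV. \<bar>N1 \<alpha>\<bar> + \<bar>N2 \<alpha>\<bar>)"
    proof eventually_elim
      case (elim x)
      show ?case
      proof
        assume "x \<in> ball x0 (R / 4)"
        then have x: "x \<in> cball x0 (R / 4)" by auto
        have "norm (u x) \<le> (\<Sum>\<alpha>\<in>UNIV. \<bar>u x $ \<alpha>\<bar>)" by (rule norm_le_l1_cart)
        also have "\<dots> \<le> (\<Sum>\<alpha>\<in>UNIV. \<bar>N1 \<alpha>\<bar> + \<bar>N2 \<alpha>\<bar>)"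
        proof (rule sum_mono)
          fix \<alpha>
          have "u x $ \<alpha> \<le> N1 \<alpha>" "- u x $ \<alpha> \<le> N2 \<alpha>" using elim x by auto
          then show "\<bar>u x $ \<alpha>\<bar> \<le> \<bar>N1 \<alpha>\<bar> + \<bar>N2 \<alpha>\<bar>" by linarith
        qed
        finally show "norm (u x) \<le> (\<Sum>\<alpha>\<in>UNIV. \<bar>N1 \<alpha>\<bar> + \<bar>N2 \<alpha>\<bar>)" .
      qed
    qed
    then show ?thesis
      using R by (intro exI[of _ "R / 4"] exI[of _ "\<Sum>\<alpha>\<in>UNIV. \<bar>N1 \<alpha>\<bar> + \<bar>N2 \<alpha>\<bar>"] conjI) auto
  qed
  \<comment> \<open>Radii and bounds are fixed for all centres in advance, so that compactness can
    select finitely many balls and the bounds can be added.\<close>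
  then have "\<forall>x0. \<exists>r. x0 \<in> \<Omega> \<longrightarrow> r > 0 \<and> (\<exists>C. AE x in lborel. x \<in> ball x0 r \<longrightarrow> norm (u x) \<le> C)" by blast
  from choice[OF this] obtain r where r: "\<forall>x0. x0 \<in> \<Omega> \<longrightarrow> r x0 > 0 \<and> (\<exists>C. AE x in lborel. x \<in> ball x0 (r x0) \<longrightarrow> norm (u x) \<le> C)"
    by (rule exE)
  then have "\<forall>x0. \<exists>C. x0 \<in> \<Omega> \<longrightarrow> (AE x in lborel. x \<in> ball x0 (r x0) \<longrightarrow> norm (u x) \<le> C)" by blast
  from choice[OF this] obtain C where C: "\<forall>x0. x0 \<in> \<Omega> \<longrightarrow> (AE x in lborel. x \<in> ball x0 (r x0) \<longrightarrow> norm (u x) \<le> C x0)"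
    by (rule exE)
  have "u \<in> Lp_on \<infinity> K" if K: "compact K" "K \<subseteq> \<Omega>" for K
  proof -
    have um: "u \<in> borel_measurable (lebesgue_on K)"
      using Du K by (auto simp: W1_loc_def Lp_loc_def Lp_on_def)
    have "K \<subseteq> (\<Union>x\<in>K. ball x (r x))" using r K by force
    then obtain T where T: "T \<subseteq> K" "finite T" "K \<subseteq> (\<Union>x\<in>T. ball x (r x))"
      using compactE_image[OF K(1), of K "\<lambda>x. ball x (r x)"] by auto
    have "AE x in lborel. \<forall>y\<in>T. x \<in> ball y (r y) \<longrightarrow> norm (u x) \<le> C y"
      using C T K by (intro AE_finite_allI) auto
    then have "AE x in lborel. x \<in> K \<longrightarrow> norm (u x) \<le> (\<Sum>y\<in>T. \<bar>C y\<bar>)"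
    proof eventually_elim
      case (elim x)
      show ?case
      proof
        assume "x \<in> K"
        then obtain y where y: "y \<in> T" "x \<in> ball y (r y)" using T by auto
        then have "norm (u x) \<le> \<bar>C y\<bar>" using elim by fastforce
        also have "\<dots> \<le> (\<Sum>y\<in>T. \<bar>C y\<bar>)" using y T by (intro member_le_sum) auto
        finally show "norm (u x) \<le> (\<Sum>y\<in>T. \<bar>C y\<bar>)" .
      qed
    qed
    then have "AE x in lebesgue_on K. norm (u x) \<le> (\<Sum>y\<in>T. \<bar>C y\<bar>)"
      using borel_compact[OF K(1)] by (subst AE_restrict_space_iff) (auto intro: AE_completion)
    then show ?thesis
      using um unfolding Lp_on_def infinity_ereal_def mem_Collect_eq ereal.case by blast
  qed
  then show ?thesis by (simp add: locally_bounded_def Lp_loc_def)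
qed

end
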